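(* Let $k$ be a field of characteristic zero, $n$ a natural number, and $(q_{11},\dots,q_{1n},q_{21},\dots,q_{2n})\in k^{2n}$. Let $S(T_n)$ be the symmetric algebra on rooted trees with $n$-coloured edges, with the Hopf algebra structure whose coproduct $\Delta$ is the one defined by $(q_{11},\dots,q_{2n})$ (see context). The graded dual $S(T_n)^*$ is the universal enveloping algebra of the Lie algebra which as a vector space is spanned by the elements $D_t$, where $t$ ranges over the $n$-coloured rooted trees, with bracket \[ [D_s,D_t]=D_t\bullet D_s-D_s\bullet D_t,\qquad\text{where}\qquad D_t\bullet D_s=\sum_{w}\ \sum_{s\subset w,\ s^c=t} q(s,w)\,D_w . \] Here the first sum ranges over all $n$-coloured rooted trees $w$, and the second sum over the subtrees of $w$ which are isomorphic to $s$ and whose complement $s^c$ is isomorphic to $t$.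
   Context: A rooted tree is an isomorphism class of finite posets which have a minimum element (the root), and in which $y\neq z$, $y<x$, $z<x$ imply $y<z$ or $z<y$. Elements are called vertices; a pair $v<w$ with no $x$ satisfying $v<x<w$ is called an edge, with lower vertex $v$. An $n$-coloured tree is an isomorphism class of such posets equipped with a function from the set of edges to $\{1,\dots,n\}$. $T_n$ is the $k$-vector space with basis the set of $n$-coloured trees. An $n$-coloured forest is a finite, possibly empty, multiset of $n$-coloured trees. $S(T_n)$ has as basis the $n$-coloured forests, with product the disjoint union; it is graded by the number of vertices. $S(T_n)^*$ is the graded linear dual, with the dual Hopf algebra structure; $D_u$ denotes the element of the basis of $S(T_n)^*$ dual to the basis of forests, corresponding to the forest $u$. A subforest $s$ of a forest $t$ is a subset of the vertices with the induced partial order, coloured as follows: an edge $v<w$ of $s$ gets the colour of the first edge (the one with lower vertex $v$) on the upward path from $v$ to $w$ in $t$. A subtree is a subforest that is a tree. $s^c$ is the complementary subforest. For a tree $t$, $s\subset t$ and $v\in s$, $p_j(v,s,t)$ is the number of edges of colour $j$ in the path in $t$ from $v$ to the root of $t$ whose lower vertex lies in $s^c$; for a forest $t$, $p_j(v,s,t):=p_j(v,s\cap t',t')$ with $t'$ the connected component of $t$ containing $v$. Put \[ q(s,t):=\prod_{j=1}^n\Big(\prod_{v\in s}q_{1j}^{\,p_j(v,s,t)}\cdot\prod_{v\in s^c}q_{2j}^{\,p_j(v,s^c,t)}\Big), \] with the convention $q^0=1$ for all $q\in k$, including $q=0$. The coproduct on $S(T_n)$ defined by $(q_{11},\dots,q_{2n})$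 is $\Delta(t)=\sum_{s\subset t}q(s,t)\,s\otimes s^c$ for every forest $t$, the sum being over all subforests $s$ of $t$; with this coproduct $S(T_n)$ is a graded connected commutative Hopf algebra. *)

theory Defs
  imports
    "HOL-Library.Multiset"
    "HOL-Library.FuncSet"
    "HOL-Library.Poly_Mapping"
    "HOL-Algebra.Module"
    "HOL-Algebra.Algebraic_Closure_Type"
begin

section \<open>Coloured forests and trees\<close>

text \<open>
  Every finite poset is isomorphic to one whose vertices are natural numbers. The order is stored
  as a strict order relation; the colouring is only meaningful on the edges.
\<close>

record cposet =
  verts :: "nat set"
  lessrel :: "nat rel"
  colour :: "nat \<times> nat \<Rightarrow> nat"

definition edges :: "cposet \<Rightarrow> nat rel" where
  "edges P = {(v, w) \<in> lessrel P. \<nexists>x. (v, x) \<in> lessrel P \<and> (x, w) \<in> lessrel P}"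

definition forest_poset :: "nat \<Rightarrow> cposet \<Rightarrow> bool" where
  "forest_poset n P \<longleftrightarrow>
     finite (verts P) \<and> lessrel P \<subseteq> verts P \<times> verts P \<and> irrefl (lessrel P) \<and> trans (lessrel P) \<and>
     (\<forall>x y z. y \<noteq> z \<and> (y, x) \<in> lessrel P \<and> (z, x) \<in> lessrel P \<longrightarrow>
        (y, z) \<in> lessrel P \<or> (z, y) \<in> lessrel P) \<and>
     (\<forall>e\<in>edges P. colour P e \<in> {1..n})"

definition tree_poset :: "nat \<Rightarrow> cposet \<Rightarrow> bool" where
  "tree_poset n P \<longleftrightarrow>
     forest_poset n P \<and> (\<exists>r\<in>verts P. \<forall>v\<in>verts P. v = r \<or> (r, v) \<in> lessrel P)"

definition isomorphic_posets :: "cposet \<Rightarrow> cposet \<Rightarrow> bool" where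
  "isomorphic_posets P Q \<longleftrightarrow>
     (\<exists>f. bij_betw f (verts P) (verts Q) \<and>
        (\<forall>v\<in>verts P. \<forall>w\<in>verts P. (v, w) \<in> lessrel P \<longleftrightarrow> (f v, f w) \<in> lessrel Q) \<and>
        (\<forall>(v, w)\<in>edges P. colour P (v, w) = colour Q (f v, f w)))"

definition tree_iso :: "nat \<Rightarrow> (cposet \<times> cposet) set" where
  "tree_iso n = {(P, Q). tree_poset n P \<and> tree_poset n Q \<and> isomorphic_posets P Q}"

type_synonym ctree = "cposet set"
type_synonym cforest = "ctree multiset"

definition ctrees :: "nat \<Rightarrow> ctree set" where
  "ctrees n = Collect (tree_poset n) // tree_iso n"

definition cforests :: "nat \<Rightarrow> cforest set" where
  "cforests n = {u. set_mset u \<subseteq> ctrees n}"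

text \<open>
  The induced subforest on \<open>s\<close>: an edge \<open>(v, w)\<close> of it is given the colour of the first edge
  \<open>(v, u)\<close> of the path from \<open>v\<close> to \<open>w\<close> in \<open>P\<close>.
\<close>

definition subforest :: "cposet \<Rightarrow> nat set \<Rightarrow> cposet" where
  "subforest P s =
     \<lparr> verts = s,
       lessrel = lessrel P \<inter> s \<times> s,
       colour = (\<lambda>(v, w). colour P (v, THE u. (v, u) \<in> edges P \<and> (u = w \<or> (u, w) \<in> lessrel P))) \<rparr>"

definition components :: "cposet \<Rightarrow> nat set set" where
  "components P = (\<lambda>v. (lessrel P \<union> (lessrel P)\<inverse>)\<^sup>* `` {v}) ` verts P"

text \<open>The multiset of coloured trees (isomorphism classes) formed by the components of \<open>P\<close>.\<close>

definition forest_class :: "nat \<Rightarrow> cposet \<Rightarrow> cforest" where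
  "forest_class n P = image_mset (\<lambda>C. tree_iso n `` {subforest P C}) (mset_set (components P))"

text \<open>A poset representing the forest \<open>u\<close>; it is determined by \<open>u\<close> up to isomorphism only.\<close>

definition forest_rep :: "nat \<Rightarrow> cforest \<Rightarrow> cposet" where
  "forest_rep n u = (SOME P. forest_poset n P \<and> forest_class n P = u)"

definition forest_degree :: "nat \<Rightarrow> cforest \<Rightarrow> nat" where
  "forest_degree n u = card (verts (forest_rep n u))"

text \<open>
  In a forest the edges of the path from \<open>v\<close> down to the root of its component are exactly the
  edges \<open>(x, y)\<close> with \<open>y \<le> v\<close>.
\<close>

definition path_count :: "nat \<Rightarrow> nat \<Rightarrow> nat set \<Rightarrow> cposet \<Rightarrow> nat" where
  "path_count j v s P =
     card {(x, y) \<in> edges P. (y = v \<or> (y, v) \<in> lessrel P) \<and> colour P (x, y) = j \<and> x \<in> verts P - s}"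

definition q_coeff ::
    "nat \<Rightarrow> (nat \<Rightarrow> 'k::field_char_0) \<Rightarrow> (nat \<Rightarrow> 'k) \<Rightarrow> nat set \<Rightarrow> cposet \<Rightarrow> 'k" where
  "q_coeff n q1 q2 s P =
     (\<Prod>j=1..n. (\<Prod>v\<in>s. q1 j ^ path_count j v s P) *
               (\<Prod>v\<in>verts P - s. q2 j ^ path_count j v (verts P - s) P))"


section \<open>The Hopf algebra of forests and its graded dual\<close>

text \<open>
  The symmetric algebra \<open>S(T\<^sub>n)\<close> consists of the elements of the type \<open>cforest \<Rightarrow>\<^sub>0 'k\<close> supported
  on \<open>n\<close>-coloured forests. Since addition of multisets is disjoint union, its product is the
  multiplication of \<open>Poly_Mapping\<close>. The tensor square of \<open>S(T\<^sub>n)\<close> is realised on the basis of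
  pairs of forests, in the type \<open>cforest \<times> cforest \<Rightarrow>\<^sub>0 'k\<close>.
\<close>

type_synonym 'k forest_alg = "cforest \<Rightarrow>\<^sub>0 'k"
type_synonym 'k functional = "'k forest_alg \<Rightarrow> 'k"

definition pm_scale :: "'k::field_char_0 \<Rightarrow> ('a \<Rightarrow>\<^sub>0 'k) \<Rightarrow> ('a \<Rightarrow>\<^sub>0 'k)" where
  "pm_scale c x = Poly_Mapping.map ((*) c) x"

definition forest_space :: "nat \<Rightarrow> 'k::field_char_0 forest_alg set" where
  "forest_space n = {x. Poly_Mapping.keys x \<subseteq> cforests n}"

definition coproduct_basis ::
    "nat \<Rightarrow> (nat \<Rightarrow> 'k::field_char_0) \<Rightarrow> (nat \<Rightarrow> 'k) \<Rightarrow> cforest \<Rightarrow> (cforest \<times> cforest \<Rightarrow>\<^sub>0 'k)" where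
  "coproduct_basis n q1 q2 u =
     (let P = forest_rep n u in
      \<Sum>s\<in>Pow (verts P).
        Poly_Mapping.single
          (forest_class n (subforest P s), forest_class n (subforest P (verts P - s)))
          (q_coeff n q1 q2 s P))"

definition coproduct ::
    "nat \<Rightarrow> (nat \<Rightarrow> 'k::field_char_0) \<Rightarrow> (nat \<Rightarrow> 'k) \<Rightarrow> 'k forest_alg \<Rightarrow> (cforest \<times> cforest \<Rightarrow>\<^sub>0 'k)" where
  "coproduct n q1 q2 x =
     (\<Sum>u\<in>Poly_Mapping.keys x. pm_scale (Poly_Mapping.lookup x u) (coproduct_basis n q1 q2 u))"

text \<open>
  Elements of the graded dual are the linear functionals on \<open>S(T\<^sub>n)\<close> that vanish in all
  sufficiently high degrees. They are extended by \<open>0\<close> to the ambient type, so that functionals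
  agreeing on \<open>S(T\<^sub>n)\<close> are equal.
\<close>

definition graded_dual_space :: "nat \<Rightarrow> 'k::field_char_0 functional set" where
  "graded_dual_space n =
     {\<phi>. (\<forall>x\<in>forest_space n. \<forall>y\<in>forest_space n. \<phi> (x + y) = \<phi> x + \<phi> y) \<and>
         (\<forall>c. \<forall>x\<in>forest_space n. \<phi> (pm_scale c x) = c * \<phi> x) \<and>
         (\<forall>x. x \<notin> forest_space n \<longrightarrow> \<phi> x = 0) \<and>
         (\<exists>N. \<forall>x\<in>forest_space n. (\<forall>u\<in>Poly_Mapping.keys x. N < forest_degree n u) \<longrightarrow> \<phi> x = 0)}"

definition D :: "nat \<Rightarrow> cforest \<Rightarrow> 'k::field_char_0 functional" where
  "D n u = (\<lambda>x. if x \<in> forest_space n then Poly_Mapping.lookup x u else 0)"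

definition tensor_functional ::
    "'k::field_char_0 functional \<Rightarrow> 'k functional \<Rightarrow> (cforest \<times> cforest \<Rightarrow>\<^sub>0 'k) \<Rightarrow> 'k" where
  "tensor_functional \<phi> \<psi> z =
     (\<Sum>(u, v)\<in>Poly_Mapping.keys z.
        Poly_Mapping.lookup z (u, v) * (\<phi> (Poly_Mapping.single u 1) * \<psi> (Poly_Mapping.single v 1)))"

definition dual_product ::
    "nat \<Rightarrow> (nat \<Rightarrow> 'k::field_char_0) \<Rightarrow> (nat \<Rightarrow> 'k) \<Rightarrow> 'k functional \<Rightarrow> 'k functional \<Rightarrow> 'k functional" where
  "dual_product n q1 q2 \<phi> \<psi> =
     (\<lambda>x. if x \<in> forest_space n then tensor_functional \<phi> \<psi> (coproduct n q1 q2 x) else 0)"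

text \<open>
  The coproduct of the dual, i.e. the transpose of the multiplication of \<open>S(T\<^sub>n)\<close>, with values in
  the functionals on the tensor square.
\<close>

definition dual_coproduct ::
    "'k::field_char_0 functional \<Rightarrow> (cforest \<times> cforest \<Rightarrow>\<^sub>0 'k) \<Rightarrow> 'k" where
  "dual_coproduct \<phi> z =
     (\<Sum>(u, v)\<in>Poly_Mapping.keys z.
        Poly_Mapping.lookup z (u, v) * \<phi> (Poly_Mapping.single u 1 * Poly_Mapping.single v 1))"

text \<open>The unit \<open>D n {#}\<close> is the counit of \<open>S(T\<^sub>n)\<close>.\<close>

definition graded_dual ::
    "nat \<Rightarrow> (nat \<Rightarrow> 'k::field_char_0) \<Rightarrow> (nat \<Rightarrow> 'k) \<Rightarrow> ('k, 'k functional) module" where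
  "graded_dual n q1 q2 =
     \<lparr> carrier = graded_dual_space n,
       monoid.mult = dual_product n q1 q2,
       one = D n {#},
       zero = (\<lambda>x. 0),
       add = (\<lambda>\<phi> \<psi> x. \<phi> x + \<psi> x),
       module.smult = (\<lambda>c \<phi> x. c * \<phi> x) \<rparr>"

definition primitive_functional :: "nat \<Rightarrow> 'k::field_char_0 functional \<Rightarrow> bool" where
  "primitive_functional n \<phi> \<longleftrightarrow>
     dual_coproduct \<phi> =
       (\<lambda>z. tensor_functional \<phi> (D n {#}) z + tensor_functional (D n {#}) \<phi> z)"


section \<open>The Lie algebra on trees\<close>

abbreviation Dt :: "nat \<Rightarrow> ctree \<Rightarrow> 'k::field_char_0 functional" where
  "Dt n t \<equiv> D n {#t#}"

text \<open>The inner sum of the formula for \<open>D\<^sub>t \<bullet> D\<^sub>s\<close>, computed in a representative of \<open>w\<close>.\<close>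

definition bullet_coeff ::
    "nat \<Rightarrow> (nat \<Rightarrow> 'k::field_char_0) \<Rightarrow> (nat \<Rightarrow> 'k) \<Rightarrow> ctree \<Rightarrow> ctree \<Rightarrow> ctree \<Rightarrow> 'k" where
  "bullet_coeff n q1 q2 t s w =
     (let P = (SOME P. P \<in> w) in
      \<Sum>a | a \<subseteq> verts P \<and> subforest P a \<in> s \<and> subforest P (verts P - a) \<in> t. q_coeff n q1 q2 a P)"

text \<open>
  \<open>bullet n q1 q2 t s\<close> is \<open>D\<^sub>t \<bullet> D\<^sub>s\<close>. The sum over all trees \<open>w\<close> has only finitely many nonzero
  terms, since \<open>w\<close> must have as many vertices as \<open>s\<close> and \<open>t\<close> together.
\<close>

definition bullet ::
    "nat \<Rightarrow> (nat \<Rightarrow> 'k::field_char_0) \<Rightarrow> (nat \<Rightarrow> 'k) \<Rightarrow> ctree \<Rightarrow> ctree \<Rightarrow> 'k functional" where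
  "bullet n q1 q2 t s =
     (\<lambda>x. \<Sum>w | w \<in> ctrees n \<and> bullet_coeff n q1 q2 t s w \<noteq> 0. bullet_coeff n q1 q2 t s w * Dt n w x)"

definition tree_span :: "nat \<Rightarrow> 'k::field_char_0 functional set" where
  "tree_span n = {\<phi>. \<exists>F c. finite F \<and> F \<subseteq> ctrees n \<and> \<phi> = (\<lambda>x. \<Sum>t\<in>F. c t * Dt n t x)}"

definition tree_support :: "nat \<Rightarrow> 'k::field_char_0 functional \<Rightarrow> ctree set" where
  "tree_support n \<phi> = {t \<in> ctrees n. \<phi> (Poly_Mapping.single {#t#} 1) \<noteq> 0}"

text \<open>
  The bilinear extension of \<open>[D\<^sub>s, D\<^sub>t] = D\<^sub>t \<bullet> D\<^sub>s - D\<^sub>s \<bullet> D\<^sub>t\<close> to \<open>tree_span n\<close>; the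
  coordinate of \<open>\<phi>\<close> at \<open>D\<^sub>t\<close> is its value at the tree \<open>t\<close>.
\<close>

definition tree_bracket ::
    "nat \<Rightarrow> (nat \<Rightarrow> 'k::field_char_0) \<Rightarrow> (nat \<Rightarrow> 'k) \<Rightarrow> 'k functional \<Rightarrow> 'k functional \<Rightarrow> 'k functional" where
  "tree_bracket n q1 q2 \<phi> \<psi> =
     (\<lambda>x. \<Sum>s\<in>tree_support n \<phi>. \<Sum>t\<in>tree_support n \<psi>.
        \<phi> (Poly_Mapping.single {#s#} 1) * \<psi> (Poly_Mapping.single {#t#} 1) *
        (bullet n q1 q2 t s x - bullet n q1 q2 s t x))"

text \<open>
  The vector space underlying the Lie algebra. Only the additive and scalar structure of this
  record matters; the bracket is carried separately.
\<close>

definition tree_lie ::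
    "nat \<Rightarrow> (nat \<Rightarrow> 'k::field_char_0) \<Rightarrow> (nat \<Rightarrow> 'k) \<Rightarrow> ('k, 'k functional) module" where
  "tree_lie n q1 q2 = (graded_dual n q1 q2) \<lparr> carrier := tree_span n \<rparr>"


section \<open>Lie algebras and universal enveloping algebras\<close>

locale lie_algebra = module R L for R (structure) and L (structure) +
  fixes bracket :: "'c \<Rightarrow> 'c \<Rightarrow> 'c"
  assumes bracket_closed: "\<lbrakk>x \<in> carrier L; y \<in> carrier L\<rbrakk> \<Longrightarrow> bracket x y \<in> carrier L"
    and bracket_add_left: "\<lbrakk>x \<in> carrier L; y \<in> carrier L; z \<in> carrier L\<rbrakk> \<Longrightarrow>
          bracket (x \<oplus>\<^bsub>L\<^esub> y) z = bracket x z \<oplus>\<^bsub>L\<^esub> bracket y z"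
    and bracket_add_right: "\<lbrakk>x \<in> carrier L; y \<in> carrier L; z \<in> carrier L\<rbrakk> \<Longrightarrow>
          bracket x (y \<oplus>\<^bsub>L\<^esub> z) = bracket x y \<oplus>\<^bsub>L\<^esub> bracket x z"
    and bracket_smult_left: "\<lbrakk>a \<in> carrier R; x \<in> carrier L; y \<in> carrier L\<rbrakk> \<Longrightarrow>
          bracket (a \<odot>\<^bsub>L\<^esub> x) y = a \<odot>\<^bsub>L\<^esub> bracket x y"
    and bracket_smult_right: "\<lbrakk>a \<in> carrier R; x \<in> carrier L; y \<in> carrier L\<rbrakk> \<Longrightarrow>
          bracket x (a \<odot>\<^bsub>L\<^esub> y) = a \<odot>\<^bsub>L\<^esub> bracket x y"
    and bracket_self: "x \<in> carrier L \<Longrightarrow> bracket x x = \<zero>\<^bsub>L\<^esub>"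
    and jacobi: "\<lbrakk>x \<in> carrier L; y \<in> carrier L; z \<in> carrier L\<rbrakk> \<Longrightarrow>
          bracket x (bracket y z) \<oplus>\<^bsub>L\<^esub> bracket y (bracket z x) \<oplus>\<^bsub>L\<^esub> bracket z (bracket x y) = \<zero>\<^bsub>L\<^esub>"

text \<open>
  Unital associative algebras; the locale \<open>algebra\<close> of HOL-Algebra only covers commutative ones.
\<close>

locale assoc_algebra = module R A + ring A for R (structure) and A (structure) +
  assumes smult_mult_left: "\<lbrakk>a \<in> carrier R; x \<in> carrier A; y \<in> carrier A\<rbrakk> \<Longrightarrow>
          (a \<odot>\<^bsub>A\<^esub> x) \<otimes>\<^bsub>A\<^esub> y = a \<odot>\<^bsub>A\<^esub> (x \<otimes>\<^bsub>A\<^esub> y)"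
    and smult_mult_right: "\<lbrakk>a \<in> carrier R; x \<in> carrier A; y \<in> carrier A\<rbrakk> \<Longrightarrow>
          x \<otimes>\<^bsub>A\<^esub> (a \<odot>\<^bsub>A\<^esub> y) = a \<odot>\<^bsub>A\<^esub> (x \<otimes>\<^bsub>A\<^esub> y)"

definition algebra_hom ::
    "('k, 'r) ring_scheme \<Rightarrow> ('k, 'a, 'm) module_scheme \<Rightarrow> ('k, 'b, 'p) module_scheme \<Rightarrow> ('a \<Rightarrow> 'b) set" where
  "algebra_hom R A B =
     {h \<in> ring_hom A B. \<forall>a\<in>carrier R. \<forall>x\<in>carrier A. h (a \<odot>\<^bsub>A\<^esub> x) = a \<odot>\<^bsub>B\<^esub> h x}"

text \<open>Lie algebra homomorphisms from \<open>L\<close> to \<open>A\<close> with its commutator bracket.\<close>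

definition lie_to_assoc_hom ::
    "('k, 'r) ring_scheme \<Rightarrow> ('k, 'l, 'm) module_scheme \<Rightarrow> ('l \<Rightarrow> 'l \<Rightarrow> 'l) \<Rightarrow>
     ('k, 'a, 'p) module_scheme \<Rightarrow> ('l \<Rightarrow> 'a) set" where
  "lie_to_assoc_hom R L bracket A =
     {f \<in> carrier L \<rightarrow> carrier A.
        (\<forall>x\<in>carrier L. \<forall>y\<in>carrier L. f (x \<oplus>\<^bsub>L\<^esub> y) = f x \<oplus>\<^bsub>A\<^esub> f y) \<and>
        (\<forall>a\<in>carrier R. \<forall>x\<in>carrier L. f (a \<odot>\<^bsub>L\<^esub> x) = a \<odot>\<^bsub>A\<^esub> f x) \<and>
        (\<forall>x\<in>carrier L. \<forall>y\<in>carrier L.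
           f (bracket x y) = (f x \<otimes>\<^bsub>A\<^esub> f y) \<ominus>\<^bsub>A\<^esub> (f y \<otimes>\<^bsub>A\<^esub> f x))}"

text \<open>
  The universal property of \<open>\<iota> : L \<rightarrow> U\<close>, tested on algebras whose carrier is an arbitrary subset
  of the type \<open>'b\<close>. Theorems should leave \<open>'b\<close> free, so that all types are covered.
\<close>

definition universal_enveloping_algebra ::
    "'b itself \<Rightarrow> 'k ring \<Rightarrow> ('k, 'l) module \<Rightarrow> ('l \<Rightarrow> 'l \<Rightarrow> 'l) \<Rightarrow> ('k, 'u) module \<Rightarrow>
     ('l \<Rightarrow> 'u) \<Rightarrow> bool" where
  "universal_enveloping_algebra _ R L bracket U \<iota> \<longleftrightarrow>
     lie_algebra R L bracket \<and> assoc_algebra R U \<and> \<iota> \<in> lie_to_assoc_hom R L bracket U \<and>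
     (\<forall>(A :: ('k, 'b) module) f.
        assoc_algebra R A \<and> f \<in> lie_to_assoc_hom R L bracket A \<longrightarrow>
        (\<exists>!F. F \<in> algebra_hom R U A \<and> F \<in> extensional (carrier U) \<and>
              (\<forall>x\<in>carrier L. F (\<iota> x) = f x)))"

end

theory Submission
  imports Defs
begin

text \<open>
  Extend the colouring from edges to all pairs \<open>x < v\<close> by giving such a pair the colour of the first
  edge from \<open>x\<close> to \<open>v\<close>. This is inherited by subforests, and \<open>q(s, t)\<close> becomes the product over all pairs
  \<open>x < v\<close> with exactly one member in \<open>s\<close>: a factor \<open>q\<^sub>1\<^sub>j\<close> if \<open>v \<in> s\<close> and \<open>q\<^sub>2\<^sub>j\<close> otherwise, \<open>j\<close> being the
  colour. Both iterated coproducts then assign to a partition of \<open>t\<close> into three parts the same product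
  over pairs from different parts, so the dual is associative.

  The product \<open>D\<^sub>t D\<^sub>v\<close> of a tree with a forest is a positive multiple of \<open>D\<^bsub>t + v\<^esub>\<close> plus forests with
  at most as many trees as \<open>v\<close>. For \<open>v\<close> a tree, these are the terms of the bullet product, so the
  commutator of \<open>D\<^sub>s\<close> and \<open>D\<^sub>t\<close> is the stated bracket. In general the formula allows one to extend a Lie
  homomorphism \<open>f\<close> to the \<open>D\<^sub>u\<close> by recursion on the number of trees of \<open>u\<close>, splitting off the least tree
  in a fixed well-order; the rule \<open>F(D\<^sub>t x) = f(D\<^sub>t) F(x)\<close> for the remaining \<open>t\<close> follows by induction,
  as in the straightening argument for the Poincare-Birkhoff-Witt theorem.
\<close>

section \<open>Posets of forests\<close>

text \<open>The dual basis elements \<open>D n u\<close> are not monomials in the trees: the leading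
  coefficient of \<open>Dt n t\<close> times \<open>D n v\<close> is the number of components of
  \<open>add_mset t v\<close> isomorphic to \<open>t\<close>. Solving for
  \<open>D n (add_mset t v)\<close> divides by this multiplicity, and this is where characteristic
  zero enters. The other terms are never computed; it is enough that deleting a subtree other than a
  full component cannot lower the number of components, which bounds their number of trees. Hence
  inductions run over the number of trees, while the number of vertices provides finiteness only. In
  the straightening step the associativity of the dual product does the work that the Jacobi
  identity does for an abstract enveloping algebra. The coproduct is defined through a chosen
  representative of each forest, whereas iterating it leads to subforests, which are different
  posets. Therefore forests must first be shown to have the same class exactly when they are
  isomorphic, so that coordinates of a product can be computed in any representative.\<close>

definition first_colour :: "cposet \<Rightarrow> nat \<times> nat \<Rightarrow> nat" where
  "first_colour P =
     (\<lambda>(v, w). colour P (v, THE u. (v, u) \<in> edges P \<and> (u = w \<or> (u, w) \<in> lessrel P)))"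

lemma subforest_simps [simp]:
  "verts (subforest P s) = s"
  "lessrel (subforest P s) = lessrel P \<inter> s \<times> s"
  "colour (subforest P s) = first_colour P"
  by (simp_all add: subforest_def first_colour_def)

lemma forest_posetD:
  assumes "forest_poset n P"
  shows "finite (verts P)" "lessrel P \<subseteq> verts P \<times> verts P" "irrefl (lessrel P)" "trans (lessrel P)"
    and "\<And>x y z. \<lbrakk>y \<noteq> z; (y, x) \<in> lessrel P; (z, x) \<in> lessrel P\<rbrakk> \<Longrightarrow>
           (y, z) \<in> lessrel P \<or> (z, y) \<in> lessrel P"
    and "\<And>e. e \<in> edges P \<Longrightarrow> colour P e \<in> {1..n}"
  using assms unfolding forest_poset_def by blast+

lemma forest_poset_wf:
  assumes "forest_poset n P"
  shows "wf (lessrel P)"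
proof (rule finite_acyclic_wf)
  show "finite (lessrel P)"
    using forest_posetD(1,2)[OF assms] by (meson finite_SigmaI finite_subset)
  show "acyclic (lessrel P)"
    using forest_posetD(3,4)[OF assms] by (simp add: acyclic_irrefl)
qed

lemma forest_poset_not_refl:
  assumes "forest_poset n P"
  shows "(x, x) \<notin> lessrel P"
  using forest_posetD(3)[OF assms] by (simp add: irrefl_def)

text \<open>Existence: a minimal vertex among those above \<open>v\<close> and weakly below
  \<open>w\<close> covers \<open>v\<close>. Uniqueness: two covers of \<open>v\<close> weakly below
  \<open>w\<close> are comparable by the forest axiom, so the smaller would separate
  \<open>v\<close> from the larger.\<close>

lemma first_edge_ex1:
  assumes P: "forest_poset n P" and vw: "(v, w) \<in> lessrel P"
  shows "\<exists>!u. (v, u) \<in> edges P \<and> (u = w \<or> (u, w) \<in> lessrel P)"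
proof -
  note tr = forest_posetD(4)[OF P]
  let ?S = "{u. (v, u) \<in> lessrel P \<and> (u = w \<or> (u, w) \<in> lessrel P)}"
  have "w \<in> ?S" using vw by simp
  then obtain u where u: "u \<in> ?S" and min: "\<And>y. (y, u) \<in> lessrel P \<Longrightarrow> y \<notin> ?S"
    by (rule wfE_min[OF forest_poset_wf[OF P]]) blast
  have "(v, u) \<in> edges P"
    unfolding edges_def using u min by (auto dest: transD[OF tr])
  moreover have "u' = u''"
    if "(v, u') \<in> edges P \<and> (u' = w \<or> (u', w) \<in> lessrel P)"
      "(v, u'') \<in> edges P \<and> (u'' = w \<or> (u'', w) \<in> lessrel P)" for u' u''
    using that forest_posetD(5)[OF P, of u' u'' w] unfolding edges_def by blast
  ultimately show ?thesis using u by blast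
qed

lemma first_colour_eqI:
  assumes "forest_poset n P" "(v, u) \<in> edges P" "u = w \<or> (u, w) \<in> lessrel P"
  shows "first_colour P (v, w) = colour P (v, u)"
proof -
  have "(v, w) \<in> lessrel P"
    using assms forest_posetD(4)[OF assms(1)] unfolding edges_def by (auto dest: transD)
  from the1_equality[OF first_edge_ex1[OF assms(1) this]] show ?thesis
    using assms(2,3) unfolding first_colour_def by auto
qed

lemma first_colour_edge:
  assumes "forest_poset n P" "e \<in> edges P"
  shows "first_colour P e = colour P e"
  using first_colour_eqI[OF assms(1), of "fst e" "snd e" "snd e"] assms(2) by simp

lemma first_edgeE:
  assumes "forest_poset n P" "(v, w) \<in> lessrel P"
  obtains u where "(v, u) \<in> edges P" "u = w \<or> (u, w) \<in> lessrel P"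
    "first_colour P (v, w) = colour P (v, u)"
  using first_edge_ex1[OF assms] first_colour_eqI[OF assms(1)] by blast

text \<open>The first edge from \<open>v\<close> towards \<open>u\<close> is also the first edge
  towards anything above \<open>u\<close>. So the colour of a pair is unchanged when its upper end
  moves up, which lets colours survive iterated restriction.\<close>

lemma first_colour_mono:
  assumes P: "forest_poset n P" and "(v, u) \<in> lessrel P" "(u, w) \<in> lessrel P"
  shows "first_colour P (v, u) = first_colour P (v, w)"
proof -
  obtain x where "(v, x) \<in> edges P" "x = u \<or> (x, u) \<in> lessrel P"
    "first_colour P (v, u) = colour P (v, x)"
    by (rule first_edgeE[OF P assms(2)])
  moreover have "x = w \<or> (x, w) \<in> lessrel P"
    using calculation(2) assms(3) transD[OF forest_posetD(4)[OF P]] by blast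
  ultimately show ?thesis using first_colour_eqI[OF P] by metis
qed

lemma first_colour_range:
  assumes "forest_poset n P" "e \<in> lessrel P"
  shows "first_colour P e \<in> {1..n}"
  using assms first_edgeE[of n P "fst e" "snd e"] forest_posetD(6)[OF assms(1)]
  by (metis prod.collapse)

lemma forest_poset_subforest:
  assumes P: "forest_poset n P" and s: "s \<subseteq> verts P"
  shows "forest_poset n (subforest P s)"
proof -
  note D = forest_posetD[OF P]
  have "first_colour P e \<in> {1..n}" if "e \<in> edges (subforest P s)" for e
    using that first_colour_range[OF P] unfolding edges_def by auto
  moreover have "trans (lessrel P \<inter> s \<times> s)" "irrefl (lessrel P \<inter> s \<times> s)"
    using D(3,4) by (auto simp: trans_def irrefl_def)
  ultimately show ?thesis
    unfolding forest_poset_def using D(1) s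
    by (simp add: finite_subset) (use D(5) in blast)
qed

text \<open>The first edge \<open>(v, u)\<close> in the subforest carries the
  \<open>first_colour\<close> of \<open>(v, u)\<close> in \<open>P\<close>, and raising
  \<open>u\<close> to \<open>w\<close> does not change it. On comparable pairs, taking subforests is
  thus transitive.\<close>

lemma first_colour_subforest:
  assumes P: "forest_poset n P" and s: "s \<subseteq> verts P" and vw: "(v, w) \<in> lessrel (subforest P s)"
  shows "first_colour (subforest P s) (v, w) = first_colour P (v, w)"
proof -
  obtain u where u: "(v, u) \<in> edges (subforest P s)" "u = w \<or> (u, w) \<in> lessrel (subforest P s)"
    "first_colour (subforest P s) (v, w) = colour (subforest P s) (v, u)"
    by (rule first_edgeE[OF forest_poset_subforest[OF P s] vw])
  moreover have "(v, u) \<in> lessrel P"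
    using u(1) by (auto simp: edges_def)
  ultimately show ?thesis
    using first_colour_mono[OF P, of v u w] by auto
qed


section \<open>Isomorphisms\<close>

text \<open>Colours are compared on all comparable pairs. In this form an isomorphism restricts to
  any set of vertices, whereas edges of a subforest need not be edges of the whole forest.\<close>

definition forest_iso :: "(nat \<Rightarrow> nat) \<Rightarrow> cposet \<Rightarrow> cposet \<Rightarrow> bool" where
  "forest_iso f P Q \<longleftrightarrow>
     bij_betw f (verts P) (verts Q) \<and>
     (\<forall>v\<in>verts P. \<forall>w\<in>verts P. (v, w) \<in> lessrel P \<longleftrightarrow> (f v, f w) \<in> lessrel Q) \<and>
     (\<forall>(v, w)\<in>lessrel P. first_colour P (v, w) = first_colour Q (f v, f w))"

text \<open>Stated for bare relations on vertex sets, so that it also applies while the target is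
  not yet known to be a forest.\<close>

lemma edges_bij_iff:
  assumes P: "lessrel P \<subseteq> verts P \<times> verts P" and Q: "lessrel Q \<subseteq> verts Q \<times> verts Q"
    and f: "bij_betw f (verts P) (verts Q)"
    and less: "\<forall>v\<in>verts P. \<forall>w\<in>verts P. (v, w) \<in> lessrel P \<longleftrightarrow> (f v, f w) \<in> lessrel Q"
    and "v \<in> verts P" "w \<in> verts P"
  shows "(v, w) \<in> edges P \<longleftrightarrow> (f v, f w) \<in> edges Q"
proof -
  have "(\<exists>x. (v, x) \<in> lessrel P \<and> (x, w) \<in> lessrel P) \<longleftrightarrow>
      (\<exists>y. (f v, y) \<in> lessrel Q \<and> (y, f w) \<in> lessrel Q)" (is "?l = ?r")
  proof
    assume ?l
    then show ?r using less P assms(5,6) by blast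
  next
    assume ?r
    then obtain y where y: "(f v, y) \<in> lessrel Q" "(y, f w) \<in> lessrel Q" by blast
    then obtain x where "x \<in> verts P" "y = f x"
      using Q f unfolding bij_betw_def by blast
    then show ?l using y less assms(5,6) by blast
  qed
  then show ?thesis using less assms(5,6) unfolding edges_def by auto
qed

text \<open>An order isomorphism preserves covers, so it maps the first edge from \<open>v\<close>
  to \<open>w\<close> to the first edge from \<open>f v\<close> to \<open>f w\<close>. Agreement of
  colours on edges therefore spreads to all comparable pairs.\<close>

lemma isomorphic_posets_iff:
  assumes P: "forest_poset n P" and Q: "forest_poset n Q"
  shows "isomorphic_posets P Q \<longleftrightarrow> (\<exists>f. forest_iso f P Q)"
proof
  assume "isomorphic_posets P Q"
  then obtain f where f: "bij_betw f (verts P) (verts Q)"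
    and less: "\<forall>v\<in>verts P. \<forall>w\<in>verts P. (v, w) \<in> lessrel P \<longleftrightarrow> (f v, f w) \<in> lessrel Q"
    and col: "\<forall>(v, w)\<in>edges P. colour P (v, w) = colour Q (f v, f w)"
    unfolding isomorphic_posets_def by blast
  note edge = edges_bij_iff[OF forest_posetD(2)[OF P] forest_posetD(2)[OF Q] f less]
  have "first_colour P (v, w) = first_colour Q (f v, f w)" if vw: "(v, w) \<in> lessrel P" for v w
  proof -
    obtain u where u: "(v, u) \<in> edges P" "u = w \<or> (u, w) \<in> lessrel P"
      "first_colour P (v, w) = colour P (v, u)"
      by (rule first_edgeE[OF P vw])
    have V: "v \<in> verts P" "u \<in> verts P" "w \<in> verts P"
      using u(1) vw forest_posetD(2)[OF P] unfolding edges_def by auto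
    have "first_colour Q (f v, f w) = colour Q (f v, f u)"
      by (rule first_colour_eqI[OF Q]) (use edge V u less in blast)+
    then show ?thesis using col u by auto
  qed
  with f less show "\<exists>f. forest_iso f P Q" unfolding forest_iso_def by blast
next
  assume "\<exists>f. forest_iso f P Q"
  then obtain f where f: "bij_betw f (verts P) (verts Q)"
    and less: "\<forall>v\<in>verts P. \<forall>w\<in>verts P. (v, w) \<in> lessrel P \<longleftrightarrow> (f v, f w) \<in> lessrel Q"
    and col: "\<forall>(v, w)\<in>lessrel P. first_colour P (v, w) = first_colour Q (f v, f w)"
    unfolding forest_iso_def by blast
  note edge = edges_bij_iff[OF forest_posetD(2)[OF P] forest_posetD(2)[OF Q] f less]
  have "colour P (v, w) = colour Q (f v, f w)" if vw: "(v, w) \<in> edges P" for v w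
  proof -
    have "(v, w) \<in> lessrel P" using vw by (simp add: edges_def)
    moreover have "(f v, f w) \<in> edges Q"
      using vw edge calculation forest_posetD(2)[OF P] by blast
    ultimately show ?thesis
      using col first_colour_edge[OF P vw] first_colour_edge[OF Q] by fastforce
  qed
  with f less show "isomorphic_posets P Q" unfolding isomorphic_posets_def by blast
qed

lemma forest_iso_bij: "forest_iso f P Q \<Longrightarrow> bij_betw f (verts P) (verts Q)"
  by (simp add: forest_iso_def)

lemma forest_iso_less:
  "\<lbrakk>forest_iso f P Q; v \<in> verts P; w \<in> verts P\<rbrakk> \<Longrightarrow> (f v, f w) \<in> lessrel Q \<longleftrightarrow> (v, w) \<in> lessrel P"
  by (simp add: forest_iso_def)

lemma forest_iso_colour:
  "\<lbrakk>forest_iso f P Q; (v, w) \<in> lessrel P\<rbrakk> \<Longrightarrow>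
     first_colour Q (f v, f w) = first_colour P (v, w)"
  by (fastforce simp: forest_iso_def)

lemma forest_iso_id: "forest_iso id P P"
  by (auto simp: forest_iso_def)

lemma forest_iso_comp:
  assumes "lessrel P \<subseteq> verts P \<times> verts P" "forest_iso f P Q" "forest_iso g Q R"
  shows "forest_iso (g \<circ> f) P R"
proof -
  have "f v \<in> verts Q" if "v \<in> verts P" for v
    using forest_iso_bij[OF assms(2)] that by (auto simp: bij_betw_def)
  then have V: "f v \<in> verts Q \<and> f w \<in> verts Q" if "v \<in> verts P" "w \<in> verts P" for v w
    using that by blast
  have "(v, w) \<in> lessrel P \<longleftrightarrow> (g (f v), g (f w)) \<in> lessrel R" if "v \<in> verts P" "w \<in> verts P" for v w
    using forest_iso_less[OF assms(2) that] forest_iso_less[OF assms(3), of "f v" "f w"] V[OF that]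
    by blast
  moreover have "first_colour P (v, w) = first_colour R (g (f v), g (f w))"
    if "(v, w) \<in> lessrel P" for v w
  proof -
    have "v \<in> verts P" "w \<in> verts P" using that assms(1) by auto
    then show ?thesis
      using that forest_iso_less[OF assms(2), of v w] forest_iso_colour[OF assms(2), of v w]
        forest_iso_colour[OF assms(3), of "f v" "f w"] by simp
  qed
  ultimately show ?thesis
    using bij_betw_trans[OF forest_iso_bij[OF assms(2)] forest_iso_bij[OF assms(3)]]
    unfolding forest_iso_def by auto
qed

lemma forest_iso_inv:
  assumes Q: "lessrel Q \<subseteq> verts Q \<times> verts Q" and f: "forest_iso f P Q"
  shows "forest_iso (inv_into (verts P) f) Q P"
proof -
  let ?g = "inv_into (verts P) f"
  have g: "?g y \<in> verts P" "f (?g y) = y" if "y \<in> verts Q" for y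
    using forest_iso_bij[OF f] that by (auto simp: bij_betw_def inv_into_into f_inv_into_f)
  have less: "(x, y) \<in> lessrel Q \<longleftrightarrow> (?g x, ?g y) \<in> lessrel P"
    if "x \<in> verts Q" "y \<in> verts Q" for x y
    using forest_iso_less[OF f g(1)[OF that(1)] g(1)[OF that(2)]] g(2) that by simp
  moreover have "first_colour Q (x, y) = first_colour P (?g x, ?g y)" if "(x, y) \<in> lessrel Q" for x y
  proof -
    have "x \<in> verts Q" "y \<in> verts Q" using that Q by auto
    then show ?thesis
      using forest_iso_colour[OF f, of "?g x" "?g y"] less[of x y] g(2) that by metis
  qed
  ultimately show ?thesis
    using bij_betw_inv_into[OF forest_iso_bij[OF f]] unfolding forest_iso_def by blast
qed

lemma forest_iso_subforest:
  assumes P: "forest_poset n P" and Q: "forest_poset n Q" and f: "forest_iso f P Q"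
    and s: "s \<subseteq> verts P"
  shows "forest_iso f (subforest P s) (subforest Q (f ` s))"
proof -
  have fs: "f ` s \<subseteq> verts Q"
    using forest_iso_bij[OF f] s by (auto simp: bij_betw_def)
  have "first_colour (subforest P s) (v, w) = first_colour (subforest Q (f ` s)) (f v, f w)"
    if "(v, w) \<in> lessrel (subforest P s)" for v w
  proof -
    have "(f v, f w) \<in> lessrel (subforest Q (f ` s))"
      using that s forest_iso_less[OF f] by auto
    with that show ?thesis
      using forest_iso_colour[OF f, of v w] first_colour_subforest[OF P s]
        first_colour_subforest[OF Q fs] by simp
  qed
  moreover have "bij_betw f s (f ` s)"
    using forest_iso_bij[OF f] s by (meson bij_betw_subset)
  moreover have "(v, w) \<in> lessrel (subforest P s) \<longleftrightarrow> (f v, f w) \<in> lessrel (subforest Q (f ` s))"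
    if "v \<in> s" "w \<in> s" for v w
    using that s forest_iso_less[OF f, of v w] by auto
  ultimately show ?thesis
    unfolding forest_iso_def by auto
qed

text \<open>The two posets can differ as records: off the comparable pairs, their colour functions
  may rest on a definite description without a witness. Hence an isomorphism by \<open>id\<close>
  instead of an equation.\<close>

lemma forest_iso_subforest_subforest:
  assumes P: "forest_poset n P" and "s \<subseteq> verts P" "s' \<subseteq> s"
  shows "forest_iso id (subforest (subforest P s) s') (subforest P s')"
proof -
  have "first_colour (subforest (subforest P s) s') (v, w) = first_colour (subforest P s') (v, w)"
    if "(v, w) \<in> lessrel (subforest (subforest P s) s')" for v w
    using that assms first_colour_subforest[OF P] forest_poset_subforest[OF P]
      first_colour_subforest[OF forest_poset_subforest[OF P], of s s'] by auto
  then show ?thesis using assms(3) unfolding forest_iso_def by auto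
qed

lemma forest_iso_subforest_verts:
  assumes P: "forest_poset n P"
  shows "forest_iso id (subforest P (verts P)) P"
  using first_colour_subforest[OF P subset_refl] forest_posetD(2)[OF P]
  unfolding forest_iso_def by auto


section \<open>Isomorphism classes of trees\<close>

abbreviation tree_class :: "nat \<Rightarrow> cposet \<Rightarrow> ctree" where
  "tree_class n P \<equiv> tree_iso n `` {P}"

lemma equiv_tree_iso: "equiv (Collect (tree_poset n)) (tree_iso n)"
proof (rule equivI)
  show "tree_iso n \<subseteq> Collect (tree_poset n) \<times> Collect (tree_poset n)"
    by (auto simp: tree_iso_def)
  have F: "forest_poset n P" if "tree_poset n P" for P
    using that by (simp add: tree_poset_def)
  have iso: "(P, Q) \<in> tree_iso n \<longleftrightarrow> tree_poset n P \<and> tree_poset n Q \<and> (\<exists>f. forest_iso f P Q)" for P Q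
    using isomorphic_posets_iff[of n P Q] by (auto simp: tree_iso_def tree_poset_def)
  have less: "lessrel P \<subseteq> verts P \<times> verts P" if "tree_poset n P" for P
    using that forest_posetD(2) by (auto simp: tree_poset_def)
  show "refl_on (Collect (tree_poset n)) (tree_iso n)"
    using forest_iso_id by (auto simp: refl_on_def iso)
  show "sym (tree_iso n)"
    unfolding sym_def iso using forest_iso_inv less by blast
  show "trans (tree_iso n)"
    unfolding trans_def iso using forest_iso_comp less by blast
qed

lemma tree_class_eq_iff:
  assumes "tree_poset n P" "tree_poset n Q"
  shows "tree_class n P = tree_class n Q \<longleftrightarrow> (\<exists>f. forest_iso f P Q)"
proof -
  have "tree_class n P = tree_class n Q \<longleftrightarrow> (P, Q) \<in> tree_iso n"
    using eq_equiv_class_iff[OF equiv_tree_iso] assms by simp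
  also have "\<dots> \<longleftrightarrow> (\<exists>f. forest_iso f P Q)"
    using assms isomorphic_posets_iff[of n P Q] by (auto simp: tree_iso_def tree_poset_def)
  finally show ?thesis .
qed

lemma tree_class_in_ctrees: "tree_poset n P \<Longrightarrow> tree_class n P \<in> ctrees n"
  unfolding ctrees_def by (rule quotientI) simp

lemma in_ctreesE:
  assumes "t \<in> ctrees n"
  obtains P where "tree_poset n P" "t = tree_class n P"
  using assms unfolding ctrees_def by (auto elim: quotientE)

lemma in_ctree_iff:
  assumes "t \<in> ctrees n"
  shows "P \<in> t \<longleftrightarrow> tree_poset n P \<and> tree_class n P = t"
proof -
  obtain Q where Q: "tree_poset n Q" "t = tree_class n Q" by (rule in_ctreesE[OF assms])
  have "P \<in> t \<longleftrightarrow> (Q, P) \<in> tree_iso n" using Q by simp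
  also have "\<dots> \<longleftrightarrow> tree_poset n P \<and> tree_class n Q = tree_class n P"
    using Q eq_equiv_class_iff[OF equiv_tree_iso, of Q n P] by (auto simp: tree_iso_def)
  finally show ?thesis using Q by auto
qed

section \<open>Components\<close>

definition roots :: "cposet \<Rightarrow> nat set" where
  "roots P = {r \<in> verts P. \<forall>x. (x, r) \<notin> lessrel P}"

definition up_set :: "cposet \<Rightarrow> nat \<Rightarrow> nat set" where
  "up_set P r = insert r {v. (r, v) \<in> lessrel P}"

lemma finite_roots: "forest_poset n P \<Longrightarrow> finite (roots P)"
  using forest_posetD(1) by (simp add: roots_def)

lemma up_set_subset:
  "\<lbrakk>forest_poset n P; r \<in> verts P\<rbrakk> \<Longrightarrow> up_set P r \<subseteq> verts P"
  using forest_posetD(2) unfolding up_set_def by blast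

lemma ex_root_below:
  assumes P: "forest_poset n P" and v: "v \<in> verts P"
  shows "\<exists>r\<in>roots P. v \<in> up_set P r"
proof -
  let ?S = "{u \<in> verts P. v \<in> up_set P u}"
  have "v \<in> ?S" using v by (simp add: up_set_def)
  then obtain r where r: "r \<in> ?S" and min: "\<And>y. (y, r) \<in> lessrel P \<Longrightarrow> y \<notin> ?S"
    by (rule wfE_min[OF forest_poset_wf[OF P]]) blast
  have "(y, r) \<notin> lessrel P" for y
    using r min[of y] forest_posetD(2)[OF P] transD[OF forest_posetD(4)[OF P], of y r v]
    unfolding up_set_def by auto
  then show ?thesis using r unfolding roots_def by blast
qed

lemma root_below_unique:
  assumes P: "forest_poset n P" and "r \<in> roots P" "r' \<in> roots P" "v \<in> up_set P r" "v \<in> up_set P r'"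
  shows "r = r'"
  using assms(2-) forest_posetD(5)[OF P, of r r' v] unfolding roots_def up_set_def by auto

text \<open>Upwards by transitivity. Downwards, \<open>x\<close> has some root below it, this root
  is also below \<open>y\<close>, and \<open>y\<close> has only one root below it.\<close>

lemma up_set_less:
  assumes P: "forest_poset n P" and r: "r \<in> roots P" and xy: "(x, y) \<in> lessrel P"
  shows "x \<in> up_set P r \<longleftrightarrow> y \<in> up_set P r"
proof
  assume "x \<in> up_set P r"
  then show "y \<in> up_set P r"
    using xy transD[OF forest_posetD(4)[OF P], of r x y] unfolding up_set_def by auto
next
  assume y: "y \<in> up_set P r"
  obtain r' where r': "r' \<in> roots P" "x \<in> up_set P r'"
    using ex_root_below[OF P, of x] xy forest_posetD(2)[OF P] by blast
  then have "y \<in> up_set P r'"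
    using xy transD[OF forest_posetD(4)[OF P], of r' x y] unfolding up_set_def by auto
  then show "x \<in> up_set P r"
    using root_below_unique[OF P r r'(1) y] r'(2) by simp
qed

text \<open>No relation leaves the up-set of a root, and all its members are connected through the
  root. Roots can thus serve as an index set for the components.\<close>

lemma components_eq:
  assumes P: "forest_poset n P"
  shows "components P = up_set P ` roots P"
proof -
  let ?E = "lessrel P \<union> (lessrel P)\<inverse>"
  have comp: "?E\<^sup>* `` {v} = up_set P r" if r: "r \<in> roots P" and v: "v \<in> up_set P r" for v r
  proof
    have "w \<in> up_set P r" if "(v, w) \<in> ?E\<^sup>*" for w
      using that by (induction rule: rtrancl_induct) (use v up_set_less[OF P r] in auto)
    then show "?E\<^sup>* `` {v} \<subseteq> up_set P r" by blast
    have "(x, r) \<in> ?E\<^sup>*" "(r, x) \<in> ?E\<^sup>*" if "x \<in> up_set P r" for x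
      using that unfolding up_set_def by auto
    then show "up_set P r \<subseteq> ?E\<^sup>* `` {v}" using v by (auto intro: rtrancl_trans)
  qed
  show ?thesis
  proof
    show "components P \<subseteq> up_set P ` roots P"
    proof
      fix C assume "C \<in> components P"
      then obtain v where v: "v \<in> verts P" "C = ?E\<^sup>* `` {v}" by (auto simp: components_def)
      then show "C \<in> up_set P ` roots P" using ex_root_below[OF P v(1)] comp by auto
    qed
    have "up_set P r \<in> components P" if "r \<in> roots P" for r
      unfolding components_def using comp[OF that, of r] that
      by (auto simp: up_set_def roots_def intro!: image_eqI[of _ _ r])
    then show "up_set P ` roots P \<subseteq> components P" by blast
  qed
qed

lemma inj_on_up_set:
  assumes "forest_poset n P"
  shows "inj_on (up_set P) (roots P)"
proof (rule inj_onI)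
  fix r r' assume r: "r \<in> roots P" "r' \<in> roots P" and "up_set P r = up_set P r'"
  then have "r \<in> up_set P r" "r \<in> up_set P r'" by (auto simp: up_set_def)
  with r show "r = r'" by (rule root_below_unique[OF assms])
qed

lemma forest_class_roots:
  assumes "forest_poset n P"
  shows "forest_class n P =
    image_mset (\<lambda>r. tree_class n (subforest P (up_set P r))) (mset_set (roots P))"
  unfolding forest_class_def components_eq[OF assms]
    image_mset_mset_set[OF inj_on_up_set[OF assms], symmetric]
  by (simp add: multiset.map_comp comp_def)

lemma size_forest_class:
  "forest_poset n P \<Longrightarrow> size (forest_class n P) = card (roots P)"
  by (simp add: forest_class_roots)

lemma tree_poset_up_set:
  assumes "forest_poset n P" "r \<in> verts P"
  shows "tree_poset n (subforest P (up_set P r))"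
  unfolding tree_poset_def
  using forest_poset_subforest[OF assms(1) up_set_subset[OF assms]]
  by (auto simp: up_set_def intro!: bexI[of _ r])

lemma forest_class_in_cforests:
  assumes "forest_poset n P"
  shows "forest_class n P \<in> cforests n"
proof -
  have "tree_class n (subforest P (up_set P r)) \<in> ctrees n" if "r \<in> roots P" for r
    using that by (intro tree_class_in_ctrees tree_poset_up_set[OF assms]) (simp add: roots_def)
  then show ?thesis
    using finite_roots[OF assms] by (auto simp: cforests_def forest_class_roots[OF assms])
qed

lemma forest_class_iso:
  assumes P: "forest_poset n P" and Q: "forest_poset n Q" and f: "forest_iso f P Q"
  shows "forest_class n P = forest_class n Q"
proof -
  have PV: "lessrel P \<subseteq> verts P \<times> verts P" and QV: "lessrel Q \<subseteq> verts Q \<times> verts Q"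
    using P Q by (simp_all add: forest_posetD(2))
  note less = forest_iso_less[OF f]
  have fV: "f ` verts P = verts Q" and inj: "inj_on f (verts P)"
    using forest_iso_bij[OF f] by (simp_all add: bij_betw_def)
  have roots: "roots Q = f ` roots P"
  proof -
    have "f r \<in> roots Q \<longleftrightarrow> r \<in> roots P" if r: "r \<in> verts P" for r
    proof -
      have "(\<exists>y. (y, f r) \<in> lessrel Q) \<longleftrightarrow> (\<exists>x. (x, r) \<in> lessrel P)"
      proof
        assume "\<exists>y. (y, f r) \<in> lessrel Q"
        then obtain y where y: "(y, f r) \<in> lessrel Q" by blast
        with QV have "y \<in> f ` verts P" unfolding fV by blast
        then obtain x where "x \<in> verts P" "(f x, f r) \<in> lessrel Q" using y by blast
        then show "\<exists>x. (x, r) \<in> lessrel P" using less r by blast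
      next
        assume "\<exists>x. (x, r) \<in> lessrel P"
        then show "\<exists>y. (y, f r) \<in> lessrel Q" using less r PV by blast
      qed
      then show ?thesis using r fV by (auto simp: roots_def)
    qed
    moreover have "roots P \<subseteq> verts P" "roots Q \<subseteq> f ` verts P"
      using fV by (auto simp: roots_def)
    ultimately show ?thesis by blast
  qed
  have up: "up_set Q (f r) = f ` up_set P r" if r: "r \<in> verts P" for r
  proof -
    have "(f r, y) \<in> lessrel Q \<longleftrightarrow> (\<exists>x. (r, x) \<in> lessrel P \<and> y = f x)" for y
    proof
      assume y: "(f r, y) \<in> lessrel Q"
      with QV have "y \<in> f ` verts P" unfolding fV by blast
      then obtain x where "x \<in> verts P" "y = f x" by blast
      then show "\<exists>x. (r, x) \<in> lessrel P \<and> y = f x" using less r y by blast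
    next
      assume "\<exists>x. (r, x) \<in> lessrel P \<and> y = f x"
      then show "(f r, y) \<in> lessrel Q" using less r PV by blast
    qed
    then show ?thesis unfolding up_set_def by auto
  qed
  have "tree_class n (subforest Q (up_set Q (f r))) = tree_class n (subforest P (up_set P r))"
    if "r \<in> roots P" for r
  proof -
    have r: "r \<in> verts P" using that by (simp add: roots_def)
    have fr: "f r \<in> verts Q" using r fV by blast
    show ?thesis
      using tree_class_eq_iff[OF tree_poset_up_set[OF P r] tree_poset_up_set[OF Q fr]]
        forest_iso_subforest[OF P Q f up_set_subset[OF P r]] unfolding up[OF r] by metis
  qed
  then have "forest_class n P =
      image_mset (\<lambda>r. tree_class n (subforest Q (up_set Q (f r)))) (mset_set (roots P))"
    unfolding forest_class_roots[OF P]
    by (intro image_mset_cong) (simp add: finite_roots[OF P])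
  also have "\<dots> = forest_class n Q"
  proof -
    have "inj_on f (roots P)"
      using inj by (rule inj_on_subset) (auto simp: roots_def)
    then show ?thesis
      unfolding forest_class_roots[OF Q] roots
      by (simp add: image_mset_mset_set[symmetric] multiset.map_comp comp_def)
  qed
  finally show ?thesis .
qed

text \<open>Equal images have equally large fibres over each value; the bijection is built by
  removing an element and a partner with the same value. It is used to pair the roots of two forests
  of the same class.\<close>

lemma image_mset_eq_bij_betw:
  assumes "finite A" "finite B" "image_mset f (mset_set A) = image_mset g (mset_set B)"
  shows "\<exists>h. bij_betw h A B \<and> (\<forall>a\<in>A. g (h a) = f a)"
  using assms
proof (induction A arbitrary: B rule: finite_induct)
  case empty
  then have "B = {}" by (simp add: mset_set_empty_iff)
  then show ?case by (simp add: bij_betw_def)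
next
  case (insert a A)
  then have eq: "add_mset (f a) (image_mset f (mset_set A)) = image_mset g (mset_set B)" by simp
  then have "f a \<in># image_mset g (mset_set B)" by (metis union_single_eq_member)
  then obtain b where b: "b \<in> B" "g b = f a" using insert.prems(1) by auto
  then have "mset_set B = add_mset b (mset_set (B - {b}))"
    using insert.prems(1) by (simp add: mset_set.remove)
  then have "image_mset f (mset_set A) = image_mset g (mset_set (B - {b}))"
    using eq b(2) by simp
  then obtain h where h: "bij_betw h A (B - {b})" "\<forall>a\<in>A. g (h a) = f a"
    using insert.IH[of "B - {b}"] insert.prems(1) by auto
  have "bij_betw (h(a := b)) A (B - {b})"
    using h(1) insert.hyps(2) by (subst bij_betw_cong[of _ _ h]) auto
  then have "bij_betw (\<lambda>x. if x = a then b else h x) (insert a A) B"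
    using notIn_Un_bij_betw[of a A "h(a := b)" "B - {b}"] insert.hyps(2) b(1)
    by (simp add: insert_absorb fun_upd_def)
  then show ?case using h(2) b(2) insert.hyps(2) by (intro exI[of _ "\<lambda>x. if x = a then b else h x"]) auto
qed

text \<open>Roots are matched so that the trees above them are isomorphic, and the isomorphisms
  chosen for the single trees are glued. This direction makes quantities attached to a class
  independent of the representative.\<close>

lemma forest_class_eq_imp_iso:
  assumes P: "forest_poset n P" and Q: "forest_poset n Q"
    and eq: "forest_class n P = forest_class n Q"
  shows "\<exists>f. forest_iso f P Q"
proof -
  obtain h where h: "bij_betw h (roots P) (roots Q)"
    and cls: "\<And>r. r \<in> roots P \<Longrightarrow> tree_class n (subforest Q (up_set Q (h r))) =
        tree_class n (subforest P (up_set P r))"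
    using image_mset_eq_bij_betw[OF finite_roots[OF P] finite_roots[OF Q]
        eq[unfolded forest_class_roots[OF P] forest_class_roots[OF Q]]] by blast
  have hQ: "h r \<in> roots Q" if "r \<in> roots P" for r using h that by (auto simp: bij_betw_def)
  have RP: "r \<in> verts P" if "r \<in> roots P" for r using that by (simp add: roots_def)
  have RQ: "r \<in> verts Q" if "r \<in> roots Q" for r using that by (simp add: roots_def)
  have "\<exists>f. forest_iso f (subforest P (up_set P r)) (subforest Q (up_set Q (h r)))"
    if r: "r \<in> roots P" for r
    using tree_class_eq_iff[OF tree_poset_up_set[OF P RP[OF r]] tree_poset_up_set[OF Q RQ[OF hQ[OF r]]]]
      cls[OF r] by simp
  then obtain f where f: "\<And>r. r \<in> roots P \<Longrightarrow>
      forest_iso (f r) (subforest P (up_set P r)) (subforest Q (up_set Q (h r)))" by metis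
  define root where "root v = (THE r. r \<in> roots P \<and> v \<in> up_set P r)" for v
  have root: "root v = r" if "r \<in> roots P" "v \<in> up_set P r" for v r
    unfolding root_def using that root_below_unique[OF P] by (intro the_equality) blast+
  have rootE: "root v \<in> roots P" "v \<in> up_set P (root v)" if "v \<in> verts P" for v
    using ex_root_below[OF P that] root by auto
  define F where "F v = f (root v) v" for v
  have Fbij: "bij_betw F (up_set P r) (up_set Q (h r))" if "r \<in> roots P" for r
    using forest_iso_bij[OF f[OF that]] root[OF that]
    by (subst bij_betw_cong[of _ _ "f r"]) (auto simp: F_def)
  have Fin: "F v \<in> up_set Q (h r)" if "r \<in> roots P" "v \<in> up_set P r" for v r
    using Fbij[OF that(1)] that(2) by (auto simp: bij_betw_def)
  \<comment> \<open>Images of different components lie above different roots of \<open>Q\<close>,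
    since \<open>h\<close> is injective and each vertex of \<open>Q\<close> has only one root below
    it.\<close>
  have same: "root v = root w" if "v \<in> verts P" "w \<in> verts P" "F v \<in> up_set Q (h r)"
    "F w \<in> up_set Q (h r)" "r \<in> roots P" for v w r
  proof -
    have "root v = r" if "v \<in> verts P" "F v \<in> up_set Q (h r)" "r \<in> roots P" for v r
    proof -
      have "h (root v) = h r"
        using root_below_unique[OF Q hQ hQ Fin] rootE that by blast
      then show ?thesis using h that rootE(1) by (auto simp: bij_betw_def inj_on_def)
    qed
    then show ?thesis using that by metis
  qed
  have "bij_betw F (verts P) (verts Q)"
  proof (rule bij_betw_imageI)
    show "inj_on F (verts P)"
    proof (rule inj_onI)
      fix v w assume vw: "v \<in> verts P" "w \<in> verts P" "F v = F w"
      have "F v \<in> up_set Q (h (root v))" using Fin rootE vw(1) by blast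
      with vw have "root v = root w" using same[of v w "root v"] rootE(1) by simp
      then show "v = w"
        using Fbij[OF rootE(1)[OF vw(1)]] rootE(2)[OF vw(1)] rootE(2)[OF vw(2)] vw(3)
        by (metis bij_betw_def inj_onD)
    qed
    show "F ` verts P = verts Q"
    proof
      show "F ` verts P \<subseteq> verts Q"
        using Fin rootE hQ RQ up_set_subset[OF Q] by blast
      show "verts Q \<subseteq> F ` verts P"
      proof
        fix y assume "y \<in> verts Q"
        then obtain r' where r': "r' \<in> roots Q" "y \<in> up_set Q r'"
          using ex_root_below[OF Q] by blast
        then obtain r where r: "r \<in> roots P" "r' = h r" using h by (auto simp: bij_betw_def)
        then show "y \<in> F ` verts P"
          using bij_betw_imp_surj_on[OF Fbij[OF r(1)]] r'(2) up_set_subset[OF P RP[OF r(1)]] by blast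
      qed
    qed
  qed
  moreover have "(v, w) \<in> lessrel P \<longleftrightarrow> (F v, F w) \<in> lessrel Q"
    if v: "v \<in> verts P" and w: "w \<in> verts P" for v w
  proof (cases "root v = root w")
    case True
    let ?r = "root v"
    have up: "v \<in> up_set P ?r" "w \<in> up_set P ?r" using rootE v w True by metis+
    have r: "?r \<in> roots P" using rootE v by blast
    show ?thesis
      using forest_iso_less[OF f[OF r], of v w] up Fin[OF r up(1)] Fin[OF r up(2)] True[symmetric]
      by (simp add: F_def)
  next
    case False
    \<comment> \<open>Comparable vertices share a component, in \<open>P\<close> and, after applying
      \<open>F\<close>, in \<open>Q\<close>; for different roots both sides of the equivalence are
      false.\<close>
    have "(v, w) \<notin> lessrel P"
      using False up_set_less[OF P rootE(1)[OF v]] rootE(2)[OF v] root[OF rootE(1)[OF v]] by metis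
    moreover have "(F v, F w) \<notin> lessrel Q"
    proof
      assume "(F v, F w) \<in> lessrel Q"
      moreover have "F v \<in> up_set Q (h (root v))" using Fin rootE v by blast
      ultimately have "F w \<in> up_set Q (h (root v))"
        using up_set_less[OF Q hQ[OF rootE(1)[OF v]]] by blast
      then show False
        using False same[OF v w \<open>F v \<in> up_set Q (h (root v))\<close>] rootE(1)[OF v] by blast
    qed
    ultimately show ?thesis by blast
  qed
  moreover have "first_colour P (v, w) = first_colour Q (F v, F w)" if vw: "(v, w) \<in> lessrel P" for v w
  proof -
    have v: "v \<in> verts P" and w: "w \<in> verts P" using vw forest_posetD(2)[OF P] by blast+
    let ?r = "root v"
    have r: "?r \<in> roots P" "v \<in> up_set P ?r" using rootE[OF v] by blast+
    then have wr: "w \<in> up_set P ?r" using up_set_less[OF P r(1) vw] by blast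
    then have [simp]: "root w = ?r" using root r(1) by blast
    let ?P = "subforest P (up_set P ?r)" and ?Q = "subforest Q (up_set Q (h ?r))"
    have "(v, w) \<in> lessrel ?P" using vw r wr by simp
    then have "first_colour ?P (v, w) = first_colour ?Q (F v, F w)" "(F v, F w) \<in> lessrel ?Q"
      using forest_iso_colour[OF f[OF r(1)], of v w] forest_iso_less[OF f[OF r(1)], of v w] r wr
      by (simp_all add: F_def)
    then show ?thesis
      using first_colour_subforest[OF P up_set_subset[OF P RP[OF r(1)]]]
        first_colour_subforest[OF Q up_set_subset[OF Q RQ[OF hQ[OF r(1)]]]]
        \<open>(v, w) \<in> lessrel ?P\<close> by metis
  qed
  ultimately have "forest_iso F P Q" unfolding forest_iso_def by blast
  then show ?thesis by blast
qed

lemma forest_class_eq_iff: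
  assumes "forest_poset n P" "forest_poset n Q"
  shows "forest_class n P = forest_class n Q \<longleftrightarrow> (\<exists>f. forest_iso f P Q)"
  using forest_class_iso[OF assms] forest_class_eq_imp_iso[OF assms] by blast

lemma forest_class_tree:
  assumes "tree_poset n P"
  shows "forest_class n P = {#tree_class n P#}"
proof -
  have P: "forest_poset n P" using assms by (simp add: tree_poset_def)
  obtain r where r: "r \<in> verts P" "\<forall>v\<in>verts P. v = r \<or> (r, v) \<in> lessrel P"
    using assms unfolding tree_poset_def by blast
  have "up_set P r = verts P"
    using r up_set_subset[OF P r(1)] unfolding up_set_def by auto
  moreover have "roots P = {r}"
    using r forest_poset_wf[OF P] forest_posetD(2)[OF P] unfolding roots_def
    by (auto dest: wf_asym)
  moreover have "tree_class n (subforest P (verts P)) = tree_class n P"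
    using tree_class_eq_iff[of n "subforest P (verts P)" P] forest_iso_subforest_verts[OF P] assms
      tree_poset_up_set[OF P r(1)] calculation(1) by auto
  ultimately show ?thesis by (simp add: forest_class_roots[OF P])
qed

lemma forest_class_empty_iff:
  assumes "forest_poset n P"
  shows "forest_class n P = {#} \<longleftrightarrow> verts P = {}"
proof -
  have "roots P = {} \<longleftrightarrow> verts P = {}"
    using ex_root_below[OF assms] unfolding roots_def by blast
  then show ?thesis
    using finite_roots[OF assms] by (simp add: forest_class_roots[OF assms] mset_set_empty_iff)
qed

lemma forest_class_single_imp_tree:
  assumes P: "forest_poset n P" and "forest_class n P = {#t#}"
  shows "tree_poset n P" "tree_class n P = t"
proof -
  have "card (roots P) = 1"
    using size_forest_class[OF P] assms(2) by simp
  then obtain r where r: "roots P = {r}" using card_1_singletonE by blast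
  then have "\<forall>v\<in>verts P. v = r \<or> (r, v) \<in> lessrel P"
    using ex_root_below[OF P] unfolding up_set_def by auto
  moreover have "r \<in> verts P" using r by (auto simp: roots_def)
  ultimately show tree: "tree_poset n P" using P unfolding tree_poset_def by blast
  show "tree_class n P = t" using forest_class_tree[OF tree] assms(2) by simp
qed

lemma forest_class_single_iff:
  assumes "forest_poset n P" "t \<in> ctrees n"
  shows "forest_class n P = {#t#} \<longleftrightarrow> P \<in> t"
  using assms forest_class_single_imp_tree[OF assms(1)] forest_class_tree in_ctree_iff by metis

text \<open>Each block is a union of components: its roots are the roots of \<open>P\<close> inside
  it and the trees above them stay the same up to isomorphism, so the multiset indexed by roots
  splits.\<close>

lemma forest_class_disjoint_union:
  assumes P: "forest_poset n P" and V: "verts P = A \<union> B" "A \<inter> B = {}"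
    and sep: "\<And>a b. \<lbrakk>a \<in> A; b \<in> B\<rbrakk> \<Longrightarrow> (a, b) \<notin> lessrel P \<and> (b, a) \<notin> lessrel P"
  shows "forest_class n P = forest_class n (subforest P A) + forest_class n (subforest P B)"
proof -
  have part: "roots (subforest P C) = roots P \<inter> C \<and>
      forest_class n (subforest P C) =
        image_mset (\<lambda>r. tree_class n (subforest P (up_set P r))) (mset_set (roots P \<inter> C))"
    if C: "C \<subseteq> verts P" and sep: "\<And>x y. (x, y) \<in> lessrel P \<Longrightarrow> x \<in> C \<longleftrightarrow> y \<in> C" for C
  proof
    note S = forest_poset_subforest[OF P C]
    show roots: "roots (subforest P C) = roots P \<inter> C"
      using C sep by (auto simp: roots_def)
    have "tree_class n (subforest (subforest P C) (up_set (subforest P C) r)) =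
        tree_class n (subforest P (up_set P r))" if r: "r \<in> roots P \<inter> C" for r
    proof -
      have up: "up_set (subforest P C) r = up_set P r" "up_set P r \<subseteq> C"
        using r sep by (auto simp: up_set_def)
      have rV: "r \<in> verts P" "r \<in> verts (subforest P C)" using r by (auto simp: roots_def)
      show ?thesis
        using tree_class_eq_iff[OF tree_poset_up_set[OF S rV(2)] tree_poset_up_set[OF P rV(1)]]
          forest_iso_subforest_subforest[OF P C up(2)] up(1) by auto
    qed
    then show "forest_class n (subforest P C) =
        image_mset (\<lambda>r. tree_class n (subforest P (up_set P r))) (mset_set (roots P \<inter> C))"
      unfolding forest_class_roots[OF S] roots
      by (intro image_mset_cong) (simp add: finite_roots[OF P])
  qed
  have less: "(x, y) \<in> lessrel P \<Longrightarrow> x \<in> A \<longleftrightarrow> y \<in> A" "(x, y) \<in> lessrel P \<Longrightarrow> x \<in> B \<longleftrightarrow> y \<in> B" for x y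
    using sep V forest_posetD(2)[OF P] by blast+
  have "mset_set (roots P) = mset_set (roots P \<inter> A) + mset_set (roots P \<inter> B)"
    using V finite_roots[OF P]
    by (subst mset_set_Union[symmetric]) (auto simp: roots_def intro: arg_cong[of _ _ mset_set])
  then show ?thesis
    using part[of A] part[of B] less V(1) by (simp add: forest_class_roots[OF P])
qed

section \<open>Representatives of forests\<close>

lemma forest_poset_transfer:
  assumes P: "forest_poset n P" and Q: "lessrel Q \<subseteq> verts Q \<times> verts Q"
    and f: "bij_betw f (verts P) (verts Q)"
    and less: "\<forall>v\<in>verts P. \<forall>w\<in>verts P. (v, w) \<in> lessrel P \<longleftrightarrow> (f v, f w) \<in> lessrel Q"
    and col: "\<And>e. e \<in> edges Q \<Longrightarrow> colour Q e \<in> {1..n}"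
  shows "forest_poset n Q"
proof -
  have V: "\<exists>v\<in>verts P. x = f v" if "x \<in> verts Q" for x
    using that bij_betw_imp_surj_on[OF f] by blast
  have rel: "\<exists>v\<in>verts P. \<exists>w\<in>verts P. x = f v \<and> y = f w \<and> (v, w) \<in> lessrel P"
    if xy: "(x, y) \<in> lessrel Q" for x y
  proof -
    have "x \<in> verts Q" "y \<in> verts Q" using xy Q by auto
    then obtain v w where "v \<in> verts P" "w \<in> verts P" "x = f v" "y = f w" using V by meson
    with xy less show ?thesis by blast
  qed
  have inj: "v = w" if "f v = f w" "v \<in> verts P" "w \<in> verts P" for v w
    using that f by (auto simp: bij_betw_def inj_on_def)
  have "irrefl (lessrel Q)"
    unfolding irrefl_def using rel inj forest_poset_not_refl[OF P] by metis
  moreover have "trans (lessrel Q)"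
  proof (rule transI)
    fix x y z assume "(x, y) \<in> lessrel Q" "(y, z) \<in> lessrel Q"
    then obtain u v v' w where "u \<in> verts P" "v \<in> verts P" "v' \<in> verts P" "w \<in> verts P"
      "x = f u" "y = f v" "y = f v'" "z = f w" "(u, v) \<in> lessrel P" "(v', w) \<in> lessrel P"
      using rel by metis
    moreover have "v = v'" using inj calculation by metis
    ultimately show "(x, z) \<in> lessrel Q"
      using less transD[OF forest_posetD(4)[OF P]] by metis
  qed
  moreover have "(y, z) \<in> lessrel Q \<or> (z, y) \<in> lessrel Q"
    if yz: "y \<noteq> z" "(y, x) \<in> lessrel Q" "(z, x) \<in> lessrel Q" for x y z
  proof -
    obtain u v v' w where "u \<in> verts P" "v \<in> verts P" "v' \<in> verts P" "w \<in> verts P"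
      "x = f u" "y = f v" "x = f v'" "z = f w" "(v, u) \<in> lessrel P" "(w, v') \<in> lessrel P"
      using rel[OF yz(2)] rel[OF yz(3)] by blast
    moreover have "u = v'" using inj calculation by metis
    ultimately show ?thesis using less forest_posetD(5)[OF P, of v w u] yz(1) by metis
  qed
  moreover have "finite (verts Q)"
    using forest_posetD(1)[OF P] bij_betw_finite[OF f] by simp
  ultimately show ?thesis
    using Q col unfolding forest_poset_def by blast
qed

text \<open>The colours off the edges are reset to \<open>0\<close>, so that only finitely many posets on a given set of
  vertices arise as images.\<close>

definition poset_image :: "(nat \<Rightarrow> nat) \<Rightarrow> cposet \<Rightarrow> cposet" where
  "poset_image f P =
     \<lparr> verts = f ` verts P,
       lessrel = map_prod f f ` lessrel P,
       colour = (\<lambda>e. if e \<in> map_prod f f ` edges P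
                     then colour P (map_prod (inv_into (verts P) f) (inv_into (verts P) f) e) else 0) \<rparr>"

lemma poset_image:
  assumes P: "forest_poset n P" and inj: "inj_on f (verts P)"
  shows "forest_poset n (poset_image f P)" "isomorphic_posets P (poset_image f P)"
proof -
  let ?Q = "poset_image f P"
  have bij: "bij_betw f (verts P) (verts ?Q)"
    using inj by (simp add: bij_betw_def poset_image_def)
  have QV: "lessrel ?Q \<subseteq> verts ?Q \<times> verts ?Q"
    using forest_posetD(2)[OF P] by (auto simp: poset_image_def)
  have less: "\<forall>v\<in>verts P. \<forall>w\<in>verts P. (v, w) \<in> lessrel P \<longleftrightarrow> (f v, f w) \<in> lessrel ?Q"
  proof (intro ballI iffI)
    fix v w assume vw: "v \<in> verts P" "w \<in> verts P" "(f v, f w) \<in> lessrel ?Q"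
    then obtain a b where ab: "(a, b) \<in> lessrel P" "f v = f a" "f w = f b"
      by (auto simp: poset_image_def)
    moreover have "a \<in> verts P" "b \<in> verts P" using ab forest_posetD(2)[OF P] by auto
    ultimately show "(v, w) \<in> lessrel P" using vw inj by (auto simp: inj_on_def)
  qed (auto simp: poset_image_def intro!: rev_image_eqI)
  note edge = edges_bij_iff[OF forest_posetD(2)[OF P] QV bij less]
  have colour: "colour ?Q (f v, f w) = colour P (v, w)" if "(v, w) \<in> edges P" for v w
  proof -
    have "(v, w) \<in> lessrel P" using that by (simp add: edges_def)
    then have "v \<in> verts P" "w \<in> verts P" using forest_posetD(2)[OF P] by auto
    then show ?thesis using that inj by (auto simp: poset_image_def inv_into_f_f)
  qed
  show "isomorphic_posets P ?Q"
    unfolding isomorphic_posets_def using bij less colour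
    by (intro exI[of _ f]) auto
  show "forest_poset n ?Q"
  proof (rule forest_poset_transfer[OF P QV bij less])
    fix e assume e: "e \<in> edges ?Q"
    then have "e \<in> lessrel ?Q" by (auto simp: edges_def)
    then have "e \<in> verts ?Q \<times> verts ?Q" using QV by blast
    then obtain v w where vw: "v \<in> verts P" "w \<in> verts P" "e = (f v, f w)"
      by (auto simp: poset_image_def)
    then have "(v, w) \<in> edges P" using edge e by blast
    then show "colour ?Q e \<in> {1..n}"
      using colour forest_posetD(6)[OF P] vw(3) by metis
  qed
qed

lemma forest_class_poset_image:
  assumes "forest_poset n P" "inj_on f (verts P)"
  shows "forest_class n (poset_image f P) = forest_class n P"
proof -
  have "\<exists>g. forest_iso g P (poset_image f P)"
    using poset_image[OF assms] isomorphic_posets_iff[OF assms(1)] by blast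
  then show ?thesis
    using forest_class_eq_iff[OF assms(1) poset_image(1)[OF assms]] by simp
qed

definition poset_sum :: "cposet \<Rightarrow> cposet \<Rightarrow> cposet" where
  "poset_sum P Q =
     \<lparr> verts = verts P \<union> verts Q, lessrel = lessrel P \<union> lessrel Q,
       colour = (\<lambda>e. if e \<in> lessrel P then colour P e else colour Q e) \<rparr>"

text \<open>With disjoint vertex sets an edge of the sum is an edge of exactly one summand. The
  summands reappear as induced subforests up to isomorphism, which determines their classes.\<close>

lemma poset_sum:
  assumes P: "forest_poset n P" and Q: "forest_poset n Q" and disj: "verts P \<inter> verts Q = {}"
  shows "forest_poset n (poset_sum P Q)"
    and "forest_class n (poset_sum P Q) = forest_class n P + forest_class n Q"
proof -
  let ?S = "poset_sum P Q"
  have S: "verts ?S = verts P \<union> verts Q" "lessrel ?S = lessrel P \<union> lessrel Q"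
    by (simp_all add: poset_sum_def)
  note PD = forest_posetD[OF P] and QD = forest_posetD[OF Q]
  have excl: "x \<in> verts P \<and> y \<in> verts P \<and> x \<notin> verts Q \<and> y \<notin> verts Q" if "(x, y) \<in> lessrel P" for x y
    using that PD(2) disj by blast
  have excl': "x \<in> verts Q \<and> y \<in> verts Q \<and> x \<notin> verts P \<and> y \<notin> verts P" if "(x, y) \<in> lessrel Q" for x y
    using that QD(2) disj by blast
  have edges: "edges ?S = edges P \<union> edges Q"
    unfolding edges_def S using excl excl' by blast
  have colP: "colour ?S e = colour P e" if "e \<in> edges P" for e
    using that by (auto simp: poset_sum_def edges_def)
  have colQ: "colour ?S e = colour Q e" if "e \<in> edges Q" for e
    using that excl excl' by (cases e) (auto simp: poset_sum_def edges_def)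
  have "irrefl (lessrel ?S)" using PD(3) QD(3) by (simp add: S irrefl_def)
  moreover have "trans (lessrel ?S)"
    using PD(4) QD(4) excl excl' unfolding S trans_def by blast
  moreover have "(y, z) \<in> lessrel ?S \<or> (z, y) \<in> lessrel ?S"
    if "y \<noteq> z" "(y, x) \<in> lessrel ?S" "(z, x) \<in> lessrel ?S" for x y z
    using that PD(5)[of y z x] QD(5)[of y z x] excl[of y x] excl'[of y x] excl[of z x] excl'[of z x]
    unfolding S by blast
  moreover have "colour ?S e \<in> {1..n}" if "e \<in> edges ?S" for e
    using that colP colQ PD(6) QD(6) unfolding edges by (metis Un_iff)
  ultimately show F: "forest_poset n ?S"
    using PD(1,2) QD(1,2) unfolding forest_poset_def S by blast
  have sub: "forest_class n (subforest ?S (verts T)) = forest_class n T"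
    if T: "forest_poset n T" and TV: "verts T \<subseteq> verts ?S"
      and less: "lessrel ?S \<inter> verts T \<times> verts T = lessrel T"
      and E: "edges T \<subseteq> edges ?S" and col: "\<And>e. e \<in> edges T \<Longrightarrow> colour ?S e = colour T e" for T
  proof -
    have "edges (subforest ?S (verts T)) = edges T" by (simp add: edges_def less)
    moreover have "first_colour ?S e = colour T e" if "e \<in> edges T" for e
      using that E col first_colour_edge[OF F, of e] by auto
    ultimately have "isomorphic_posets (subforest ?S (verts T)) T"
      unfolding isomorphic_posets_def by (intro exI[of _ id]) (auto simp: less)
    then show ?thesis
      using forest_class_eq_iff[OF _ T] isomorphic_posets_iff[OF _ T] forest_poset_subforest[OF F TV]
      by blast
  qed
  have "lessrel ?S \<inter> verts P \<times> verts P = lessrel P" "lessrel ?S \<inter> verts Q \<times> verts Q = lessrel Q"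
    unfolding S using excl excl' by auto
  then have "forest_class n (subforest ?S (verts P)) = forest_class n P"
    "forest_class n (subforest ?S (verts Q)) = forest_class n Q"
    using sub[OF P] sub[OF Q] colP colQ by (simp_all add: S edges)
  moreover have "(a, b) \<notin> lessrel ?S \<and> (b, a) \<notin> lessrel ?S" if "a \<in> verts P" "b \<in> verts Q" for a b
    using that excl excl' unfolding S by blast
  ultimately show "forest_class n ?S = forest_class n P + forest_class n Q"
    using forest_class_disjoint_union[OF F S(1) disj] by simp
qed

lemma ex_forest_rep:
  "u \<in> cforests n \<Longrightarrow> \<exists>P. forest_poset n P \<and> forest_class n P = u"
proof (induction u)
  case empty
  let ?E = "\<lparr>verts = {}, lessrel = {}, colour = (\<lambda>_. 0)\<rparr>"
  have "forest_poset n ?E"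
    by (auto simp: forest_poset_def edges_def irrefl_def trans_def)
  then show ?case using forest_class_empty_iff[of n ?E] by auto
next
  case (add t u)
  then have t: "t \<in> ctrees n" and "u \<in> cforests n" by (auto simp: cforests_def)
  with add.IH obtain P where P: "forest_poset n P" "forest_class n P = u" by blast
  obtain T where T: "tree_poset n T" "t = tree_class n T" by (rule in_ctreesE[OF t])
  have TF: "forest_poset n T" "forest_class n T = {#t#}"
    using T forest_class_tree[OF T(1)] by (auto simp: tree_poset_def)
  \<comment> \<open>Even numbers for \<open>P\<close> and odd numbers for \<open>T\<close> make the
    vertex sets disjoint.\<close>
  let ?f = "\<lambda>v::nat. 2 * v" and ?g = "\<lambda>v::nat. Suc (2 * v)"
  have inj: "inj_on ?f A" "inj_on ?g A" for A by (auto simp: inj_on_def)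
  have "verts (poset_image ?f P) \<inter> verts (poset_image ?g T) = {}"
    unfolding poset_image_def by simp (auto, presburger)
  from poset_sum[OF poset_image(1)[OF P(1) inj(1)] poset_image(1)[OF TF(1) inj(2)] this]
  show ?case
    using P(2) TF(2) forest_class_poset_image[OF P(1) inj(1)] forest_class_poset_image[OF TF(1) inj(2)]
    by auto
qed

lemma forest_rep:
  assumes "u \<in> cforests n"
  shows "forest_poset n (forest_rep n u)" "forest_class n (forest_rep n u) = u"
  using someI_ex[OF ex_forest_rep[OF assms]] unfolding forest_rep_def by blast+

lemma forest_degree_class:
  assumes "forest_poset n P"
  shows "forest_degree n (forest_class n P) = card (verts P)"
proof -
  note rep = forest_rep[OF forest_class_in_cforests[OF assms]]
  then obtain f where "forest_iso f (forest_rep n (forest_class n P)) P"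
    using forest_class_eq_iff[OF rep(1) assms] by blast
  then show ?thesis
    unfolding forest_degree_def using forest_iso_bij bij_betw_same_card by blast
qed

text \<open>Every forest has a representative whose vertices form an initial segment of the naturals
  and whose colours vanish off the edges. In bounded degree there are finitely many of these. This
  finiteness makes elements of the graded dual finite combinations of the
  \<open>D n u\<close>.\<close>

lemma finite_cforests_degree: "finite {u \<in> cforests n. forest_degree n u \<le> N}"
proof -
  define NF where "NF m = (\<lambda>(r, c). \<lparr>verts = {..<m::nat}, lessrel = r, colour = c\<rparr>) `
      (Pow ({..<m} \<times> {..<m}) \<times>
        {c. \<forall>e. (e \<in> {..<m} \<times> {..<m} \<longrightarrow> c e \<in> {..n}) \<and> (e \<notin> {..<m} \<times> {..<m} \<longrightarrow> c e = 0)})" for m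
  have fin: "finite (NF m)" for m
    unfolding NF_def by (intro finite_imageI finite_cartesian_product finite_set_of_finite_funs) auto
  have "u \<in> forest_class n ` (\<Union>m\<le>N. NF m)" if u: "u \<in> cforests n" "forest_degree n u \<le> N" for u
  proof -
    let ?P = "forest_rep n u"
    note P = forest_rep[OF u(1)]
    obtain f where f: "bij_betw f (verts ?P) {..<card (verts ?P)}"
      using ex_bij_betw_finite_nat[OF forest_posetD(1)[OF P(1)]] by (auto simp: atLeast0LessThan)
    let ?Q = "poset_image f ?P"
    have inj: "inj_on f (verts ?P)" using f by (simp add: bij_betw_def)
    note Q = poset_image(1)[OF P(1) inj]
    have V: "verts ?Q = {..<card (verts ?P)}" using f by (simp add: poset_image_def bij_betw_def)
    have e: "colour ?Q e \<in> {..n}" "e \<notin> verts ?Q \<times> verts ?Q \<Longrightarrow> colour ?Q e = 0" for e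
    proof -
      have iff: "colour ?Q e \<in> {1..n} \<and> e \<in> verts ?Q \<times> verts ?Q"
        if "e \<in> map_prod f f ` edges ?P"
      proof -
        from that obtain v w where vw: "(v, w) \<in> edges ?P" "e = (f v, f w)"
          by (metis imageE map_prod_simp surj_pair)
        then have "(v, w) \<in> lessrel ?P" by (simp add: edges_def)
        then have V: "v \<in> verts ?P" "w \<in> verts ?P" using forest_posetD(2)[OF P(1)] by auto
        have "colour ?Q e = colour ?P (v, w)"
          using vw V inj by (auto simp: poset_image_def)
        then show ?thesis
          using forest_posetD(6)[OF P(1) vw(1)] V vw(2) by (simp add: poset_image_def)
      qed
      have "colour ?Q e = 0" if "e \<notin> map_prod f f ` edges ?P"
        using that unfolding poset_image_def by simp
      with iff show "colour ?Q e \<in> {..n}" "e \<notin> verts ?Q \<times> verts ?Q \<Longrightarrow> colour ?Q e = 0"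
        by fastforce+
    qed
    have "?Q \<in> NF (card (verts ?P))"
      unfolding NF_def
      by (intro image_eqI[of _ _ "(lessrel ?Q, colour ?Q)"])
         (use V e forest_posetD(2)[OF Q] in auto)
    moreover have "card (verts ?P) \<le> N" using u(2) by (simp add: forest_degree_def)
    ultimately show ?thesis
      using forest_class_poset_image[OF P(1) inj] P(2) by (intro image_eqI[of _ _ ?Q]) auto
  qed
  then have "{u \<in> cforests n. forest_degree n u \<le> N} \<subseteq> forest_class n ` (\<Union>m\<le>N. NF m)" by blast
  then show ?thesis using fin by (meson finite_UN finite_atMost finite_imageI finite_subset)
qed


section \<open>The coefficients of the coproduct\<close>

text \<open>The set \<open>a\<close> contains the upper and \<open>b\<close> the lower ends of the
  pairs. With \<open>a\<close> and \<open>b\<close> complementary, this is one of the two halves of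
  \<open>q_coeff\<close>.\<close>

definition cross_weight :: "(nat \<Rightarrow> 'k::field_char_0) \<Rightarrow> cposet \<Rightarrow> nat set \<Rightarrow> nat set \<Rightarrow> 'k" where
  "cross_weight q P a b = (\<Prod>e\<in>lessrel P \<inter> b \<times> a. q (first_colour P e))"

text \<open>Every vertex \<open>x\<close> below \<open>v\<close> is the lower end of exactly one
  edge on the path down from \<open>v\<close>, and the colour of this edge is
  \<open>first_colour P (x, v)\<close>. Counting lower ends replaces edges on paths by comparable
  pairs.\<close>

lemma path_count_eq:
  assumes P: "forest_poset n P"
  shows "path_count j v s P = card {x \<in> verts P - s. (x, v) \<in> lessrel P \<and> first_colour P (x, v) = j}"
proof -
  let ?E = "{(x, y) \<in> edges P. (y = v \<or> (y, v) \<in> lessrel P) \<and> colour P (x, y) = j \<and> x \<in> verts P - s}"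
  let ?X = "{x \<in> verts P - s. (x, v) \<in> lessrel P \<and> first_colour P (x, v) = j}"
  have less: "(x, v) \<in> lessrel P" if "(x, y) \<in> edges P" "y = v \<or> (y, v) \<in> lessrel P" for x y
    using that transD[OF forest_posetD(4)[OF P]] unfolding edges_def by blast
  have "inj_on fst ?E"
  proof (rule inj_onI)
    fix e e' assume E: "e \<in> ?E" "e' \<in> ?E" "fst e = fst e'"
    then obtain x y y' where xy: "e = (x, y)" "e' = (x, y')" by (metis prod.collapse)
    with E have y: "(x, y) \<in> edges P \<and> (y = v \<or> (y, v) \<in> lessrel P)"
      "(x, y') \<in> edges P \<and> (y' = v \<or> (y', v) \<in> lessrel P)" by auto
    then have "(x, v) \<in> lessrel P" using less by blast
    from first_edge_ex1[OF P this] y have "y = y'" by blast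
    with xy show "e = e'" by simp
  qed
  moreover have "fst ` ?E = ?X"
  proof
    show "fst ` ?E \<subseteq> ?X" using less first_colour_eqI[OF P] by fastforce
    show "?X \<subseteq> fst ` ?E"
    proof
      fix x assume x: "x \<in> ?X"
      then have xv: "(x, v) \<in> lessrel P" by simp
      obtain u where "(x, u) \<in> edges P" "u = v \<or> (u, v) \<in> lessrel P"
        "first_colour P (x, v) = colour P (x, u)"
        by (rule first_edgeE[OF P xv])
      with x have "(x, u) \<in> ?E" by auto
      then show "x \<in> fst ` ?E" by (metis (no_types, lifting) fst_conv image_eqI)
    qed
  qed
  ultimately show ?thesis
    unfolding path_count_def using bij_betw_same_card[of fst ?E ?X] by (simp add: bij_betw_def)
qed

text \<open>A power of \<open>q j\<close> is a product over the vertices outside \<open>s\<close>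
  that lie below \<open>v\<close> and have colour \<open>j\<close> towards it. After exchanging the
  products, grouping by colour absorbs the product over \<open>j\<close>; colours lie in
  \<open>{1..n}\<close>, so no pair is lost.\<close>

lemma prod_path_count:
  fixes q :: "nat \<Rightarrow> 'k::field_char_0"
  assumes P: "forest_poset n P" and s: "s \<subseteq> verts P"
  shows "(\<Prod>j=1..n. \<Prod>v\<in>s. q j ^ path_count j v s P) = cross_weight q P s (verts P - s)"
proof -
  have fin: "finite (verts P)" "finite s"
    using forest_posetD(1)[OF P] s finite_subset by blast+
  let ?X = "\<lambda>v. {x \<in> verts P - s. (x, v) \<in> lessrel P}"
  have "(\<Prod>j=1..n. \<Prod>v\<in>s. q j ^ path_count j v s P) = (\<Prod>v\<in>s. \<Prod>j=1..n. q j ^ path_count j v s P)"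
    by (rule prod.swap)
  also have "\<dots> = (\<Prod>v\<in>s. \<Prod>x\<in>?X v. q (first_colour P (x, v)))"
  proof (rule prod.cong[OF refl])
    fix v assume "v \<in> s"
    have "(\<Prod>j=1..n. q j ^ path_count j v s P) =
        (\<Prod>j=1..n. \<Prod>x\<in>{x \<in> ?X v. first_colour P (x, v) = j}. q (first_colour P (x, v)))"
      unfolding path_count_eq[OF P] by (intro prod.cong refl) (simp add: conj_assoc)
    also have "\<dots> = (\<Prod>x\<in>?X v. q (first_colour P (x, v)))"
      by (rule prod.group) (use fin first_colour_range[OF P] in auto)
    finally show "(\<Prod>j=1..n. q j ^ path_count j v s P) = (\<Prod>x\<in>?X v. q (first_colour P (x, v)))" .
  qed
  also have "\<dots> = (\<Prod>(v, x)\<in>Sigma s ?X. q (first_colour P (x, v)))"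
    by (rule prod.Sigma) (use fin in auto)
  also have "\<dots> = cross_weight q P s (verts P - s)"
    unfolding cross_weight_def
    by (rule prod.reindex_bij_witness[of _ prod.swap prod.swap]) auto
  finally show ?thesis .
qed

lemma q_coeff_eq_cross_weight:
  assumes P: "forest_poset n P" and s: "s \<subseteq> verts P"
  shows "q_coeff n q1 q2 s P = cross_weight q1 P s (verts P - s) * cross_weight q2 P (verts P - s) s"
proof -
  have "verts P - (verts P - s) = s" using s by blast
  then show ?thesis
    using prod_path_count[OF P s, of q1] prod_path_count[OF P, of "verts P - s" q2]
    unfolding q_coeff_def prod.distrib by simp
qed

lemma finite_lessrel: "forest_poset n P \<Longrightarrow> finite (lessrel P)"
  using forest_posetD(1,2) by (meson finite_SigmaI finite_subset)

lemma cross_weight_Un_left: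
  assumes "forest_poset n P" "a \<inter> a' = {}"
  shows "cross_weight q P (a \<union> a') b = cross_weight q P a b * cross_weight q P a' b"
  unfolding cross_weight_def using assms finite_lessrel[OF assms(1)]
  by (subst prod.union_disjoint[symmetric]) (auto intro!: prod.cong)

lemma cross_weight_Un_right:
  assumes "forest_poset n P" "b \<inter> b' = {}"
  shows "cross_weight q P a (b \<union> b') = cross_weight q P a b * cross_weight q P a b'"
  unfolding cross_weight_def using assms finite_lessrel[OF assms(1)]
  by (subst prod.union_disjoint[symmetric]) (auto intro!: prod.cong)

lemma cross_weight_subforest:
  assumes P: "forest_poset n P" and s: "s \<subseteq> verts P" "a \<subseteq> s" "b \<subseteq> s"
  shows "cross_weight q (subforest P s) a b = cross_weight q P a b"
proof -
  have "lessrel (subforest P s) \<inter> b \<times> a = lessrel P \<inter> b \<times> a" using s by auto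
  moreover have "first_colour (subforest P s) e = first_colour P e"
    if "e \<in> lessrel (subforest P s) \<inter> b \<times> a" for e
    using first_colour_subforest[OF P s(1)] that by (cases e) blast
  ultimately show ?thesis
    unfolding cross_weight_def by (metis (no_types, lifting) prod.cong)
qed

lemma cross_weight_iso:
  assumes P: "forest_poset n P" and f: "forest_iso f P Q" and ab: "a \<subseteq> verts P" "b \<subseteq> verts P"
  shows "cross_weight q Q (f ` a) (f ` b) = cross_weight q P a b"
proof -
  have inj: "inj_on f (verts P)" using forest_iso_bij[OF f] by (simp add: bij_betw_def)
  then have "inj_on (map_prod f f) (verts P \<times> verts P)" by (rule map_prod_inj_on[OF _ inj, unfolded])
  then have inj2: "inj_on (map_prod f f) (lessrel P \<inter> b \<times> a)"
    by (rule inj_on_subset) (use ab in auto)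
  have im: "lessrel Q \<inter> f ` b \<times> f ` a = map_prod f f ` (lessrel P \<inter> b \<times> a)"
  proof
    show "lessrel Q \<inter> f ` b \<times> f ` a \<subseteq> map_prod f f ` (lessrel P \<inter> b \<times> a)"
    proof
      fix e assume e: "e \<in> lessrel Q \<inter> f ` b \<times> f ` a"
      then obtain x v where xv: "x \<in> b" "v \<in> a" "e = (f x, f v)" by blast
      then have "(x, v) \<in> lessrel P" using e ab forest_iso_less[OF f, of x v] by auto
      with xv show "e \<in> map_prod f f ` (lessrel P \<inter> b \<times> a)"
        by (intro image_eqI[of _ _ "(x, v)"]) auto
    qed
    show "map_prod f f ` (lessrel P \<inter> b \<times> a) \<subseteq> lessrel Q \<inter> f ` b \<times> f ` a"
      using forest_iso_less[OF f] ab by auto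
  qed
  show ?thesis
    unfolding cross_weight_def im prod.reindex[OF inj2]
    using forest_iso_colour[OF f] by (auto intro!: prod.cong)
qed

lemma q_coeff_iso:
  assumes P: "forest_poset n P" and Q: "forest_poset n Q" and f: "forest_iso f P Q"
    and s: "s \<subseteq> verts P"
  shows "q_coeff n q1 q2 (f ` s) Q = q_coeff n q1 q2 s P"
proof -
  have inj: "inj_on f (verts P)" and V: "f ` verts P = verts Q"
    using forest_iso_bij[OF f] by (auto simp: bij_betw_def)
  have "verts Q - f ` s = f ` (verts P - s)"
    using inj_on_image_set_diff[OF inj _ s, of "verts P"] V by auto
  moreover have "f ` s \<subseteq> verts Q" using s V by blast
  ultimately show ?thesis
    using s by (simp add: q_coeff_eq_cross_weight P Q cross_weight_iso[OF P f])
qed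

text \<open>Order the blocks as \<open>a\<close>, \<open>b\<close>, \<open>c\<close>. Either side
  multiplies, over all comparable pairs with ends in different blocks, the \<open>q1\<close> factor
  if the upper end lies in the earlier block and the \<open>q2\<close> factor otherwise.\<close>

lemma q_coeff_coassoc:
  assumes P: "forest_poset n P" and V: "verts P = a \<union> b \<union> c"
    and disj: "a \<inter> b = {}" "a \<inter> c = {}" "b \<inter> c = {}"
  shows "q_coeff n q1 q2 (a \<union> b) P * q_coeff n q1 q2 a (subforest P (a \<union> b)) =
    q_coeff n q1 q2 a P * q_coeff n q1 q2 b (subforest P (b \<union> c))"
proof -
  have diff: "verts P - (a \<union> b) = c" "verts P - a = b \<union> c" "a \<union> b - a = b" "b \<union> c - b = c"
    using V disj by auto
  have sub: "a \<union> b \<subseteq> verts P" "b \<union> c \<subseteq> verts P" "a \<subseteq> verts P" using V by auto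
  have "q_coeff n q1 q2 (a \<union> b) P = cross_weight q1 P (a \<union> b) c * cross_weight q2 P c (a \<union> b)"
    "q_coeff n q1 q2 a P = cross_weight q1 P a (b \<union> c) * cross_weight q2 P (b \<union> c) a"
    using q_coeff_eq_cross_weight[OF P sub(1)] q_coeff_eq_cross_weight[OF P sub(3)]
    unfolding diff by blast+
  moreover have "q_coeff n q1 q2 a (subforest P (a \<union> b)) = cross_weight q1 P a b * cross_weight q2 P b a"
    "q_coeff n q1 q2 b (subforest P (b \<union> c)) = cross_weight q1 P b c * cross_weight q2 P c b"
    using sub diff
    by (simp_all add: q_coeff_eq_cross_weight forest_poset_subforest[OF P] cross_weight_subforest[OF P])
  ultimately show ?thesis
    by (simp add: cross_weight_Un_left[OF P] cross_weight_Un_right[OF P] disj mult_ac)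
qed

text \<open>Both products are empty, so the value is \<open>1\<close> also when some parameters are
  zero.\<close>

lemma q_coeff_no_crossing:
  assumes P: "forest_poset n P" and s: "s \<subseteq> verts P"
    and sep: "\<And>a b. \<lbrakk>a \<in> s; b \<in> verts P - s\<rbrakk> \<Longrightarrow> (a, b) \<notin> lessrel P \<and> (b, a) \<notin> lessrel P"
  shows "q_coeff n q1 q2 s P = 1"
proof -
  have "lessrel P \<inter> (verts P - s) \<times> s = {}" "lessrel P \<inter> s \<times> (verts P - s) = {}"
    using sep by blast+
  then show ?thesis
    unfolding q_coeff_eq_cross_weight[OF P s] cross_weight_def by simp
qed

section \<open>The graded dual as an algebra\<close>

lemma cforestsE:
  assumes "u \<in> cforests n"
  obtains P where "forest_poset n P" "u = forest_class n P"
  using forest_rep[OF assms] by metis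

section \<open>Linear extension of functions given on a basis\<close>

definition pm_lin :: "('a \<Rightarrow> 'k::field_char_0) \<Rightarrow> ('a \<Rightarrow>\<^sub>0 'k) \<Rightarrow> 'k" where
  "pm_lin h z = (\<Sum>k\<in>Poly_Mapping.keys z. Poly_Mapping.lookup z k * h k)"

lemma pm_lin_superset:
  assumes "finite A" "Poly_Mapping.keys z \<subseteq> A"
  shows "pm_lin h z = (\<Sum>k\<in>A. Poly_Mapping.lookup z k * h k)"
  unfolding pm_lin_def using assms by (intro sum.mono_neutral_left) (auto simp: in_keys_iff)

lemma pm_lin_0 [simp]: "pm_lin h 0 = 0"
  by (simp add: pm_lin_def)

lemma pm_lin_single [simp]: "pm_lin h (Poly_Mapping.single k c) = c * h k"
  by (simp add: pm_lin_def)

lemma pm_lin_add: "pm_lin h (x + y) = pm_lin h x + pm_lin h y"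
proof -
  let ?A = "Poly_Mapping.keys x \<union> Poly_Mapping.keys y"
  have "pm_lin h (x + y) = (\<Sum>k\<in>?A. Poly_Mapping.lookup (x + y) k * h k)"
    by (rule pm_lin_superset) (use Poly_Mapping.keys_add[of x y] in auto)
  also have "\<dots> = pm_lin h x + pm_lin h y"
    by (simp add: pm_lin_superset[of ?A] lookup_add distrib_right sum.distrib)
  finally show ?thesis .
qed

lemma pm_lin_sum: "pm_lin h (\<Sum>i\<in>I. f i) = (\<Sum>i\<in>I. pm_lin h (f i))"
  by (induction I rule: infinite_finite_induct) (simp_all add: pm_lin_add)

lemma lookup_pm_scale [simp]: "Poly_Mapping.lookup (pm_scale c x) k = c * Poly_Mapping.lookup x k"
  unfolding pm_scale_def by (simp add: Poly_Mapping.map.rep_eq when_def)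

lemma keys_pm_scale: "Poly_Mapping.keys (pm_scale c x) \<subseteq> Poly_Mapping.keys x"
  by (auto simp: in_keys_iff)

lemma pm_lin_scale: "pm_lin h (pm_scale c x) = c * pm_lin h x"
proof -
  have "pm_lin h (pm_scale c x) = (\<Sum>k\<in>Poly_Mapping.keys x. Poly_Mapping.lookup (pm_scale c x) k * h k)"
    by (rule pm_lin_superset[OF finite_keys keys_pm_scale])
  then show ?thesis by (simp add: pm_lin_def sum_distrib_left mult.assoc)
qed

lemma pm_scale_single: "pm_scale c (Poly_Mapping.single u d) = Poly_Mapping.single u (c * d)"
  by (rule poly_mapping_eqI) (simp add: lookup_single when_def)

lemma sum_single_lookup: "(\<Sum>u\<in>Poly_Mapping.keys x. Poly_Mapping.single u (Poly_Mapping.lookup x u)) = x"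
proof (rule poly_mapping_eqI)
  fix k
  have "Poly_Mapping.lookup (\<Sum>u\<in>Poly_Mapping.keys x. Poly_Mapping.single u (Poly_Mapping.lookup x u)) k =
      (\<Sum>u\<in>Poly_Mapping.keys x. if u = k then Poly_Mapping.lookup x u else 0)"
    by (simp add: lookup_sum lookup_single when_def)
  also have "\<dots> = Poly_Mapping.lookup x k"
    by (simp add: in_keys_iff)
  finally show "Poly_Mapping.lookup (\<Sum>u\<in>Poly_Mapping.keys x.
      Poly_Mapping.single u (Poly_Mapping.lookup x u)) k = Poly_Mapping.lookup x k" .
qed

section \<open>Functionals in coordinates\<close>

abbreviation coord :: "'k::field_char_0 functional \<Rightarrow> cforest \<Rightarrow> 'k" where
  "coord \<phi> u \<equiv> \<phi> (Poly_Mapping.single u 1)"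

lemma zero_in_forest_space [simp]: "0 \<in> forest_space n"
  by (simp add: forest_space_def)

lemma single_in_forest_space [simp]:
  "u \<in> cforests n \<Longrightarrow> Poly_Mapping.single u c \<in> forest_space n"
  by (simp add: forest_space_def)

lemma add_in_forest_space:
  "\<lbrakk>x \<in> forest_space n; y \<in> forest_space n\<rbrakk> \<Longrightarrow> x + y \<in> forest_space n"
  using Poly_Mapping.keys_add[of x y] by (auto simp: forest_space_def)

lemma scale_in_forest_space: "x \<in> forest_space n \<Longrightarrow> pm_scale c x \<in> forest_space n"
  using keys_pm_scale[of c x] by (auto simp: forest_space_def)

text \<open>Linearity determines the value on finite combinations of forests, and outside
  \<open>forest_space n\<close> the value is \<open>0\<close> by convention. Functionals can thus be
  handled through their coordinates alone.\<close>

lemma graded_dual_eval: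
  fixes \<phi> :: "'k::field_char_0 functional"
  assumes \<phi>: "\<phi> \<in> graded_dual_space n"
  shows "\<phi> x = (if x \<in> forest_space n then pm_lin (coord \<phi>) x else 0)"
proof (cases "x \<in> forest_space n")
  case True
  have add: "\<phi> (x + y) = \<phi> x + \<phi> y" if "x \<in> forest_space n" "y \<in> forest_space n" for x y
    using \<phi> that by (simp add: graded_dual_space_def)
  have scale: "\<phi> (pm_scale c x) = c * \<phi> x" if "x \<in> forest_space n" for c x
    using \<phi> that by (simp add: graded_dual_space_def)
  have "pm_scale 0 0 = (0 :: 'k forest_alg)" by (rule poly_mapping_eqI) simp
  then have zero: "\<phi> 0 = 0" using scale[of 0 0] by simp
  have sum: "(\<Sum>u\<in>F. Poly_Mapping.single u (c u)) \<in> forest_space n \<and>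
      \<phi> (\<Sum>u\<in>F. Poly_Mapping.single u (c u)) = (\<Sum>u\<in>F. c u * coord \<phi> u)"
    if "finite F" "F \<subseteq> cforests n" for F c
    using that
  proof (induction F rule: finite_induct)
    case (insert u F)
    then have "\<phi> (Poly_Mapping.single u (c u)) = c u * coord \<phi> u"
      using scale[of "Poly_Mapping.single u 1" "c u"] by (simp add: pm_scale_single)
    with insert show ?case by (simp add: add add_in_forest_space)
  qed (simp add: zero)
  have "Poly_Mapping.keys x \<subseteq> cforests n" using True by (simp add: forest_space_def)
  from sum[OF finite_keys this, of "Poly_Mapping.lookup x"] True show ?thesis
    by (simp add: sum_single_lookup pm_lin_def)
next
  case False
  then show ?thesis using \<phi> by (simp add: graded_dual_space_def)
qed

lemma graded_dual_bound:
  fixes \<phi> :: "'k::field_char_0 functional"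
  assumes \<phi>: "\<phi> \<in> graded_dual_space n"
  obtains N where "\<And>u. \<lbrakk>u \<in> cforests n; N < forest_degree n u\<rbrakk> \<Longrightarrow> coord \<phi> u = 0"
proof -
  obtain N where "\<forall>x\<in>forest_space n. (\<forall>u\<in>Poly_Mapping.keys x. N < forest_degree n u) \<longrightarrow> \<phi> x = 0"
    using \<phi> by (auto simp: graded_dual_space_def)
  then have "coord \<phi> u = 0" if "u \<in> cforests n" "N < forest_degree n u" for u
    using that by simp
  then show ?thesis by (rule that)
qed

lemma graded_dual_finite_support:
  fixes \<phi> :: "'k::field_char_0 functional"
  assumes \<phi>: "\<phi> \<in> graded_dual_space n"
  shows "finite {u \<in> cforests n. coord \<phi> u \<noteq> 0}"
proof -
  obtain N where N: "\<And>u. \<lbrakk>u \<in> cforests n; N < forest_degree n u\<rbrakk> \<Longrightarrow> coord \<phi> u = 0"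
    using graded_dual_bound[OF \<phi>] by blast
  then have "{u \<in> cforests n. coord \<phi> u \<noteq> 0} \<subseteq> {u \<in> cforests n. forest_degree n u \<le> N}"
    by (auto simp: not_less[symmetric])
  then show ?thesis using finite_cforests_degree finite_subset by blast
qed

lemma graded_dualI:
  fixes a :: "cforest \<Rightarrow> 'k::field_char_0"
  assumes \<phi>: "\<And>x. \<phi> x = (if x \<in> forest_space n then pm_lin a x else 0)"
    and N: "\<And>u. \<lbrakk>u \<in> cforests n; N < forest_degree n u\<rbrakk> \<Longrightarrow> a u = 0"
  shows "\<phi> \<in> graded_dual_space n"
proof -
  have "pm_lin a x = 0" if "x \<in> forest_space n" "\<forall>u\<in>Poly_Mapping.keys x. N < forest_degree n u" for x
    unfolding pm_lin_def using that N by (intro sum.neutral) (auto simp: forest_space_def)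
  then show ?thesis
    unfolding graded_dual_space_def
    by (auto simp: \<phi> add_in_forest_space scale_in_forest_space pm_lin_add pm_lin_scale)
qed

lemma graded_dual_eqI:
  fixes \<phi> \<psi> :: "'k::field_char_0 functional"
  assumes "\<phi> \<in> graded_dual_space n" "\<psi> \<in> graded_dual_space n"
    and "\<And>u. u \<in> cforests n \<Longrightarrow> coord \<phi> u = coord \<psi> u"
  shows "\<phi> = \<psi>"
proof
  fix x
  have "pm_lin (coord \<phi>) x = pm_lin (coord \<psi>) x" if "x \<in> forest_space n"
    unfolding pm_lin_def using that assms(3) by (intro sum.cong) (auto simp: forest_space_def)
  then show "\<phi> x = \<psi> x"
    using graded_dual_eval[OF assms(1), of x] graded_dual_eval[OF assms(2), of x] by simp
qed

lemma D_in_graded_dual: "D n u \<in> graded_dual_space n"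
proof (rule graded_dualI[of _ n "\<lambda>w. if w = u then 1 else 0" "forest_degree n u"])
  show "D n u x = (if x \<in> forest_space n then pm_lin (\<lambda>w. if w = u then 1 else 0) x else 0)" for x
    by (simp add: D_def pm_lin_def in_keys_iff if_distrib cong: if_cong)
qed auto

lemma coord_D: "w \<in> cforests n \<Longrightarrow> coord (D n u) w = (if w = u then 1 else 0)"
  by (simp add: D_def lookup_single when_def)

lemma graded_dual_zero: "(\<lambda>x. 0) \<in> graded_dual_space n"
  by (rule graded_dualI[of _ n "\<lambda>w. 0"]) (simp_all add: pm_lin_def)

lemma graded_dual_add:
  assumes "\<phi> \<in> graded_dual_space n" "\<psi> \<in> graded_dual_space n"
  shows "(\<lambda>x. \<phi> x + \<psi> x) \<in> graded_dual_space n"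
proof -
  obtain N where N: "\<And>u. \<lbrakk>u \<in> cforests n; N < forest_degree n u\<rbrakk> \<Longrightarrow> coord \<phi> u = 0"
    using graded_dual_bound[OF assms(1)] by blast
  obtain M where M: "\<And>u. \<lbrakk>u \<in> cforests n; M < forest_degree n u\<rbrakk> \<Longrightarrow> coord \<psi> u = 0"
    using graded_dual_bound[OF assms(2)] by blast
  have "\<phi> x + \<psi> x = (if x \<in> forest_space n then pm_lin (\<lambda>u. coord \<phi> u + coord \<psi> u) x else 0)" for x
    using graded_dual_eval[OF assms(1), of x] graded_dual_eval[OF assms(2), of x]
    by (simp add: pm_lin_def distrib_left sum.distrib)
  then show ?thesis
    by (rule graded_dualI[where N = "max N M"]) (simp add: N M)
qed

lemma graded_dual_scale:
  assumes "\<phi> \<in> graded_dual_space n"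
  shows "(\<lambda>x. c * \<phi> x) \<in> graded_dual_space n"
proof -
  obtain N where N: "\<And>u. \<lbrakk>u \<in> cforests n; N < forest_degree n u\<rbrakk> \<Longrightarrow> coord \<phi> u = 0"
    using graded_dual_bound[OF assms(1)] by blast
  have "c * \<phi> x = (if x \<in> forest_space n then pm_lin (\<lambda>u. c * coord \<phi> u) x else 0)" for x
    using graded_dual_eval[OF assms, of x]
    by (simp add: pm_lin_def sum_distrib_left mult_ac)
  then show ?thesis
    by (rule graded_dualI[where N = N]) (simp add: N)
qed

lemma graded_dual_diff:
  assumes "\<phi> \<in> graded_dual_space n" "\<psi> \<in> graded_dual_space n"
  shows "(\<lambda>x. \<phi> x - \<psi> x) \<in> graded_dual_space n"
  using graded_dual_add[OF assms(1) graded_dual_scale[OF assms(2), of "-1"]] by simp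

lemma graded_dual_sum:
  assumes "\<And>i. i \<in> I \<Longrightarrow> f i \<in> graded_dual_space n"
  shows "(\<lambda>x. \<Sum>i\<in>I. c i * f i x) \<in> graded_dual_space n"
  using assms
  by (induction I rule: infinite_finite_induct)
    (simp_all add: graded_dual_zero graded_dual_add graded_dual_scale)

text \<open>The product of the dual in coordinates, with the poset as an argument: it has to be
  evaluated on subforests, which are in general not the representatives selected by
  \<open>forest_rep\<close>.\<close>

definition conv ::
    "nat \<Rightarrow> (nat \<Rightarrow> 'k::field_char_0) \<Rightarrow> (nat \<Rightarrow> 'k) \<Rightarrow> (cforest \<Rightarrow> 'k) \<Rightarrow> (cforest \<Rightarrow> 'k) \<Rightarrow> cposet \<Rightarrow> 'k" where
  "conv n q1 q2 a b P = (\<Sum>s\<in>Pow (verts P). q_coeff n q1 q2 s P *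
     (a (forest_class n (subforest P s)) * b (forest_class n (subforest P (verts P - s)))))"

lemma conv_iso:
  assumes P: "forest_poset n P" and Q: "forest_poset n Q"
    and eq: "forest_class n P = forest_class n Q"
  shows "conv n q1 q2 a b P = conv n q1 q2 a b Q"
proof -
  obtain f where f: "forest_iso f P Q" using forest_class_eq_iff[OF P Q] eq by blast
  have inj: "inj_on f (verts P)" and V: "f ` verts P = verts Q"
    using forest_iso_bij[OF f] by (auto simp: bij_betw_def)
  have cls: "forest_class n (subforest Q (f ` s)) = forest_class n (subforest P s)"
    if s: "s \<subseteq> verts P" for s
  proof -
    have "f ` s \<subseteq> verts Q" using s V by blast
    then show ?thesis
      using forest_class_iso[OF forest_poset_subforest[OF P s] forest_poset_subforest[OF Q]
          forest_iso_subforest[OF P Q f s]] by simp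
  qed
  have "conv n q1 q2 a b P = (\<Sum>s\<in>Pow (verts P). q_coeff n q1 q2 (f ` s) Q *
      (a (forest_class n (subforest Q (f ` s))) * b (forest_class n (subforest Q (verts Q - f ` s)))))"
    unfolding conv_def
  proof (rule sum.cong[OF refl])
    fix s assume "s \<in> Pow (verts P)"
    then have s: "s \<subseteq> verts P" by simp
    have "verts Q - f ` s = f ` (verts P - s)"
      using inj_on_image_set_diff[OF inj _ s, of "verts P"] V by auto
    then show "q_coeff n q1 q2 s P * (a (forest_class n (subforest P s)) *
        b (forest_class n (subforest P (verts P - s)))) =
      q_coeff n q1 q2 (f ` s) Q * (a (forest_class n (subforest Q (f ` s))) *
        b (forest_class n (subforest Q (verts Q - f ` s))))"
      using cls[OF s] cls[of "verts P - s"] by (simp add: q_coeff_iso[OF P Q f s])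
  qed
  also have "\<dots> = conv n q1 q2 a b Q"
    unfolding conv_def
    by (rule sum.reindex_bij_betw[OF bij_betw_Pow[OF forest_iso_bij[OF f]]])
  finally show ?thesis .
qed

lemma dual_product_eval:
  "dual_product n q1 q2 \<phi> \<psi> x = (if x \<in> forest_space n
     then pm_lin (\<lambda>w. conv n q1 q2 (coord \<phi>) (coord \<psi>) (forest_rep n w)) x else 0)"
proof -
  define h where "h = (\<lambda>(u, v). coord \<phi> u * coord \<psi> v)"
  have "tensor_functional \<phi> \<psi> z = pm_lin h z" for z
    unfolding tensor_functional_def pm_lin_def h_def by (intro sum.cong) auto
  moreover have "pm_lin h (coproduct_basis n q1 q2 w) =
      conv n q1 q2 (coord \<phi>) (coord \<psi>) (forest_rep n w)" for w
    by (simp add: coproduct_basis_def Let_def pm_lin_sum conv_def h_def)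
  ultimately show ?thesis
    unfolding dual_product_def coproduct_def
    by (simp add: pm_lin_sum pm_lin_scale) (simp add: pm_lin_def)
qed

lemma coord_dual_product:
  assumes "forest_poset n P"
  shows "coord (dual_product n q1 q2 \<phi> \<psi>) (forest_class n P) =
    conv n q1 q2 (coord \<phi>) (coord \<psi>) P"
  using forest_class_in_cforests[OF assms]
  by (simp add: dual_product_eval conv_iso[OF forest_rep(1) assms forest_rep(2)])

lemma dual_product_closed:
  assumes \<phi>: "\<phi> \<in> graded_dual_space n" and \<psi>: "\<psi> \<in> graded_dual_space n"
  shows "dual_product n q1 q2 \<phi> \<psi> \<in> graded_dual_space n"
proof -
  obtain N where N: "\<And>u. \<lbrakk>u \<in> cforests n; N < forest_degree n u\<rbrakk> \<Longrightarrow> coord \<phi> u = 0"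
    using graded_dual_bound[OF \<phi>] by blast
  obtain M where M: "\<And>u. \<lbrakk>u \<in> cforests n; M < forest_degree n u\<rbrakk> \<Longrightarrow> coord \<psi> u = 0"
    using graded_dual_bound[OF \<psi>] by blast
  show ?thesis
  proof (rule graded_dualI[OF dual_product_eval])
    \<comment> \<open>The numbers of vertices of \<open>s\<close> and of its complement add up to
      the degree of \<open>w\<close>, so every term exceeds one of the two bounds.\<close>
    fix w assume w: "w \<in> cforests n" "N + M < forest_degree n w"
    let ?P = "forest_rep n w"
    note P = forest_rep(1)[OF w(1)]
    have "coord \<phi> (forest_class n (subforest ?P s)) = 0 \<or>
        coord \<psi> (forest_class n (subforest ?P (verts ?P - s))) = 0" if s: "s \<subseteq> verts ?P" for s
    proof -
      have "card (verts ?P) = card s + card (verts ?P - s)"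
        using s forest_posetD(1)[OF P] by (metis card_Diff_subset card_mono finite_subset le_add_diff_inverse)
      then consider "N < card s" | "M < card (verts ?P - s)"
        using w(2) unfolding forest_degree_def by linarith
      then show ?thesis
        using N M s forest_class_in_cforests[OF forest_poset_subforest[OF P]]
          forest_degree_class[OF forest_poset_subforest[OF P]]
        by (metis Diff_subset subforest_simps(1))
    qed
    then show "conv n q1 q2 (coord \<phi>) (coord \<psi>) ?P = 0"
      unfolding conv_def by (intro sum.neutral) auto
  qed
qed

lemma conv_subforest:
  assumes P: "forest_poset n P" and s: "s \<subseteq> verts P"
  shows "conv n q1 q2 a b (subforest P s) = (\<Sum>r\<in>Pow s. q_coeff n q1 q2 r (subforest P s) *
     (a (forest_class n (subforest P r)) * b (forest_class n (subforest P (s - r)))))"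
proof -
  have "forest_class n (subforest (subforest P s) r) = forest_class n (subforest P r)" if "r \<subseteq> s" for r
    using forest_class_iso[OF _ _ forest_iso_subforest_subforest[OF P s that]] that s
      forest_poset_subforest[OF forest_poset_subforest[OF P s], of r] forest_poset_subforest[OF P, of r]
    by auto
  then show ?thesis unfolding conv_def by (intro sum.cong) auto
qed

lemma dual_product_assoc:
  assumes "\<phi> \<in> graded_dual_space n" "\<psi> \<in> graded_dual_space n" "\<chi> \<in> graded_dual_space n"
  shows "dual_product n q1 q2 (dual_product n q1 q2 \<phi> \<psi>) \<chi> =
    dual_product n q1 q2 \<phi> (dual_product n q1 q2 \<psi> \<chi>)"
proof (rule graded_dual_eqI)
  fix w assume "w \<in> cforests n"
  then obtain P where P: "forest_poset n P" and w: "w = forest_class n P" using cforestsE by blast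
  let ?V = "verts P" and ?c = "\<lambda>s. forest_class n (subforest P s)"
  have fin: "finite ?V" using forest_posetD(1)[OF P] .
  \<comment> \<open>The contribution of the partition of the vertices into \<open>a\<close>,
    \<open>b\<close> and the rest, with the coefficient as it arises from the left
    bracketing.\<close>
  let ?F = "\<lambda>a b. q_coeff n q1 q2 (a \<union> b) P * q_coeff n q1 q2 a (subforest P (a \<union> b)) *
    (coord \<phi> (?c a) * coord \<psi> (?c b) * coord \<chi> (?c (?V - (a \<union> b))))"
  let ?I = "SIGMA a : Pow ?V. Pow (?V - a)"
  have "coord (dual_product n q1 q2 (dual_product n q1 q2 \<phi> \<psi>) \<chi>) w =
     (\<Sum>s\<in>Pow ?V. q_coeff n q1 q2 s P *
       (conv n q1 q2 (coord \<phi>) (coord \<psi>) (subforest P s) * coord \<chi> (?c (?V - s))))"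
    unfolding w coord_dual_product[OF P] conv_def[of _ _ _ _ _ P]
    by (intro sum.cong refl) (simp add: coord_dual_product[OF forest_poset_subforest[OF P]])
  also have "\<dots> = (\<Sum>s\<in>Pow ?V. \<Sum>a\<in>Pow s. ?F a (s - a))"
    by (intro sum.cong refl)
      (auto simp: conv_subforest[OF P] sum_distrib_left sum_distrib_right Un_absorb1 mult_ac intro!: sum.cong)
  also have "\<dots> = (\<Sum>(s, a)\<in>(SIGMA s : Pow ?V. Pow s). ?F a (s - a))"
    by (rule sum.Sigma) (use fin finite_subset in auto)
  \<comment> \<open>A set \<open>s\<close> with a subset \<open>a\<close> is traded for the disjoint
    sets \<open>a\<close> and \<open>s - a\<close>.\<close>
  also have "\<dots> = (\<Sum>(a, b)\<in>?I. ?F a b)"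
    by (rule sum.reindex_bij_witness[of _ "\<lambda>(a, b). (a \<union> b, a)" "\<lambda>(s, a). (a, s - a)"]) auto
  finally have left: "coord (dual_product n q1 q2 (dual_product n q1 q2 \<phi> \<psi>) \<chi>) w = \<dots>" .
  have "coord (dual_product n q1 q2 \<phi> (dual_product n q1 q2 \<psi> \<chi>)) w =
     (\<Sum>a\<in>Pow ?V. q_coeff n q1 q2 a P *
       (coord \<phi> (?c a) * conv n q1 q2 (coord \<psi>) (coord \<chi>) (subforest P (?V - a))))"
    unfolding w coord_dual_product[OF P] conv_def[of _ _ _ _ _ P]
    by (intro sum.cong refl) (simp add: coord_dual_product[OF forest_poset_subforest[OF P]])
  also have "\<dots> = (\<Sum>a\<in>Pow ?V. \<Sum>b\<in>Pow (?V - a). ?F a b)"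
  proof (intro sum.cong refl)
    fix a assume "a \<in> Pow ?V"
    then have a: "a \<subseteq> ?V" by simp
    have "q_coeff n q1 q2 a P * (coord \<phi> (?c a) * (q_coeff n q1 q2 b (subforest P (?V - a)) *
        (coord \<psi> (?c b) * coord \<chi> (?c (?V - a - b))))) = ?F a b" if b: "b \<in> Pow (?V - a)" for b
    proof -
      have V: "?V = a \<union> b \<union> (?V - (a \<union> b))" "b \<union> (?V - (a \<union> b)) = ?V - a" "?V - a - b = ?V - (a \<union> b)"
        using a b by auto
      \<comment> \<open>Coassociativity of the coefficients turns the term of the right bracketing
        into \<open>?F a b\<close>.\<close>
      have "q_coeff n q1 q2 (a \<union> b) P * q_coeff n q1 q2 a (subforest P (a \<union> b)) =
          q_coeff n q1 q2 a P * q_coeff n q1 q2 b (subforest P (?V - a))"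
        using q_coeff_coassoc[OF P V(1)] b unfolding V(2) by blast
      then show ?thesis unfolding V(3) by (simp add: mult_ac)
    qed
    then show "q_coeff n q1 q2 a P * (coord \<phi> (?c a) *
        conv n q1 q2 (coord \<psi>) (coord \<chi>) (subforest P (?V - a))) = (\<Sum>b\<in>Pow (?V - a). ?F a b)"
      unfolding conv_subforest[OF P Diff_subset] sum_distrib_left by (intro sum.cong refl) blast
  qed
  also have "\<dots> = (\<Sum>(a, b)\<in>?I. ?F a b)"
    by (rule sum.Sigma) (use fin finite_subset in auto)
  finally show "coord (dual_product n q1 q2 (dual_product n q1 q2 \<phi> \<psi>) \<chi>) w =
      coord (dual_product n q1 q2 \<phi> (dual_product n q1 q2 \<psi> \<chi>)) w"
    using left by simp
qed (intro dual_product_closed assms)+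

lemma q_coeff_trivial:
  assumes "forest_poset n P"
  shows "q_coeff n q1 q2 {} P = 1" "q_coeff n q1 q2 (verts P) P = 1"
  using q_coeff_no_crossing[OF assms] by auto

lemma forest_class_subforest_empty_iff:
  assumes "forest_poset n P" "s \<subseteq> verts P"
  shows "forest_class n (subforest P s) = {#} \<longleftrightarrow> s = {}"
  using forest_class_empty_iff[OF forest_poset_subforest[OF assms]] by simp

lemma forest_class_subforest_verts:
  assumes "forest_poset n P"
  shows "forest_class n (subforest P (verts P)) = forest_class n P"
  using forest_class_iso[OF _ assms forest_iso_subforest_verts[OF assms]]
    forest_poset_subforest[OF assms] by blast

text \<open>The functional \<open>D n {#}\<close> detects the empty subforest, so only
  \<open>s = {}\<close> or \<open>s = verts P\<close> survives in the sum, with coefficient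
  \<open>1\<close>.\<close>

lemma dual_product_one:
  assumes "\<phi> \<in> graded_dual_space n"
  shows "dual_product n q1 q2 (D n {#}) \<phi> = \<phi>" "dual_product n q1 q2 \<phi> (D n {#}) = \<phi>"
proof -
  have "coord (dual_product n q1 q2 (D n {#}) \<phi>) w = coord \<phi> w \<and>
      coord (dual_product n q1 q2 \<phi> (D n {#})) w = coord \<phi> w" if "w \<in> cforests n" for w
  proof -
    from that obtain P where P: "forest_poset n P" and w: "w = forest_class n P"
      using cforestsE by blast
    let ?V = "verts P" and ?c = "\<lambda>s. forest_class n (subforest P s)"
    have fin: "finite (Pow ?V)" using forest_posetD(1)[OF P] by simp
    have D: "coord (D n {#}) (?c s) = (if s = {} then 1 else 0)" if "s \<subseteq> ?V" for s
      using that forest_class_subforest_empty_iff[OF P that]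
        forest_class_in_cforests[OF forest_poset_subforest[OF P that]] by (simp add: coord_D)
    have "conv n q1 q2 (coord (D n {#})) (coord \<phi>) P =
        (\<Sum>s\<in>Pow ?V. if s = {} then coord \<phi> w else 0)"
      unfolding conv_def w
      by (intro sum.cong refl) (auto simp: D q_coeff_trivial[OF P] forest_class_subforest_verts[OF P])
    moreover have "conv n q1 q2 (coord \<phi>) (coord (D n {#})) P =
        (\<Sum>s\<in>Pow ?V. if s = ?V then coord \<phi> w else 0)"
      unfolding conv_def w
      by (intro sum.cong refl) (auto simp: D q_coeff_trivial[OF P] forest_class_subforest_verts[OF P])
    ultimately show ?thesis
      using fin by (simp add: w coord_dual_product[OF P])
  qed
  then show "dual_product n q1 q2 (D n {#}) \<phi> = \<phi>" "dual_product n q1 q2 \<phi> (D n {#}) = \<phi>"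
    by (auto intro!: graded_dual_eqI[of _ n] dual_product_closed D_in_graded_dual assms)
qed

section \<open>Bilinearity of the product and the algebra axioms\<close>

lemma tensor_functional_add:
  "tensor_functional (\<lambda>x. \<phi> x + \<phi>' x) \<psi> z = tensor_functional \<phi> \<psi> z + tensor_functional \<phi>' \<psi> z"
  "tensor_functional \<phi> (\<lambda>x. \<psi> x + \<psi>' x) z = tensor_functional \<phi> \<psi> z + tensor_functional \<phi> \<psi>' z"
  by (simp_all add: tensor_functional_def case_prod_unfold distrib_left distrib_right sum.distrib)

lemma tensor_functional_scale:
  "tensor_functional (\<lambda>x. c * \<phi> x) \<psi> z = c * tensor_functional \<phi> \<psi> z"
  "tensor_functional \<phi> (\<lambda>x. c * \<psi> x) z = c * tensor_functional \<phi> \<psi> z"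
  by (simp_all add: tensor_functional_def case_prod_unfold sum_distrib_left mult_ac)

lemma dual_product_add:
  "dual_product n q1 q2 (\<lambda>x. \<phi> x + \<phi>' x) \<psi> = (\<lambda>x. dual_product n q1 q2 \<phi> \<psi> x + dual_product n q1 q2 \<phi>' \<psi> x)"
  "dual_product n q1 q2 \<phi> (\<lambda>x. \<psi> x + \<psi>' x) = (\<lambda>x. dual_product n q1 q2 \<phi> \<psi> x + dual_product n q1 q2 \<phi> \<psi>' x)"
  by (auto simp: dual_product_def tensor_functional_add)

lemma dual_product_scale:
  "dual_product n q1 q2 (\<lambda>x. c * \<phi> x) \<psi> = (\<lambda>x. c * dual_product n q1 q2 \<phi> \<psi> x)"
  "dual_product n q1 q2 \<phi> (\<lambda>x. c * \<psi> x) = (\<lambda>x. c * dual_product n q1 q2 \<phi> \<psi> x)"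
  by (auto simp: dual_product_def tensor_functional_scale)

lemma dual_product_sum:
  "dual_product n q1 q2 (\<lambda>x. \<Sum>i\<in>I. c i * f i x) \<psi> = (\<lambda>x. \<Sum>i\<in>I. c i * dual_product n q1 q2 (f i) \<psi> x)"
  "dual_product n q1 q2 \<phi> (\<lambda>x. \<Sum>i\<in>I. c i * f i x) = (\<lambda>x. \<Sum>i\<in>I. c i * dual_product n q1 q2 \<phi> (f i) x)"
proof -
  have "dual_product n q1 q2 (\<lambda>x. 0) \<psi> = (\<lambda>x. 0)" "dual_product n q1 q2 \<phi> (\<lambda>x. 0) = (\<lambda>x. 0)"
    using dual_product_scale(1)[of n q1 q2 0] dual_product_scale(2)[of n q1 q2 _ 0] by simp_all
  then show
    "dual_product n q1 q2 (\<lambda>x. \<Sum>i\<in>I. c i * f i x) \<psi> = (\<lambda>x. \<Sum>i\<in>I. c i * dual_product n q1 q2 (f i) \<psi> x)"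
    "dual_product n q1 q2 \<phi> (\<lambda>x. \<Sum>i\<in>I. c i * f i x) = (\<lambda>x. \<Sum>i\<in>I. c i * dual_product n q1 q2 \<phi> (f i) x)"
    by (induction I rule: infinite_finite_induct) (simp_all add: dual_product_add dual_product_scale)
qed

lemma graded_dual_simps [simp]:
  "carrier (graded_dual n q1 q2) = graded_dual_space n"
  "monoid.mult (graded_dual n q1 q2) = dual_product n q1 q2"
  "one (graded_dual n q1 q2) = D n {#}"
  "zero (graded_dual n q1 q2) = (\<lambda>x. 0)"
  "add (graded_dual n q1 q2) = (\<lambda>\<phi> \<psi> x. \<phi> x + \<psi> x)"
  "module.smult (graded_dual n q1 q2) = (\<lambda>c \<phi> x. c * \<phi> x)"
  by (simp_all add: graded_dual_def)

lemma ring_of_type_simps [simp]: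
  "carrier (ring_of_type_algebra :: 'a::field_char_0 ring) = UNIV"
  "monoid.mult (ring_of_type_algebra :: 'a ring) = (*)"
  "one (ring_of_type_algebra :: 'a ring) = 1"
  "zero (ring_of_type_algebra :: 'a ring) = 0"
  "add (ring_of_type_algebra :: 'a ring) = (+)"
  by (simp_all add: ring_of_type_algebra_def)

lemma graded_dual_abelian_group: "abelian_group (graded_dual n q1 q2)"
proof (rule abelian_groupI)
  fix \<phi> assume "\<phi> \<in> carrier (graded_dual n q1 q2)"
  then show "\<exists>\<psi>\<in>carrier (graded_dual n q1 q2).
      \<psi> \<oplus>\<^bsub>graded_dual n q1 q2\<^esub> \<phi> = \<zero>\<^bsub>graded_dual n q1 q2\<^esub>"
    using graded_dual_scale[of \<phi> n "-1"] by (intro bexI[of _ "\<lambda>x. - 1 * \<phi> x"]) auto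
qed (auto simp: graded_dual_add graded_dual_zero add_ac)

lemma graded_dual_assoc_algebra:
  fixes q1 q2 :: "nat \<Rightarrow> 'k::field_char_0"
  shows "assoc_algebra (ring_of_type_algebra :: 'k ring) (graded_dual n q1 q2)"
proof (intro assoc_algebra.intro assoc_algebra_axioms.intro)
  show "module (ring_of_type_algebra :: 'k ring) (graded_dual n q1 q2)"
    by (rule moduleI[OF cring_from_type_algebra graded_dual_abelian_group])
      (auto simp: graded_dual_scale algebra_simps)
  have "monoid (graded_dual n q1 q2)"
    by (rule monoidI)
      (simp_all add: dual_product_closed D_in_graded_dual dual_product_assoc dual_product_one)
  then show "ring (graded_dual n q1 q2)"
    by (intro ringI graded_dual_abelian_group) (simp_all add: dual_product_add)
qed (simp_all add: dual_product_scale)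

lemma graded_dual_minus:
  assumes "\<phi> \<in> graded_dual_space n" "\<psi> \<in> graded_dual_space n"
  shows "\<phi> \<ominus>\<^bsub>graded_dual n q1 q2\<^esub> \<psi> = (\<lambda>x. \<phi> x - \<psi> x)"
proof -
  interpret abelian_group "graded_dual n q1 q2" by (rule graded_dual_abelian_group)
  have "\<ominus>\<^bsub>graded_dual n q1 q2\<^esub> \<psi> = (\<lambda>x. - 1 * \<psi> x)"
    by (rule minus_equality) (use assms graded_dual_scale[of \<psi> n "-1"] in auto)
  then show ?thesis by (simp add: a_minus_def)
qed

section \<open>The commutator on the span of the trees\<close>

lemma add_mset_in_cforests [simp]: "add_mset t u \<in> cforests n \<longleftrightarrow> t \<in> ctrees n \<and> u \<in> cforests n"
  by (auto simp: cforests_def)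

lemma empty_in_cforests [simp]: "{#} \<in> cforests n"
  by (simp add: cforests_def)

text \<open>If some component lies inside \<open>s\<close>, its root must be the root of
  \<open>s\<close>, so \<open>s\<close> is that component. Otherwise every component has a vertex
  outside \<open>s\<close>; a root of the complement below this vertex lies in the same component,
  so the number of roots does not drop.\<close>

lemma subtree_component_or_size_le:
  assumes P: "forest_poset n P" and s: "s \<subseteq> verts P" and tree: "tree_poset n (subforest P s)"
  shows "s \<in> up_set P ` roots P \<or>
    size (forest_class n P) \<le> size (forest_class n (subforest P (verts P - s)))"
proof -
  let ?c = "verts P - s"
  have C: "forest_poset n (subforest P ?c)" by (rule forest_poset_subforest[OF P]) blast
  obtain \<rho> where \<rho>: "\<rho> \<in> s" "\<And>v. v \<in> s \<Longrightarrow> v = \<rho> \<or> (\<rho>, v) \<in> lessrel P"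
    using tree unfolding tree_poset_def by auto
  have le: "card (roots P) \<le> card (roots (subforest P ?c))"
    if f: "\<And>r. r \<in> roots P \<Longrightarrow> \<exists>x\<in>up_set P r. x \<in> ?c"
  proof -
    have "\<exists>x. x \<in> up_set P r \<and> x \<in> roots (subforest P ?c)" if r: "r \<in> roots P" for r
    proof -
      obtain x where x: "x \<in> up_set P r" "x \<in> ?c" using f[OF r] by blast
      then obtain y where y: "y \<in> roots (subforest P ?c)" "x \<in> up_set (subforest P ?c) y"
        using ex_root_below[OF C, of x] by auto
      then have "x = y \<or> (y, x) \<in> lessrel P" by (auto simp: up_set_def)
      then have "y \<in> up_set P r" using up_set_less[OF P r, of y x] x(1) by blast
      with y show ?thesis by blast
    qed
    then obtain g where g: "\<And>r. r \<in> roots P \<Longrightarrow> g r \<in> up_set P r \<and> g r \<in> roots (subforest P ?c)"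
      by metis
    have "inj_on g (roots P)"
      using g root_below_unique[OF P] unfolding inj_on_def by metis
    then show ?thesis
      using g by (intro card_inj_on_le[of g] finite_roots[OF C]) auto
  qed
  show ?thesis
  proof (cases "\<exists>r\<in>roots P. up_set P r \<subseteq> s")
    case True
    then obtain r where r: "r \<in> roots P" "up_set P r \<subseteq> s" by blast
    then have "r \<in> s" by (auto simp: up_set_def)
    with r(1) have "r = \<rho>" using \<rho>(2) by (auto simp: roots_def)
    then have "s \<subseteq> up_set P r" using \<rho>(2) by (auto simp: up_set_def)
    with r show ?thesis by blast
  next
    case False
    have "\<exists>x\<in>up_set P r. x \<in> ?c" if r: "r \<in> roots P" for r
    proof -
      have "up_set P r \<subseteq> verts P" using r by (intro up_set_subset[OF P]) (simp add: roots_def)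
      then show ?thesis using False r by blast
    qed
    from le[OF this] show ?thesis by (simp add: size_forest_class P C)
  qed
qed

lemma component_complement:
  assumes P: "forest_poset n P" and r: "r \<in> roots P"
  shows "forest_class n P =
      add_mset (tree_class n (subforest P (up_set P r)))
        (forest_class n (subforest P (verts P - up_set P r)))"
    and "q_coeff n q1 q2 (up_set P r) P = 1"
proof -
  have rV: "r \<in> verts P" using r by (simp add: roots_def)
  note up = up_set_subset[OF P rV]
  have sep: "(a, b) \<notin> lessrel P \<and> (b, a) \<notin> lessrel P"
    if "a \<in> up_set P r" "b \<in> verts P - up_set P r" for a b
    using that up_set_less[OF P r] by blast
  show "forest_class n P = add_mset (tree_class n (subforest P (up_set P r)))
      (forest_class n (subforest P (verts P - up_set P r)))"
    using forest_class_disjoint_union[OF P, of "up_set P r" "verts P - up_set P r"] sep up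
      forest_class_tree[OF tree_poset_up_set[OF P rV]] by (auto simp: Un_absorb1)
  show "q_coeff n q1 q2 (up_set P r) P = 1"
    using q_coeff_no_crossing[OF P up] sep by blast
qed

text \<open>Since \<open>w\<close> has more trees than \<open>u\<close>, a subtree with complement
  \<open>u\<close> must be a full component. The coordinate thus counts the components of type
  \<open>t\<close> whose removal leaves \<open>u\<close>, each with coefficient \<open>1\<close>; in
  \<open>add_mset t u\<close> there are \<open>Suc (count u t)\<close> of them.\<close>

lemma coord_Dt_product:
  fixes q1 q2 :: "nat \<Rightarrow> 'k::field_char_0"
  assumes t: "t \<in> ctrees n" and u: "u \<in> cforests n" and w: "w \<in> cforests n" and size: "size u < size w"
  shows "coord (dual_product n q1 q2 (Dt n t) (D n u)) w =
    (if w = add_mset t u then of_nat (Suc (count u t)) else 0)"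
proof -
  obtain P where P: "forest_poset n P" and wP: "w = forest_class n P" using cforestsE[OF w] by blast
  let ?V = "verts P" and ?c = "\<lambda>s. forest_class n (subforest P s)"
  let ?tc = "\<lambda>r. tree_class n (subforest P (up_set P r))"
  have Dc: "coord (D n u' :: 'k functional) (?c s) = (if ?c s = u' then 1 else 0)" if "s \<subseteq> ?V" for s u'
    by (rule coord_D[OF forest_class_in_cforests[OF forest_poset_subforest[OF P that]]])
  have RV: "r \<in> ?V" if "r \<in> roots P" for r using that by (simp add: roots_def)
  let ?S = "{s \<in> Pow ?V. ?c s = {#t#} \<and> ?c (?V - s) = u}"
  let ?R = "{r \<in> roots P. ?tc r = t \<and> ?c (?V - up_set P r) = u}"
  have S: "?S = up_set P ` ?R"
  proof
    show "?S \<subseteq> up_set P ` ?R"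
    proof
      fix s assume s: "s \<in> ?S"
      then have sV: "s \<subseteq> ?V" by simp
      have tree: "tree_poset n (subforest P s)" "tree_class n (subforest P s) = t"
        using s forest_class_single_imp_tree[OF forest_poset_subforest[OF P sV]] by auto
      have "\<not> size (forest_class n P) \<le> size (?c (?V - s))" using s size wP by simp
      then have "s \<in> up_set P ` roots P"
        using subtree_component_or_size_le[OF P sV tree(1)] by blast
      then show "s \<in> up_set P ` ?R" using s tree(2) by auto
    qed
    show "up_set P ` ?R \<subseteq> ?S"
      using up_set_subset[OF P RV] forest_class_tree[OF tree_poset_up_set[OF P RV]] by auto
  qed
  have "coord (dual_product n q1 q2 (Dt n t) (D n u)) w =
      (\<Sum>s\<in>Pow ?V. if ?c s = {#t#} \<and> ?c (?V - s) = u then q_coeff n q1 q2 s P else 0)"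
    unfolding wP coord_dual_product[OF P] conv_def by (intro sum.cong refl) (auto simp: Dc)
  also have "\<dots> = (\<Sum>s\<in>?S. q_coeff n q1 q2 s P)"
    by (rule sum.inter_filter[symmetric]) (simp add: forest_posetD(1)[OF P])
  also have "\<dots> = (\<Sum>r\<in>?R. q_coeff n q1 q2 (up_set P r) P)"
    unfolding S by (intro sum.reindex[unfolded comp_def] inj_on_subset[OF inj_on_up_set[OF P]]) auto
  also have "\<dots> = of_nat (card ?R)"
  proof -
    have "(\<Sum>r\<in>?R. q_coeff n q1 q2 (up_set P r) P) = (\<Sum>r\<in>?R. 1)"
      by (intro sum.cong refl component_complement(2)[OF P]) blast
    then show ?thesis by simp
  qed
  finally have coord: "coord (dual_product n q1 q2 (Dt n t) (D n u)) w = of_nat (card ?R)" .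
  show ?thesis
  proof (cases "w = add_mset t u")
    case True
    have "?c (?V - up_set P r) = u" if "r \<in> roots P" "?tc r = t" for r
      using component_complement(1)[OF P that(1)] that(2) True wP by simp
    then have "?R = {r \<in> roots P. ?tc r = t}" by blast
    also have "card \<dots> = count w t"
      unfolding wP forest_class_roots[OF P]
      using finite_roots[OF P] by (simp add: count_image_mset_eq_card_vimage)
    finally show ?thesis using coord True by simp
  next
    case False
    then have "?R = {}" using component_complement(1)[OF P] wP by auto
    then have "card ?R = 0" by (simp only: card.empty)
    then show ?thesis using coord False by simp
  qed
qed

text \<open>The left factor is evaluated on the chosen vertices and the right one on their
  complement, while the bullet names the complement first; hence \<open>s\<close> and
  \<open>t\<close> exchange places. This explains the order of the terms in the bracket.\<close>

lemma coord_tree_product: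
  fixes q1 q2 :: "nat \<Rightarrow> 'k::field_char_0"
  assumes s: "s \<in> ctrees n" and t: "t \<in> ctrees n" and w: "w \<in> ctrees n"
  shows "coord (dual_product n q1 q2 (Dt n s) (Dt n t)) {#w#} = bullet_coeff n q1 q2 t s w"
proof -
  let ?P = "SOME P. P \<in> w"
  have "\<exists>P. P \<in> w" using in_ctreesE[OF w] in_ctree_iff[OF w] by metis
  then have Pw: "?P \<in> w" by (rule someI_ex)
  then have P: "forest_poset n ?P" "forest_class n ?P = {#w#}"
    using in_ctree_iff[OF w] forest_class_tree by (auto simp: tree_poset_def)
  have fin: "finite (Pow (verts ?P))" using forest_posetD(1)[OF P(1)] by simp
  have D: "coord (Dt n r :: 'k functional) (forest_class n (subforest ?P a)) = (if subforest ?P a \<in> r then 1 else 0)"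
    if "a \<subseteq> verts ?P" "r \<in> ctrees n" for a r
    using forest_class_single_iff[OF forest_poset_subforest[OF P(1) that(1)] that(2)]
    by (simp add: coord_D forest_class_in_cforests forest_poset_subforest[OF P(1) that(1)])
  have "coord (dual_product n q1 q2 (Dt n s) (Dt n t)) {#w#} =
      (\<Sum>a\<in>Pow (verts ?P). if subforest ?P a \<in> s \<and> subforest ?P (verts ?P - a) \<in> t
        then q_coeff n q1 q2 a ?P else 0)"
    unfolding P(2)[symmetric] coord_dual_product[OF P(1)] conv_def
    by (intro sum.cong refl) (auto simp: D s t)
  also have "\<dots> = bullet_coeff n q1 q2 t s w"
    unfolding bullet_coeff_def Let_def sum.inter_filter[OF fin, symmetric]
    by (intro sum.cong) auto
  finally show ?thesis .
qed

lemma finite_bullet_support: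
  assumes s: "s \<in> ctrees n" and t: "t \<in> ctrees n"
  shows "finite {w \<in> ctrees n. bullet_coeff n q1 q2 t s w \<noteq> 0}"
proof -
  let ?\<phi> = "dual_product n q1 q2 (Dt n s) (Dt n t)"
  have "finite {u \<in> cforests n. coord ?\<phi> u \<noteq> 0}"
    by (intro graded_dual_finite_support dual_product_closed D_in_graded_dual)
  moreover have "(\<lambda>w. {#w#}) ` {w \<in> ctrees n. bullet_coeff n q1 q2 t s w \<noteq> 0} \<subseteq>
      {u \<in> cforests n. coord ?\<phi> u \<noteq> 0}"
    using coord_tree_product[OF s t, of _ q1 q2] by auto
  ultimately show ?thesis
    by (metis (no_types, lifting) finite_imageD finite_subset inj_onI single_eq_single)
qed

section \<open>The span of the trees and its bracket\<close>

lemma tree_span_subset: "tree_span n \<subseteq> graded_dual_space n"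
  unfolding tree_span_def by (auto intro!: graded_dual_sum D_in_graded_dual)

lemma bullet_in_tree_span:
  assumes "s \<in> ctrees n" "t \<in> ctrees n"
  shows "bullet n q1 q2 t s \<in> tree_span n"
  unfolding tree_span_def bullet_def using finite_bullet_support[OF assms] by blast

lemma coord_tree_sum:
  assumes "finite F" "F \<subseteq> ctrees n" "u \<in> cforests n"
  shows "(\<Sum>t\<in>F. c t * coord (Dt n t) u) = (\<Sum>t\<in>F. if u = {#t#} then c t else 0)"
  using assms by (intro sum.cong) (auto simp: coord_D)

lemma finite_tree_support:
  assumes "\<phi> \<in> graded_dual_space n"
  shows "finite (tree_support n \<phi>)"
proof -
  have "finite ((\<lambda>t. {#t#}) ` tree_support n \<phi>)"
    by (rule finite_subset[OF _ graded_dual_finite_support[OF assms]])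
      (auto simp: tree_support_def)
  then show ?thesis by (rule finite_imageD) (simp add: inj_on_def)
qed

lemma graded_dual_expand_trees:
  assumes \<phi>: "\<phi> \<in> graded_dual_space n" and supp: "\<And>u. \<lbrakk>u \<in> cforests n; size u \<noteq> 1\<rbrakk> \<Longrightarrow> coord \<phi> u = 0"
  shows "\<phi> = (\<lambda>x. \<Sum>t\<in>tree_support n \<phi>. coord \<phi> {#t#} * Dt n t x)"
proof (rule graded_dual_eqI[OF \<phi>])
  let ?F = "tree_support n \<phi>" and ?c = "\<lambda>t. coord \<phi> {#t#}"
  note fin = finite_tree_support[OF \<phi>]
  have sub: "?F \<subseteq> ctrees n" by (auto simp: tree_support_def)
  fix u assume u: "u \<in> cforests n"
  show "coord \<phi> u = (\<Sum>t\<in>?F. ?c t * coord (Dt n t) u)"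
  proof (cases "size u = 1")
    case True
    then obtain t where t: "u = {#t#}" using size_1_singleton_mset by blast
    then show ?thesis
      using u fin unfolding coord_tree_sum[OF fin sub u] by (simp add: tree_support_def)
  next
    case False
    then have "(\<Sum>t\<in>?F. if u = {#t#} then ?c t else 0) = 0" by (intro sum.neutral) auto
    then show ?thesis using supp[OF u False] unfolding coord_tree_sum[OF fin sub u] by simp
  qed
qed (intro graded_dual_sum D_in_graded_dual)

text \<open>Describing the span by its support on forests with exactly one tree makes its closure
  properties statements about single coordinates.\<close>

lemma tree_span_iff:
  fixes \<phi> :: "'k::field_char_0 functional"
  shows "\<phi> \<in> tree_span n \<longleftrightarrow>
    \<phi> \<in> graded_dual_space n \<and> (\<forall>u\<in>cforests n. size u \<noteq> 1 \<longrightarrow> coord \<phi> u = 0)"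
proof
  assume "\<phi> \<in> tree_span n"
  moreover from this obtain F and c :: "ctree \<Rightarrow> 'k" where
    F: "finite F" "F \<subseteq> ctrees n" "\<phi> = (\<lambda>x. \<Sum>t\<in>F. c t * Dt n t x)"
    unfolding tree_span_def by blast
  have "coord \<phi> u = 0" if "u \<in> cforests n" "size u \<noteq> 1" for u
    unfolding F(3) coord_tree_sum[OF F(1,2) that(1)] using that(2) by (intro sum.neutral) auto
  ultimately show "\<phi> \<in> graded_dual_space n \<and> (\<forall>u\<in>cforests n. size u \<noteq> 1 \<longrightarrow> coord \<phi> u = 0)"
    using tree_span_subset by blast
next
  assume \<phi>: "\<phi> \<in> graded_dual_space n \<and> (\<forall>u\<in>cforests n. size u \<noteq> 1 \<longrightarrow> coord \<phi> u = 0)"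
  have "finite (tree_support n \<phi>)" "tree_support n \<phi> \<subseteq> ctrees n"
    using \<phi> finite_tree_support by (auto simp: tree_support_def)
  moreover have "\<phi> = (\<lambda>x. \<Sum>t\<in>tree_support n \<phi>. coord \<phi> {#t#} * Dt n t x)"
    using \<phi> by (intro graded_dual_expand_trees) auto
  ultimately show "\<phi> \<in> tree_span n"
    unfolding tree_span_def
    by (intro CollectI exI[of _ "tree_support n \<phi>"] exI[of _ "\<lambda>t. coord \<phi> {#t#}"] conjI)
qed

lemma tree_span_expand:
  assumes "\<phi> \<in> tree_span n"
  shows "\<phi> = (\<lambda>x. \<Sum>t\<in>tree_support n \<phi>. coord \<phi> {#t#} * Dt n t x)"
  using assms by (intro graded_dual_expand_trees) (auto simp: tree_span_iff)

text \<open>The bullet keeps the single-tree part of a product. At the empty forest both products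
  vanish, and the terms with at least two trees reduce to one whose forest and multiplicity are
  symmetric in \<open>s\<close> and \<open>t\<close>, so it cancels in the commutator.\<close>

lemma bullet_commutator:
  fixes q1 q2 :: "nat \<Rightarrow> 'k::field_char_0"
  assumes s: "s \<in> ctrees n" and t: "t \<in> ctrees n"
  shows "bullet n q1 q2 t s x - bullet n q1 q2 s t x =
    dual_product n q1 q2 (Dt n s) (Dt n t) x - dual_product n q1 q2 (Dt n t) (Dt n s) x"
proof -
  let ?st = "dual_product n q1 q2 (Dt n s) (Dt n t)" and ?ts = "dual_product n q1 q2 (Dt n t) (Dt n s)"
  have b: "bullet n q1 q2 t s \<in> graded_dual_space n" "bullet n q1 q2 s t \<in> graded_dual_space n"
    using bullet_in_tree_span tree_span_subset s t by blast+
  have coord_bullet: "coord (bullet n q1 q2 b a) u =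
      (if size u = 1 then coord (dual_product n q1 q2 (Dt n a) (Dt n b)) u else 0)"
    if "a \<in> ctrees n" "b \<in> ctrees n" "u \<in> cforests n" for a b u
  proof (cases "size u = 1")
    case True
    then obtain w where w: "u = {#w#}" using size_1_singleton_mset by blast
    then have "w \<in> ctrees n" using that by simp
    then show ?thesis
      using finite_bullet_support[OF that(1,2), of q1 q2] coord_tree_product[OF that(1,2), of w q1 q2] w
      unfolding bullet_def
      by (subst coord_tree_sum[OF _ _ that(3)]) auto
  next
    case False
    then show ?thesis
      using bullet_in_tree_span[OF that(1,2), of q1 q2] that(3) by (simp add: tree_span_iff)
  qed
  have "(\<lambda>x. bullet n q1 q2 t s x - bullet n q1 q2 s t x) = (\<lambda>x. ?st x - ?ts x)"
  proof (rule graded_dual_eqI[of _ n])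
    fix u assume u: "u \<in> cforests n"
    consider "size u = 1" | "u = {#}" | "1 < size u"
      by (metis One_nat_def less_one linorder_neqE_nat size_eq_0_iff_empty)
    then show "coord (bullet n q1 q2 t s) u - coord (bullet n q1 q2 s t) u = coord ?st u - coord ?ts u"
    proof cases
      case 1
      then show ?thesis using coord_bullet s t u by simp
    next
      case 2
      obtain P where P: "forest_poset n P" "u = forest_class n P" using cforestsE[OF u] by blast
      then have V: "verts P = {}" using 2 forest_class_empty_iff by metis
      then have e: "forest_class n (subforest P {}) = {#}"
        using forest_class_subforest_empty_iff[OF P(1)] by blast
      have "coord (Dt n a :: 'k functional) {#} = 0" for a by (simp add: D_def lookup_one when_def)
      then have "coord (dual_product n q1 q2 (Dt n a) (Dt n b)) u = 0" for a b
        unfolding P(2) coord_dual_product[OF P(1)] conv_def V by (simp add: e)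
      then show ?thesis using coord_bullet[OF s t u] coord_bullet[OF t s u] by simp
    next
      case 3
      then show ?thesis
        using coord_bullet s t u by (simp add: coord_Dt_product add_mset_commute)
    qed
  qed (intro graded_dual_diff dual_product_closed D_in_graded_dual b)+
  then show ?thesis by meson
qed

text \<open>Bilinearity extends the case of two trees. From here on the Lie algebra axioms reduce to
  properties of an associative product.\<close>

lemma tree_bracket_commutator:
  assumes \<phi>: "\<phi> \<in> tree_span n" and \<psi>: "\<psi> \<in> tree_span n"
  shows "tree_bracket n q1 q2 \<phi> \<psi> = (\<lambda>x. dual_product n q1 q2 \<phi> \<psi> x - dual_product n q1 q2 \<psi> \<phi> x)"
proof
  fix x
  let ?S = "tree_support n \<phi>" and ?T = "tree_support n \<psi>"
  let ?p = "\<lambda>s t. dual_product n q1 q2 (Dt n s) (Dt n t) x"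
  have S: "?S \<subseteq> ctrees n" "?T \<subseteq> ctrees n" by (auto simp: tree_support_def)
  have "dual_product n q1 q2 \<phi> \<psi> =
    dual_product n q1 q2 (\<lambda>x. \<Sum>s\<in>?S. coord \<phi> {#s#} * Dt n s x) (\<lambda>x. \<Sum>t\<in>?T. coord \<psi> {#t#} * Dt n t x)"
    using tree_span_expand[OF \<phi>] tree_span_expand[OF \<psi>] by metis
  then have 1: "dual_product n q1 q2 \<phi> \<psi> x = (\<Sum>s\<in>?S. \<Sum>t\<in>?T. coord \<phi> {#s#} * coord \<psi> {#t#} * ?p s t)"
    by (simp add: dual_product_sum sum_distrib_left mult.assoc)
  have "dual_product n q1 q2 \<psi> \<phi> =
    dual_product n q1 q2 (\<lambda>x. \<Sum>t\<in>?T. coord \<psi> {#t#} * Dt n t x) (\<lambda>x. \<Sum>s\<in>?S. coord \<phi> {#s#} * Dt n s x)"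
    using tree_span_expand[OF \<phi>] tree_span_expand[OF \<psi>] by metis
  then have "dual_product n q1 q2 \<psi> \<phi> x = (\<Sum>t\<in>?T. \<Sum>s\<in>?S. coord \<phi> {#s#} * coord \<psi> {#t#} * ?p t s)"
    by (simp add: dual_product_sum sum_distrib_left mult.left_commute[of "coord \<phi> _"] mult.assoc)
  then have 2: "dual_product n q1 q2 \<psi> \<phi> x = (\<Sum>s\<in>?S. \<Sum>t\<in>?T. coord \<phi> {#s#} * coord \<psi> {#t#} * ?p t s)"
    by (subst sum.swap) simp
  show "tree_bracket n q1 q2 \<phi> \<psi> x = dual_product n q1 q2 \<phi> \<psi> x - dual_product n q1 q2 \<psi> \<phi> x"
    unfolding tree_bracket_def 1 2 sum_subtractf[symmetric]
    using S by (intro sum.cong refl) (simp add: bullet_commutator right_diff_distrib subset_eq)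
qed

lemma Dt_in_tree_span: "t \<in> ctrees n \<Longrightarrow> Dt n t \<in> tree_span n"
  by (auto simp: tree_span_iff D_in_graded_dual coord_D)

lemma tree_bracket_Dt:
  assumes "s \<in> ctrees n" "t \<in> ctrees n"
  shows "tree_bracket n q1 q2 (Dt n s) (Dt n t) = (\<lambda>x. bullet n q1 q2 t s x - bullet n q1 q2 s t x)"
  using assms by (simp add: tree_bracket_commutator Dt_in_tree_span bullet_commutator)

section \<open>The Lie algebra axioms and primitivity\<close>

lemma tree_span_zero: "(\<lambda>x. 0) \<in> tree_span n"
  by (simp add: tree_span_iff graded_dual_zero)

lemma tree_span_add:
  "\<lbrakk>\<phi> \<in> tree_span n; \<psi> \<in> tree_span n\<rbrakk> \<Longrightarrow> (\<lambda>x. \<phi> x + \<psi> x) \<in> tree_span n"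
  by (simp add: tree_span_iff graded_dual_add)

lemma tree_span_scale: "\<phi> \<in> tree_span n \<Longrightarrow> (\<lambda>x. c * \<phi> x) \<in> tree_span n"
  by (simp add: tree_span_iff graded_dual_scale)

lemma tree_span_diff:
  "\<lbrakk>\<phi> \<in> tree_span n; \<psi> \<in> tree_span n\<rbrakk> \<Longrightarrow> (\<lambda>x. \<phi> x - \<psi> x) \<in> tree_span n"
  by (simp add: tree_span_iff graded_dual_diff)

lemma tree_span_sum:
  assumes "\<And>i. i \<in> I \<Longrightarrow> f i \<in> tree_span n"
  shows "(\<lambda>x. \<Sum>i\<in>I. c i * f i x) \<in> tree_span n"
  using assms
  by (induction I rule: infinite_finite_induct) (simp_all add: tree_span_zero tree_span_add tree_span_scale)

lemma tree_bracket_closed: "tree_bracket n q1 q2 \<phi> \<psi> \<in> tree_span n"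
proof -
  have "(\<lambda>x. bullet n q1 q2 t s x - bullet n q1 q2 s t x) \<in> tree_span n"
    if "s \<in> tree_support n \<phi>" "t \<in> tree_support n \<psi>" for s t
    using that by (intro tree_span_diff bullet_in_tree_span) (auto simp: tree_support_def)
  \<comment> \<open>The factor \<open>1\<close> gives the outer sum the shape required by
    \<open>tree_span_sum\<close>.\<close>
  then have "(\<lambda>x. \<Sum>s\<in>tree_support n \<phi>. 1 * (\<Sum>t\<in>tree_support n \<psi>. coord \<phi> {#s#} * coord \<psi> {#t#} *
      (bullet n q1 q2 t s x - bullet n q1 q2 s t x))) \<in> tree_span n"
    by (intro tree_span_sum) blast
  then show ?thesis unfolding tree_bracket_def by simp
qed

lemma tree_lie_simps [simp]:
  "carrier (tree_lie n q1 q2) = tree_span n"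
  "zero (tree_lie n q1 q2) = (\<lambda>x. 0)"
  "add (tree_lie n q1 q2) = (\<lambda>\<phi> \<psi> x. \<phi> x + \<psi> x)"
  "module.smult (tree_lie n q1 q2) = (\<lambda>c \<phi> x. c * \<phi> x)"
  by (simp_all add: tree_lie_def)

lemma tree_lie_algebra:
  fixes q1 q2 :: "nat \<Rightarrow> 'k::field_char_0"
  shows "lie_algebra (ring_of_type_algebra :: 'k ring) (tree_lie n q1 q2) (tree_bracket n q1 q2)"
proof (intro lie_algebra.intro lie_algebra_axioms.intro)
  have "abelian_group (tree_lie n q1 q2)"
  proof (rule abelian_groupI)
    fix \<phi> assume "\<phi> \<in> carrier (tree_lie n q1 q2)"
    then show "\<exists>\<psi>\<in>carrier (tree_lie n q1 q2). \<psi> \<oplus>\<^bsub>tree_lie n q1 q2\<^esub> \<phi> = \<zero>\<^bsub>tree_lie n q1 q2\<^esub>"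
      using tree_span_scale[of \<phi> n "-1"] by (intro bexI[of _ "\<lambda>x. - 1 * \<phi> x"]) auto
  qed (auto simp: tree_span_add tree_span_zero add_ac)
  then show "module (ring_of_type_algebra :: 'k ring) (tree_lie n q1 q2)"
    by (intro moduleI cring_from_type_algebra) (auto simp: tree_span_scale algebra_simps)
next
  fix \<phi> \<psi> \<chi> assume "\<phi> \<in> carrier (tree_lie n q1 q2)" "\<psi> \<in> carrier (tree_lie n q1 q2)"
    "\<chi> \<in> carrier (tree_lie n q1 q2)"
  then have span: "\<phi> \<in> tree_span n" "\<psi> \<in> tree_span n" "\<chi> \<in> tree_span n" by simp_all
  then have G: "\<phi> \<in> graded_dual_space n" "\<psi> \<in> graded_dual_space n" "\<chi> \<in> graded_dual_space n"
    using tree_span_subset by blast+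
  have diff: "dual_product n q1 q2 \<alpha> (\<lambda>x. \<beta> x - \<gamma> x) =
      (\<lambda>x. dual_product n q1 q2 \<alpha> \<beta> x - dual_product n q1 q2 \<alpha> \<gamma> x)"
    "dual_product n q1 q2 (\<lambda>x. \<beta> x - \<gamma> x) \<alpha> =
      (\<lambda>x. dual_product n q1 q2 \<beta> \<alpha> x - dual_product n q1 q2 \<gamma> \<alpha> x)" for \<alpha> \<beta> \<gamma> :: "'k functional"
    using dual_product_add(2)[of n q1 q2 \<alpha> \<beta> "\<lambda>x. - 1 * \<gamma> x"]
      dual_product_add(1)[of n q1 q2 \<beta> "\<lambda>x. - 1 * \<gamma> x" \<alpha>]
      dual_product_scale(1)[of n q1 q2 "- 1" \<gamma> \<alpha>] dual_product_scale(2)[of n q1 q2 \<alpha> "- 1" \<gamma>] by simp_all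
  \<comment> \<open>Associativity brings all four triple products into right-bracketed form. In the
    cyclic sum each of the six orders of the factors then occurs once with either sign.\<close>
  have nested: "tree_bracket n q1 q2 \<alpha> (tree_bracket n q1 q2 \<beta> \<gamma>) =
     (\<lambda>x. dual_product n q1 q2 \<alpha> (dual_product n q1 q2 \<beta> \<gamma>) x - dual_product n q1 q2 \<alpha> (dual_product n q1 q2 \<gamma> \<beta>) x
       - (dual_product n q1 q2 \<beta> (dual_product n q1 q2 \<gamma> \<alpha>) x - dual_product n q1 q2 \<gamma> (dual_product n q1 q2 \<beta> \<alpha>) x))"
    if "\<alpha> \<in> tree_span n" "\<beta> \<in> tree_span n" "\<gamma> \<in> tree_span n" for \<alpha> \<beta> \<gamma> :: "'k functional"
  proof -
    have "\<alpha> \<in> graded_dual_space n" "\<beta> \<in> graded_dual_space n" "\<gamma> \<in> graded_dual_space n"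
      using that tree_span_subset by blast+
    then show ?thesis
      using that tree_bracket_commutator[OF that(1) tree_bracket_closed, of q1 q2 q1 q2 \<beta> \<gamma>]
      by (simp add: tree_bracket_commutator diff dual_product_assoc)
  qed
  show "tree_bracket n q1 q2 \<phi> (tree_bracket n q1 q2 \<psi> \<chi>) \<oplus>\<^bsub>tree_lie n q1 q2\<^esub>
      tree_bracket n q1 q2 \<psi> (tree_bracket n q1 q2 \<chi> \<phi>) \<oplus>\<^bsub>tree_lie n q1 q2\<^esub>
      tree_bracket n q1 q2 \<chi> (tree_bracket n q1 q2 \<phi> \<psi>) = \<zero>\<^bsub>tree_lie n q1 q2\<^esub>"
    by (simp add: nested span)
next
  fix \<phi> \<psi> :: "'k functional"
  show "tree_bracket n q1 q2 \<phi> \<psi> \<in> carrier (tree_lie n q1 q2)"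
    by (simp add: tree_bracket_closed)
qed (auto simp: tree_bracket_commutator tree_span_add tree_span_scale
    dual_product_add dual_product_scale algebra_simps)

text \<open>The disjoint union \<open>u + v\<close> is a single tree only if one of \<open>u\<close>
  and \<open>v\<close> is empty and the other is that tree. The transposed multiplication therefore
  produces just the two primitive terms.\<close>

lemma tree_span_primitive:
  fixes \<phi> :: "'k::field_char_0 functional"
  assumes "\<phi> \<in> tree_span n"
  shows "primitive_functional n \<phi>"
proof -
  \<comment> \<open>The identity to be shown ranges over the whole ambient type, so multisets
    outside \<open>cforests n\<close> must be covered too; there the functional is \<open>0\<close>
    by convention.\<close>
  have eval: "coord \<phi> u = (if u \<in> cforests n \<and> size u = 1 then coord \<phi> u else 0)" for u
  proof (cases "u \<in> cforests n")
    case True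
    then show ?thesis using assms by (auto simp: tree_span_iff)
  next
    case False
    then have "Poly_Mapping.single u (1 :: 'k) \<notin> forest_space n" by (simp add: forest_space_def)
    moreover have "\<phi> \<in> graded_dual_space n" using assms tree_span_subset by blast
    ultimately have "coord \<phi> u = 0" by (simp add: graded_dual_space_def)
    with False show ?thesis by simp
  qed
  have unit: "coord (D n {#}) u = (if u = {#} then 1 else 0)" for u
    by (simp add: D_def lookup_single when_def forest_space_def)
  have "coord \<phi> (u + v) = coord \<phi> u * coord (D n {#}) v + coord (D n {#}) u * coord \<phi> v" for u v
  proof -
    have "coord \<phi> (u + v) = 0" if "u \<noteq> {#}" "v \<noteq> {#}"
      using that eval[of "u + v"] by (auto simp: size_eq_0_iff_empty[symmetric] simp del: size_eq_0_iff_empty)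
    moreover have "coord \<phi> {#} = 0" using eval[of "{#}"] by simp
    ultimately show ?thesis by (auto simp: unit)
  qed
  then show ?thesis
    unfolding primitive_functional_def dual_coproduct_def tensor_functional_def
    by (simp add: fun_eq_iff case_prod_unfold mult_single sum.distrib[symmetric] distrib_left[symmetric])
qed

section \<open>The universal property\<close>

text \<open>The function takes minima in a well-order of the whole type, since isomorphism classes
  have no canonical linear order. What is recorded is that a minimum stays the minimum of each
  subset containing it.\<close>

lemma ex_min_choice:
  "\<exists>m :: 'a set \<Rightarrow> 'a. \<forall>A B. A \<noteq> {} \<longrightarrow> m A \<in> A \<and> (B \<subseteq> A \<and> m A \<in> B \<longrightarrow> m B = m A)"
proof -
  obtain r :: "'a rel" where r: "well_order_on UNIV r" using well_order_on by blast
  then have wf: "wf (r - Id)" and lin: "refl r" "antisym r" "total r"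
    by (auto simp: well_order_on_def linear_order_on_def partial_order_on_def preorder_on_def)
  define m where "m A = (THE x. x \<in> A \<and> (\<forall>y\<in>A. (x, y) \<in> r))" for A
  have m: "m A = x" if "x \<in> A" "\<forall>y\<in>A. (x, y) \<in> r" for A x
    unfolding m_def using that lin(2) by (intro the_equality) (auto simp: antisym_def)
  have ex: "\<exists>x\<in>A. \<forall>y\<in>A. (x, y) \<in> r" if A: "A \<noteq> {}" for A
  proof -
    obtain z where "z \<in> A" using A by blast
    then obtain x where x: "x \<in> A" "\<And>y. (y, x) \<in> r - Id \<Longrightarrow> y \<notin> A"
      by (rule wfE_min[OF wf]) blast
    have "(x, y) \<in> r" if "y \<in> A" for y
      using x(2)[of y] that lin by (cases "x = y") (auto simp: refl_on_def total_on_def)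
    with x(1) show ?thesis by blast
  qed
  have "m A \<in> A \<and> (B \<subseteq> A \<and> m A \<in> B \<longrightarrow> m B = m A)" if "A \<noteq> {}" for A B
  proof -
    obtain x where x: "x \<in> A" "\<forall>y\<in>A. (x, y) \<in> r" using ex \<open>A \<noteq> {}\<close> by blast
    then have "m A = x" by (rule m)
    then show ?thesis using x m[of x B] by auto
  qed
  then show ?thesis by blast
qed

text \<open>The least element with respect to some well-order on the trees.\<close>

definition min_tree :: "cforest \<Rightarrow> ctree" where
  "min_tree u = (SOME m. \<forall>A B. A \<noteq> {} \<longrightarrow> m A \<in> A \<and> (B \<subseteq> A \<and> m A \<in> B \<longrightarrow> m B = m A)) (set_mset u)"

lemma min_tree_in: "u \<noteq> {#} \<Longrightarrow> min_tree u \<in># u"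
  using someI_ex[OF ex_min_choice[where 'a = ctree]] unfolding min_tree_def by auto

lemma min_tree_subset:
  assumes "set_mset v \<subseteq> set_mset u" "min_tree u \<in># v"
  shows "min_tree v = min_tree u"
proof -
  have "set_mset u \<noteq> {}" using assms by auto
  then show ?thesis
    using someI_ex[OF ex_min_choice[where 'a = ctree]] assms unfolding min_tree_def by blast
qed

text \<open>As a remainder it makes the product formula true by definition. All that is used about
  its coordinates is a bound on the number of trees in its support.\<close>

definition lower_terms ::
    "nat \<Rightarrow> (nat \<Rightarrow> 'k::field_char_0) \<Rightarrow> (nat \<Rightarrow> 'k) \<Rightarrow> ctree \<Rightarrow> cforest \<Rightarrow> 'k functional" where
  "lower_terms n q1 q2 t v =
     (\<lambda>x. dual_product n q1 q2 (Dt n t) (D n v) x - of_nat (Suc (count v t)) * D n (add_mset t v) x)"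

lemma lower_terms_in_graded_dual: "lower_terms n q1 q2 t v \<in> graded_dual_space n"
  unfolding lower_terms_def
  by (intro graded_dual_diff graded_dual_scale dual_product_closed D_in_graded_dual)

lemma coord_lower_terms:
  assumes "t \<in> ctrees n" "v \<in> cforests n" "w \<in> cforests n" "size v < size w"
  shows "coord (lower_terms n q1 q2 t v) w = 0"
  using coord_Dt_product[OF assms, of q1 q2] assms by (simp add: lower_terms_def coord_D)

lemma Dt_product_eq:
  "dual_product n q1 q2 (Dt n t) (D n v) =
    (\<lambda>x. of_nat (Suc (count v t)) * D n (add_mset t v) x + 1 * lower_terms n q1 q2 t v x)"
  by (simp add: lower_terms_def)

text \<open>The leading coefficient is a positive integer and hence invertible in characteristic
  zero. This is the product formula solved for the forest with the most trees.\<close>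

lemma D_eq:
  "D n (add_mset t v) = (\<lambda>x. inverse (of_nat (Suc (count v t))) * dual_product n q1 q2 (Dt n t) (D n v) x +
     (- inverse (of_nat (Suc (count v t)))) * lower_terms n q1 q2 t v x)"
  by (simp add: lower_terms_def field_simps del: of_nat_Suc)

lemma graded_dual_expand:
  fixes \<phi> :: "'k::field_char_0 functional"
  assumes "\<phi> \<in> graded_dual_space n"
  shows "\<phi> = (\<lambda>x. \<Sum>u\<in>{u \<in> cforests n. coord \<phi> u \<noteq> 0}. coord \<phi> u * D n u x)"
proof (rule graded_dual_eqI[OF assms])
  fix w assume w: "w \<in> cforests n"
  let ?S = "{u \<in> cforests n. coord \<phi> u \<noteq> 0}"
  have "(\<Sum>u\<in>?S. coord \<phi> u * coord (D n u) w) = (\<Sum>u\<in>?S. if u = w then coord \<phi> u else 0)"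
    by (intro sum.cong refl) (auto simp: coord_D[OF w])
  then show "coord \<phi> w = (\<Sum>u\<in>?S. coord \<phi> u * coord (D n u) w)"
    using w graded_dual_finite_support[OF assms] by simp
qed (intro graded_dual_sum D_in_graded_dual)

text \<open>The step retains that \<open>u\<close> lies in the support of the original
  \<open>\<phi>\<close>, so bounds on the number of trees in this support are available in the
  induction.\<close>

lemma graded_dual_induct [consumes 1, case_names zero comb]:
  fixes \<phi> :: "'k::field_char_0 functional"
  assumes \<phi>: "\<phi> \<in> graded_dual_space n" and zero: "P (\<lambda>x. 0)"
    and comb: "\<And>c u \<psi>. \<lbrakk>u \<in> cforests n; coord \<phi> u \<noteq> 0; \<psi> \<in> graded_dual_space n; P \<psi>\<rbrakk> \<Longrightarrow>
      P (\<lambda>x. c * D n u x + \<psi> x)"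
  shows "P \<phi>"
proof -
  have "P (\<lambda>x. \<Sum>u\<in>S. coord \<phi> u * D n u x)"
    if "finite S" "S \<subseteq> {u \<in> cforests n. coord \<phi> u \<noteq> 0}" for S
    using that
  proof (induction S rule: finite_induct)
    case empty
    show ?case using zero by simp
  next
    case (insert u S)
    have "(\<lambda>x. \<Sum>u\<in>S. coord \<phi> u * D n u x) \<in> graded_dual_space n"
      by (intro graded_dual_sum D_in_graded_dual)
    with insert comb[of u "\<lambda>x. \<Sum>u\<in>S. coord \<phi> u * D n u x" "coord \<phi> u"] show ?case by simp
  qed
  from this[OF graded_dual_finite_support[OF \<phi>] subset_refl] show ?thesis
    using graded_dual_expand[OF \<phi>] by simp
qed

text \<open>The trees generate the dual as an algebra: by induction on the number of trees,
  \<open>D n u\<close> arises from a tree times a smaller forest and from lower terms. This serves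
  both the multiplicativity and the uniqueness of the extension.\<close>

lemma graded_dual_generated:
  fixes \<phi> :: "'k::field_char_0 functional" and q1 q2 :: "nat \<Rightarrow> 'k"
  assumes \<phi>: "\<phi> \<in> graded_dual_space n" and one: "P (D n {#})"
    and comb: "\<And>a b \<phi> \<psi>. \<lbrakk>\<phi> \<in> graded_dual_space n; \<psi> \<in> graded_dual_space n; P \<phi>; P \<psi>\<rbrakk> \<Longrightarrow>
      P (\<lambda>x. a * \<phi> x + b * \<psi> x)"
    and mult: "\<And>t \<phi>. \<lbrakk>t \<in> ctrees n; \<phi> \<in> graded_dual_space n; P \<phi>\<rbrakk> \<Longrightarrow>
      P (dual_product n q1 q2 (Dt n t) \<phi>)"
  shows "P \<phi>"
proof -
  have zero: "P (\<lambda>x. 0)"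
    using comb[OF D_in_graded_dual D_in_graded_dual one one, of 0 0] by simp
  have step: "P (\<lambda>x. c * D n u x + \<psi> x)"
    if "P (D n u)" "\<psi> \<in> graded_dual_space n" "P \<psi>" for c u \<psi>
    using comb[OF D_in_graded_dual that(2,1,3), of c 1] by simp
  have D: "P (D n u)" if "u \<in> cforests n" for u
    using that
  proof (induction "size u" arbitrary: u rule: less_induct)
    case less
    show ?case
    proof (cases u)
      case empty
      then show ?thesis using one by simp
    next
      case (add t v)
      then have tv: "t \<in> ctrees n" "v \<in> cforests n" using less.prems by auto
      have "P (lower_terms n q1 q2 t v)"
        using lower_terms_in_graded_dual
      proof (induction rule: graded_dual_induct)
        case (comb c w \<psi>)
        then have "size w \<le> size v" using coord_lower_terms[OF tv] not_le by blast
        with comb show ?case using less.hyps[of w] \<open>u = add_mset t v\<close> step by simp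
      qed (rule zero)
      moreover have "P (dual_product n q1 q2 (Dt n t) (D n v))"
        using mult[OF tv(1) D_in_graded_dual] less.hyps[of v] add tv(2) by simp
      ultimately show ?thesis
        unfolding \<open>u = add_mset t v\<close> D_eq[of n t v q1 q2]
        by (intro comb dual_product_closed D_in_graded_dual lower_terms_in_graded_dual)
    qed
  qed
  show ?thesis
    using \<phi> by (induction rule: graded_dual_induct) (use zero D step in blast)+
qed

lemma min_tree_add_cases:
  assumes "min_tree (add_mset t v) \<noteq> t"
  obtains s v' where "v = add_mset s v'" "min_tree v = s" "min_tree (add_mset s (add_mset t v')) = s"
proof -
  let ?s = "min_tree (add_mset t v)"
  have "?s \<in># v" using min_tree_in[of "add_mset t v"] assms by auto
  then obtain v' where v': "v = add_mset ?s v'" by (metis mset_add)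
  moreover have "min_tree v = ?s" using min_tree_subset[of v "add_mset t v"] \<open>?s \<in># v\<close> by auto
  moreover have "min_tree (add_mset ?s (add_mset t v')) = ?s"
    using v' by (metis add_mset_commute)
  ultimately show ?thesis by (rule that)
qed

locale tree_lie_hom =
  assoc_algebra "ring_of_type_algebra :: 'k::field_char_0 ring" A
  for A :: "('k::field_char_0, 'b) module" (structure) +
  fixes n :: nat and q1 q2 :: "nat \<Rightarrow> 'k::field_char_0" and f :: "'k::field_char_0 functional \<Rightarrow> 'b"
  assumes f: "f \<in> lie_to_assoc_hom ring_of_type_algebra (tree_lie n q1 q2) (tree_bracket n q1 q2) A"
begin

abbreviation dual_prod :: "'k functional \<Rightarrow> 'k functional \<Rightarrow> 'k functional" (infixl "\<star>" 70) where
  "\<phi> \<star> \<psi> \<equiv> dual_product n q1 q2 \<phi> \<psi>"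

section \<open>Arithmetic of the target algebra and of the Lie homomorphism\<close>

lemma scale_closed: "x \<in> carrier A \<Longrightarrow> c \<odot> x \<in> carrier A"
  using smult_closed[of c x] by simp

lemma scale_add_left: "x \<in> carrier A \<Longrightarrow> (c + d) \<odot> x = c \<odot> x \<oplus> d \<odot> x"
  using smult_l_distr[of c d x] by simp

lemma scale_add_right: "\<lbrakk>x \<in> carrier A; y \<in> carrier A\<rbrakk> \<Longrightarrow> c \<odot> (x \<oplus> y) = c \<odot> x \<oplus> c \<odot> y"
  using smult_r_distr[of c x y] by simp

lemma scale_mult: "x \<in> carrier A \<Longrightarrow> (c * d) \<odot> x = c \<odot> (d \<odot> x)"
  using smult_assoc1[of c d x] by simp

lemma scale_one: "x \<in> carrier A \<Longrightarrow> 1 \<odot> x = x"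
  using smult_one[of x] by simp

lemma scale_zero_left: "x \<in> carrier A \<Longrightarrow> 0 \<odot> x = \<zero>"
  using smult_l_null[of x] by simp

lemma scale_zero_right: "c \<odot> \<zero> = \<zero>"
  using smult_r_null[of c] by simp

lemma scale_prod_left: "\<lbrakk>x \<in> carrier A; y \<in> carrier A\<rbrakk> \<Longrightarrow> (c \<odot> x) \<otimes> y = c \<odot> (x \<otimes> y)"
  using smult_mult_left[of c x y] by simp

lemma scale_prod_right: "\<lbrakk>x \<in> carrier A; y \<in> carrier A\<rbrakk> \<Longrightarrow> x \<otimes> (c \<odot> y) = c \<odot> (x \<otimes> y)"
  using smult_mult_right[of c x y] by simp

lemma f_closed: "\<phi> \<in> tree_span n \<Longrightarrow> f \<phi> \<in> carrier A"
  using f by (auto simp: lie_to_assoc_hom_def)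

lemma f_add: "\<lbrakk>\<phi> \<in> tree_span n; \<psi> \<in> tree_span n\<rbrakk> \<Longrightarrow> f (\<lambda>x. \<phi> x + \<psi> x) = f \<phi> \<oplus> f \<psi>"
  using f by (auto simp: lie_to_assoc_hom_def)

lemma f_scale: "\<phi> \<in> tree_span n \<Longrightarrow> f (\<lambda>x. c * \<phi> x) = c \<odot> f \<phi>"
  using f by (auto simp: lie_to_assoc_hom_def)

lemma f_bracket:
  "\<lbrakk>\<phi> \<in> tree_span n; \<psi> \<in> tree_span n\<rbrakk> \<Longrightarrow>
     f (tree_bracket n q1 q2 \<phi> \<psi>) = f \<phi> \<otimes> f \<psi> \<ominus> f \<psi> \<otimes> f \<phi>"
  using f by (auto simp: lie_to_assoc_hom_def)

section \<open>Linear extension with values in the target algebra\<close>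

definition lin_ext :: "(cforest \<Rightarrow> 'b) \<Rightarrow> 'k functional \<Rightarrow> 'b" where
  "lin_ext g \<phi> = (\<Oplus>u\<in>{u \<in> cforests n. coord \<phi> u \<noteq> 0}. coord \<phi> u \<odot> g u)"

lemma lin_ext_superset:
  assumes g: "g \<in> cforests n \<rightarrow> carrier A"
    and S: "finite S" "{u \<in> cforests n. coord \<phi> u \<noteq> 0} \<subseteq> S" "S \<subseteq> cforests n"
  shows "lin_ext g \<phi> = (\<Oplus>u\<in>S. coord \<phi> u \<odot> g u)"
  unfolding lin_ext_def
proof (rule add.finprod_mono_neutral_cong_left[OF S(1,2)])
  show "coord \<phi> u \<odot> g u = \<zero>" if "u \<in> S - {u \<in> cforests n. coord \<phi> u \<noteq> 0}" for u
  proof -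
    have "coord \<phi> u = 0" "g u \<in> carrier A" using that S(3) g by auto
    then show ?thesis by (simp add: scale_zero_left)
  qed
qed (use S(3) g in \<open>auto intro: scale_closed\<close>)

lemma lin_ext_closed:
  assumes "g \<in> cforests n \<rightarrow> carrier A"
  shows "lin_ext g \<phi> \<in> carrier A"
  unfolding lin_ext_def using assms by (intro finsum_closed) (auto intro: scale_closed)

lemma lin_ext_cong:
  assumes "g \<in> cforests n \<rightarrow> carrier A"
    and "\<And>u. \<lbrakk>u \<in> cforests n; coord \<phi> u \<noteq> 0\<rbrakk> \<Longrightarrow> h u = g u"
  shows "lin_ext h \<phi> = lin_ext g \<phi>"
  unfolding lin_ext_def using assms by (intro finsum_cong') (auto intro: scale_closed)

lemma finsum_scale:
  assumes "finite S" "h \<in> S \<rightarrow> carrier A"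
  shows "(\<Oplus>u\<in>S. c \<odot> h u) = c \<odot> (\<Oplus>u\<in>S. h u)"
  using assms
proof (induction S rule: finite_induct)
  case empty
  show ?case by (simp add: scale_zero_right)
next
  case (insert u S)
  then have "h u \<in> carrier A" "h \<in> S \<rightarrow> carrier A" "(\<lambda>u. c \<odot> h u) \<in> S \<rightarrow> carrier A"
    by (auto intro: scale_closed)
  with insert show ?case by (simp add: scale_closed scale_add_right finsum_closed)
qed

lemma lin_ext_comb:
  assumes g: "g \<in> cforests n \<rightarrow> carrier A"
    and \<phi>: "\<phi> \<in> graded_dual_space n" and \<psi>: "\<psi> \<in> graded_dual_space n"
  shows "lin_ext g (\<lambda>x. a * \<phi> x + b * \<psi> x) = a \<odot> lin_ext g \<phi> \<oplus> b \<odot> lin_ext g \<psi>"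
proof -
  let ?S = "{u \<in> cforests n. coord \<phi> u \<noteq> 0} \<union> {u \<in> cforests n. coord \<psi> u \<noteq> 0}"
  have S: "finite ?S" "?S \<subseteq> cforests n"
    using graded_dual_finite_support[OF \<phi>] graded_dual_finite_support[OF \<psi>] by auto
  have g': "g u \<in> carrier A" if "u \<in> ?S" for u using g that by auto
  have "lin_ext g (\<lambda>x. a * \<phi> x + b * \<psi> x) = (\<Oplus>u\<in>?S. (a * coord \<phi> u + b * coord \<psi> u) \<odot> g u)"
    by (rule lin_ext_superset[OF g S(1) _ S(2)]) auto
  also have "\<dots> = (\<Oplus>u\<in>?S. a \<odot> (coord \<phi> u \<odot> g u) \<oplus> b \<odot> (coord \<psi> u \<odot> g u))"
    using g' by (intro finsum_cong') (auto simp: scale_add_left scale_mult scale_closed)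
  also have "\<dots> = (\<Oplus>u\<in>?S. a \<odot> (coord \<phi> u \<odot> g u)) \<oplus> (\<Oplus>u\<in>?S. b \<odot> (coord \<psi> u \<odot> g u))"
    using g' by (intro finsum_addf) (auto simp: scale_closed)
  also have "\<dots> = a \<odot> (\<Oplus>u\<in>?S. coord \<phi> u \<odot> g u) \<oplus> b \<odot> (\<Oplus>u\<in>?S. coord \<psi> u \<odot> g u)"
    using g' S(1) by (subst (1 2) finsum_scale) (auto simp: scale_closed)
  also have "\<dots> = a \<odot> lin_ext g \<phi> \<oplus> b \<odot> lin_ext g \<psi>"
    using lin_ext_superset[OF g S(1) _ S(2), of \<phi>] lin_ext_superset[OF g S(1) _ S(2), of \<psi>] by auto
  finally show ?thesis .
qed

lemma lin_ext_D:
  assumes "g \<in> cforests n \<rightarrow> carrier A" "u \<in> cforests n"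
  shows "lin_ext g (D n u) = g u"
proof -
  have "g u \<in> carrier A" using assms by auto
  moreover have "lin_ext g (D n u) = (\<Oplus>w\<in>{u}. coord (D n u) w \<odot> g w)"
    using assms(2) by (intro lin_ext_superset[OF assms(1)]) (auto simp: coord_D split: if_splits)
  ultimately show ?thesis using assms(2) by (simp add: coord_D scale_one scale_closed)
qed

text \<open>The value on \<open>D\<^sub>u\<close> is forced by the product of \<open>D\<^sub>t\<close> with \<open>D\<^bsub>u - t\<^esub>\<close> for the least tree \<open>t\<close> of \<open>u\<close>.
  The guard on the size is vacuous, since no other term of this product has as many trees as \<open>u\<close>.\<close>

function forest_ext :: "cforest \<Rightarrow> 'b" where
  "forest_ext u =
    (if u = {#} then \<one>
     else inverse (of_nat (count u (min_tree u))) \<odot>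
       (f (Dt n (min_tree u)) \<otimes> forest_ext (u - {#min_tree u#}) \<ominus>
        lin_ext (\<lambda>w. if size w < size u then forest_ext w else \<zero>)
          (lower_terms n q1 q2 (min_tree u) (u - {#min_tree u#}))))"
  by auto
termination
  by (relation "measure size") (auto simp: min_tree_in size_Diff1_less)

declare forest_ext.simps [simp del]

section \<open>The extension on the basis of forests\<close>

lemma forest_ext_empty: "forest_ext {#} = \<one>"
  by (simp add: forest_ext.simps)

lemma forest_ext_add:
  assumes "min_tree (add_mset t v) = t"
  shows "forest_ext (add_mset t v) = inverse (of_nat (Suc (count v t))) \<odot>
    (f (Dt n t) \<otimes> forest_ext v \<ominus>
     lin_ext (\<lambda>w. if size w < Suc (size v) then forest_ext w else \<zero>) (lower_terms n q1 q2 t v))"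
  by (subst forest_ext.simps) (simp add: assms del: of_nat_Suc)

text \<open>Induction on the number of trees reaches every value that the recursion uses, because
  the guard replaces the others by the zero of the target.\<close>

lemma forest_ext_closed: "u \<in> cforests n \<Longrightarrow> forest_ext u \<in> carrier A"
proof (induction "size u" arbitrary: u rule: less_induct)
  case less
  show ?case
  proof (cases "u = {#}")
    case True
    then show ?thesis by (simp add: forest_ext_empty)
  next
    case False
    let ?t = "min_tree u"
    obtain v where v: "u = add_mset ?t v" using min_tree_in[OF False] by (metis mset_add)
    then have tv: "?t \<in> ctrees n" "v \<in> cforests n" using less.prems by (metis add_mset_in_cforests)+
    have "size u = Suc (size v)" using v by (metis size_add_mset)
    then have "forest_ext v \<in> carrier A" using less.hyps tv(2) by simp
    moreover have "(\<lambda>w. if size w < Suc (size v) then forest_ext w else \<zero>) \<in> cforests n \<rightarrow> carrier A"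
      using less.hyps \<open>size u = Suc (size v)\<close> by auto
    moreover have "min_tree (add_mset ?t v) = ?t" using v by simp
    ultimately have "forest_ext (add_mset ?t v) \<in> carrier A"
      using f_closed[OF Dt_in_tree_span[OF tv(1)]]
      by (simp only: forest_ext_add scale_closed lin_ext_closed minus_closed m_closed)
    then show ?thesis using v by simp
  qed
qed

lemma forest_ext_funcset: "forest_ext \<in> cforests n \<rightarrow> carrier A"
  using forest_ext_closed by blast

abbreviation ext :: "'k functional \<Rightarrow> 'b" where
  "ext \<equiv> lin_ext forest_ext"

lemmas ext_closed = lin_ext_closed[OF forest_ext_funcset]
lemmas ext_comb = lin_ext_comb[OF forest_ext_funcset]
lemmas ext_D = lin_ext_D[OF forest_ext_funcset]

lemma ext_zero: "ext (\<lambda>x. 0) = \<zero>"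
  by (simp add: lin_ext_def)

text \<open>The recursion for \<open>forest_ext\<close> is the product formula solved for its
  leading term; here the solution is put back into the formula.\<close>

lemma ext_Dt_product_min:
  assumes t: "t \<in> ctrees n" and v: "v \<in> cforests n" and min: "min_tree (add_mset t v) = t"
  shows "ext (Dt n t \<star> D n v) = f (Dt n t) \<otimes> ext (D n v)"
proof -
  let ?c = "of_nat (Suc (count v t)) :: 'k"
  let ?L = "lower_terms n q1 q2 t v" and ?X = "f (Dt n t) \<otimes> forest_ext v"
  have u: "add_mset t v \<in> cforests n" using t v by simp
  have X: "?X \<in> carrier A"
    using f_closed[OF Dt_in_tree_span[OF t]] forest_ext_closed[OF v] by simp
  have L: "ext ?L \<in> carrier A" by (rule ext_closed)
  have "size w < Suc (size v)" if "w \<in> cforests n" "coord ?L w \<noteq> 0" for w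
    using coord_lower_terms[OF t v that(1)] that(2) by (metis not_less_eq)
  then have "lin_ext (\<lambda>w. if size w < Suc (size v) then forest_ext w else \<zero>) ?L = ext ?L"
    by (intro lin_ext_cong forest_ext_funcset) auto
  then have u_eq: "forest_ext (add_mset t v) = inverse ?c \<odot> (?X \<ominus> ext ?L)"
    using forest_ext_add[OF min] by simp
  have "ext (Dt n t \<star> D n v) = ?c \<odot> ext (D n (add_mset t v)) \<oplus> 1 \<odot> ext ?L"
    unfolding Dt_product_eq by (rule ext_comb[OF D_in_graded_dual lower_terms_in_graded_dual])
  also have "\<dots> = ?c \<odot> (inverse ?c \<odot> (?X \<ominus> ext ?L)) \<oplus> ext ?L"
    using L by (simp add: ext_D u scale_one u_eq del: of_nat_Suc add_mset_in_cforests)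
  also have "\<dots> = (?X \<ominus> ext ?L) \<oplus> ext ?L"
    using X L by (simp add: scale_mult[symmetric] scale_one del: of_nat_Suc)
  also have "\<dots> = ?X" using X L by (simp add: a_minus_def a_assoc l_neg)
  finally show ?thesis by (simp add: ext_D v)
qed

section \<open>Multiplicativity for left factors from the Lie algebra\<close>

definition good :: "'k functional \<Rightarrow> 'k functional \<Rightarrow> bool" where
  "good y x \<longleftrightarrow> ext (y \<star> x) = f y \<otimes> ext x"

lemma good_comb:
  assumes y: "y \<in> tree_span n" and x: "x \<in> graded_dual_space n" "x' \<in> graded_dual_space n"
    and "good y x" "good y x'"
  shows "good y (\<lambda>z. a * x z + b * x' z)"
proof -
  have yG: "y \<in> graded_dual_space n" using y tree_span_subset by blast
  have "y \<star> (\<lambda>z. a * x z + b * x' z) = (\<lambda>z. a * (y \<star> x) z + b * (y \<star> x') z)"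
    by (simp add: dual_product_add dual_product_scale)
  then have "ext (y \<star> (\<lambda>z. a * x z + b * x' z)) = a \<odot> (f y \<otimes> ext x) \<oplus> b \<odot> (f y \<otimes> ext x')"
    using assms by (simp add: ext_comb dual_product_closed yG good_def)
  also have "\<dots> = f y \<otimes> (a \<odot> ext x \<oplus> b \<odot> ext x')"
    using f_closed[OF y] by (simp add: ext_closed scale_prod_right scale_closed r_distr)
  finally show ?thesis using x by (simp add: good_def ext_comb)
qed

lemma dual_prod_zero: "y \<star> (\<lambda>z. 0) = (\<lambda>z. 0)" "(\<lambda>z. 0) \<star> y = (\<lambda>z. 0)"
  using dual_product_scale(2)[of n q1 q2 y 0 y] dual_product_scale(1)[of n q1 q2 0 y y] by simp_all

lemma good_of_basis:
  assumes y: "y \<in> tree_span n" and x: "x \<in> graded_dual_space n"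
    and basis: "\<And>u. \<lbrakk>u \<in> cforests n; coord x u \<noteq> 0\<rbrakk> \<Longrightarrow> good y (D n u)"
  shows "good y x"
  using x
proof (induction rule: graded_dual_induct)
  case zero
  show ?case using f_closed[OF y] by (simp add: good_def dual_prod_zero ext_zero)
next
  case (comb c u \<psi>)
  then show ?case
    using good_comb[OF y D_in_graded_dual comb(3) basis[OF comb(1,2)] comb(4), of c 1] by simp
qed

text \<open>Linearity in the left factor. It carries the rule from single trees to commutators,
  which are combinations of trees.\<close>

lemma good_tree_span:
  assumes y: "y \<in> tree_span n" and x: "x \<in> graded_dual_space n"
    and trees: "\<And>t. t \<in> ctrees n \<Longrightarrow> good (Dt n t) x"
  shows "good y x"
proof -
  have f0: "f (\<lambda>z. 0) = \<zero>"
    using f_scale[OF tree_span_zero, of 0] f_closed[OF tree_span_zero] by (simp add: scale_zero_left)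
  have "good (\<lambda>z. \<Sum>t\<in>S. c t * Dt n t z) x" if "finite S" "S \<subseteq> ctrees n" for S c
    using that
  proof (induction S rule: finite_induct)
    case empty
    then show ?case by (simp add: good_def dual_prod_zero ext_zero f0 ext_closed)
  next
    case (insert t S)
    let ?y = "\<lambda>z. \<Sum>t\<in>S. c t * Dt n t z"
    have t: "Dt n t \<in> tree_span n" and S: "?y \<in> tree_span n"
      using insert.prems by (auto intro!: tree_span_sum Dt_in_tree_span)
    have yG: "?y \<in> graded_dual_space n" using S tree_span_subset by blast
    have eq: "(\<lambda>z. \<Sum>t\<in>insert t S. c t * Dt n t z) = (\<lambda>z. c t * Dt n t z + ?y z)"
      using insert.hyps by simp
    have "(\<lambda>z. c t * Dt n t z + ?y z) \<star> x = (\<lambda>z. c t * (Dt n t \<star> x) z + 1 * (?y \<star> x) z)"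
      by (simp add: dual_product_add dual_product_scale)
    then have "ext ((\<lambda>z. c t * Dt n t z + ?y z) \<star> x) = c t \<odot> ext (Dt n t \<star> x) \<oplus> 1 \<odot> ext (?y \<star> x)"
      using x yG by (simp only: ext_comb dual_product_closed D_in_graded_dual)
    also have "\<dots> = c t \<odot> (f (Dt n t) \<otimes> ext x) \<oplus> f ?y \<otimes> ext x"
      using insert trees[of t] f_closed[OF S] by (simp add: good_def scale_one ext_closed)
    also have "\<dots> = f (\<lambda>z. c t * Dt n t z + ?y z) \<otimes> ext x"
      using f_closed[OF t] f_closed[OF S]
      by (simp add: f_add f_scale tree_span_scale t S scale_prod_left scale_closed ext_closed l_distr)
    finally show ?case unfolding eq good_def .
  qed
  moreover obtain S c where "finite S" "S \<subseteq> ctrees n" "y = (\<lambda>z. \<Sum>t\<in>S. c t * Dt n t z)"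
    using y unfolding tree_span_def by blast
  ultimately show ?thesis by blast
qed

text \<open>If \<open>t\<close> is not the least tree of \<open>D\<^sub>t \<star> D\<^sub>v\<close>, then \<open>t\<close> is commuted past the least tree \<open>s\<close> of \<open>v\<close>;
  the commutator lies in the Lie algebra, so that all terms arising have fewer trees.\<close>

lemma good_Dt_D: "\<lbrakk>t \<in> ctrees n; v \<in> cforests n\<rbrakk> \<Longrightarrow> good (Dt n t) (D n v)"
proof (induction "size v" arbitrary: t v rule: less_induct)
  case less
  \<comment> \<open>By linearity in both arguments, the induction hypothesis for basis elements
    covers every \<open>y\<close> in the Lie algebra and every \<open>x\<close> supported on forests
    with fewer trees than \<open>v\<close>.\<close>
  have IH: "good y x"
    if y: "y \<in> tree_span n" and x: "x \<in> graded_dual_space n"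
      and supp: "\<And>u. \<lbrakk>u \<in> cforests n; coord x u \<noteq> 0\<rbrakk> \<Longrightarrow> size u < size v" for y x
  proof (rule good_tree_span[OF y x])
    fix t assume t: "t \<in> ctrees n"
    show "good (Dt n t) x"
    proof (rule good_of_basis[OF Dt_in_tree_span[OF t] x])
      fix u assume u: "u \<in> cforests n" "coord x u \<noteq> 0"
      show "good (Dt n t) (D n u)" by (rule less.hyps[OF supp[OF u] t u(1)])
    qed
  qed
  show ?case
  proof (cases "min_tree (add_mset t v) = t")
    case True
    then show ?thesis using ext_Dt_product_min less.prems by (simp add: good_def)
  next
    case False
    then obtain s v' where v: "v = add_mset s v'" and min_v: "min_tree v = s"
      and min_stv': "min_tree (add_mset s (add_mset t v')) = s"
      by (rule min_tree_add_cases)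
    have t: "t \<in> ctrees n" and s: "s \<in> ctrees n" and v': "v' \<in> cforests n" using less.prems v by auto
    let ?t = "Dt n t :: 'k functional" and ?s = "Dt n s :: 'k functional" and ?v' = "D n v' :: 'k functional"
    let ?B = "tree_bracket n q1 q2 ?t ?s"
    note span = Dt_in_tree_span[OF t] Dt_in_tree_span[OF s]
    note fc = f_closed[OF span(1)] f_closed[OF span(2)]
    have G: "?t \<in> graded_dual_space n" "?s \<in> graded_dual_space n" "?v' \<in> graded_dual_space n"
      by (rule D_in_graded_dual)+
    \<comment> \<open>The lower terms have at most as many trees as \<open>v'\<close>, hence fewer
      than \<open>v\<close>.\<close>
    have low: "good y (lower_terms n q1 q2 r v')" if "y \<in> tree_span n" "r \<in> ctrees n" for y r
      using that(1) lower_terms_in_graded_dual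
    proof (rule IH)
      fix u assume "u \<in> cforests n" "coord (lower_terms n q1 q2 r v') u \<noteq> 0"
      then have "\<not> size v' < size u" using coord_lower_terms[OF that(2) v'] by blast
      then show "size u < size v" using v by simp
    qed
    have good_v': "good y ?v'" if "y \<in> tree_span n" for y
      by (rule IH[OF that D_in_graded_dual]) (auto simp: coord_D v split: if_splits)
    \<comment> \<open>The forest \<open>add_mset t v'\<close> has as many trees as \<open>v\<close>,
      beyond the reach of the induction hypothesis. Here the rule holds because \<open>s\<close> is
      the least tree of the product.\<close>
    have "good ?s (D n (add_mset t v'))"
      using ext_Dt_product_min[OF s _ min_stv'] t v' by (simp add: good_def)
    then have "good ?s (?t \<star> ?v')"
      unfolding Dt_product_eq
      by (intro good_comb low span t D_in_graded_dual lower_terms_in_graded_dual)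
    then have st: "ext (?s \<star> (?t \<star> ?v')) = f ?s \<otimes> (f ?t \<otimes> ext ?v')"
      using good_v'[OF span(1)] by (simp add: good_def)
    have B: "?B \<in> tree_span n" by (rule tree_bracket_closed)
    have BG: "?B \<in> graded_dual_space n" using B tree_span_subset by blast
    \<comment> \<open>After multiplication by \<open>?v'\<close>, the first summand is settled by
      the minimality of \<open>s\<close> and the second by the induction hypothesis, as
      \<open>?B\<close> lies in the Lie algebra and \<open>v'\<close> has fewer trees than
      \<open>v\<close>.\<close>
    have "?t \<star> ?s = (\<lambda>x. (?s \<star> ?t) x + ?B x)"
      by (simp add: tree_bracket_commutator span)
    then have "?t \<star> (?s \<star> ?v') = (\<lambda>x. (?s \<star> ?t) x + ?B x) \<star> ?v'"
      using dual_product_assoc[OF G(1,2,3), of q1 q2] by simp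
    also have "\<dots> = (\<lambda>x. 1 * (?s \<star> (?t \<star> ?v')) x + 1 * (?B \<star> ?v') x)"
      by (simp add: dual_product_add dual_product_assoc G)
    finally have "ext (?t \<star> (?s \<star> ?v')) = 1 \<odot> ext (?s \<star> (?t \<star> ?v')) \<oplus> 1 \<odot> ext (?B \<star> ?v')"
      using G BG by (simp only: ext_comb dual_product_closed)
    also have "\<dots> = f ?s \<otimes> (f ?t \<otimes> ext ?v') \<oplus> f ?B \<otimes> ext ?v'"
      using st good_v'[OF B] by (simp add: good_def scale_one ext_closed fc f_closed[OF B])
    also have "\<dots> = f ?t \<otimes> (f ?s \<otimes> ext ?v')"
    proof -
      have "f ?s \<otimes> (f ?t \<otimes> ext ?v') \<oplus> (f ?t \<otimes> f ?s \<ominus> f ?s \<otimes> f ?t) \<otimes> ext ?v' =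
          (f ?s \<otimes> f ?t \<oplus> (f ?t \<otimes> f ?s \<ominus> f ?s \<otimes> f ?t)) \<otimes> ext ?v'"
        using fc by (simp add: l_distr m_assoc ext_closed)
      also have "f ?s \<otimes> f ?t \<oplus> (f ?t \<otimes> f ?s \<ominus> f ?s \<otimes> f ?t) = f ?t \<otimes> f ?s"
        using fc a_lcomm[of "f ?s \<otimes> f ?t" "f ?t \<otimes> f ?s" "\<ominus> (f ?s \<otimes> f ?t)"]
        by (simp add: a_minus_def r_neg)
      finally show ?thesis using fc by (simp add: f_bracket span m_assoc ext_closed)
    qed
    also have "\<dots> = f ?t \<otimes> ext (?s \<star> ?v')"
      using good_v'[OF span(2)] by (simp add: good_def)
    finally have "good ?t (?s \<star> ?v')" by (simp add: good_def)
    \<comment> \<open>The basis element for \<open>v\<close> is a combination of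
      \<open>?s \<star> ?v'\<close> and lower terms, for both of which the rule is now
      known.\<close>
    then show ?thesis
      unfolding v D_eq[of n s v' q1 q2]
      by (intro good_comb low span s dual_product_closed D_in_graded_dual lower_terms_in_graded_dual)
  qed
qed

section \<open>The extension as an algebra homomorphism, and its uniqueness\<close>

lemma ext_tree_product:
  assumes "y \<in> tree_span n" "x \<in> graded_dual_space n"
  shows "ext (y \<star> x) = f y \<otimes> ext x"
proof -
  have "good (Dt n t) x" if "t \<in> ctrees n" for t
    using good_of_basis[OF Dt_in_tree_span[OF that] assms(2)] good_Dt_D[OF that] by blast
  with good_tree_span[OF assms] show ?thesis by (simp add: good_def)
qed

lemma ext_one: "ext (D n {#}) = \<one>"
  by (simp add: ext_D forest_ext_empty)

text \<open>Multiply \<open>y\<close> by the unit \<open>D n {#}\<close>, whose image is the unit of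
  the target.\<close>

lemma ext_tree_span:
  assumes y: "y \<in> tree_span n"
  shows "ext y = f y"
proof -
  have "y \<in> graded_dual_space n" using y tree_span_subset by blast
  then show ?thesis
    using ext_tree_product[OF y D_in_graded_dual, of "{#}"] f_closed[OF y]
    by (simp add: dual_product_one ext_one)
qed

text \<open>Induction over the generation of the left factor by trees: associativity exposes each
  tree as the outermost left factor, where the rule for elements of the Lie algebra applies.\<close>

lemma ext_product:
  assumes x: "x \<in> graded_dual_space n" and y: "y \<in> graded_dual_space n"
  shows "ext (x \<star> y) = ext x \<otimes> ext y"
  using x
proof (induction rule: graded_dual_generated[of x n _ q1 q2, consumes 1, case_names one comb mult])
  case one
  show ?case using y by (simp add: dual_product_one ext_one ext_closed)
next
  case (comb a b \<phi> \<psi>)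
  have "(\<lambda>x. a * \<phi> x + b * \<psi> x) \<star> y = (\<lambda>x. a * (\<phi> \<star> y) x + b * (\<psi> \<star> y) x)"
    by (simp add: dual_product_add dual_product_scale)
  then have "ext ((\<lambda>x. a * \<phi> x + b * \<psi> x) \<star> y) = a \<odot> (ext \<phi> \<otimes> ext y) \<oplus> b \<odot> (ext \<psi> \<otimes> ext y)"
    using comb y by (simp add: ext_comb dual_product_closed)
  then show ?case
    using comb by (simp add: ext_comb ext_closed scale_closed l_distr scale_prod_left)
next
  case (mult t \<phi>)
  note t = Dt_in_tree_span[OF mult(1)]
  have "ext (Dt n t \<star> \<phi> \<star> y) = ext (Dt n t \<star> (\<phi> \<star> y))"
    using mult(2) y by (simp add: dual_product_assoc D_in_graded_dual)
  also have "\<dots> = f (Dt n t) \<otimes> (ext \<phi> \<otimes> ext y)"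
    using mult y by (simp add: ext_tree_product t dual_product_closed)
  finally show ?case
    using mult(2) f_closed[OF t] by (simp add: ext_tree_product t m_assoc ext_closed)
qed

lemma ex1_extension:
  "\<exists>!F. F \<in> algebra_hom ring_of_type_algebra (graded_dual n q1 q2) A \<and>
     F \<in> extensional (carrier (graded_dual n q1 q2)) \<and>
     (\<forall>\<phi>\<in>carrier (tree_lie n q1 q2). F \<phi> = f \<phi>)"
proof (rule ex1I)
  \<comment> \<open>Restricting makes the map extensional, so that uniqueness concerns the values on
    the graded dual only.\<close>
  let ?F = "restrict ext (graded_dual_space n)"
  have add: "ext (\<lambda>x. \<phi> x + \<psi> x) = ext \<phi> \<oplus> ext \<psi>"
    if "\<phi> \<in> graded_dual_space n" "\<psi> \<in> graded_dual_space n" for \<phi> \<psi>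
    using ext_comb[OF that, of 1 1] by (simp add: scale_one ext_closed)
  have scale: "ext (\<lambda>x. c * \<phi> x) = c \<odot> ext \<phi>" if "\<phi> \<in> graded_dual_space n" for c \<phi>
    using ext_comb[OF that that, of c 0] by (simp add: scale_zero_left scale_closed ext_closed)
  show "?F \<in> algebra_hom ring_of_type_algebra (graded_dual n q1 q2) A \<and>
      ?F \<in> extensional (carrier (graded_dual n q1 q2)) \<and>
      (\<forall>\<phi>\<in>carrier (tree_lie n q1 q2). ?F \<phi> = f \<phi>)"
    using tree_span_subset
    by (auto simp: algebra_hom_def ring_hom_def ext_closed dual_product_closed ext_product
        graded_dual_add graded_dual_scale D_in_graded_dual add scale ext_one ext_tree_span subset_eq)
next
  fix H
  assume H: "H \<in> algebra_hom ring_of_type_algebra (graded_dual n q1 q2) A \<and>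
     H \<in> extensional (carrier (graded_dual n q1 q2)) \<and>
     (\<forall>\<phi>\<in>carrier (tree_lie n q1 q2). H \<phi> = f \<phi>)"
  have H_add: "H (\<lambda>x. \<phi> x + \<psi> x) = H \<phi> \<oplus> H \<psi>"
    and H_mult: "H (\<phi> \<star> \<psi>) = H \<phi> \<otimes> H \<psi>"
    if "\<phi> \<in> graded_dual_space n" "\<psi> \<in> graded_dual_space n" for \<phi> \<psi>
    using H that by (auto simp: algebra_hom_def ring_hom_def)
  have H_scale: "H (\<lambda>x. c * \<phi> x) = c \<odot> H \<phi>" if "\<phi> \<in> graded_dual_space n" for c \<phi>
    using H that by (auto simp: algebra_hom_def)
  \<comment> \<open>The values of \<open>H\<close> are forced on the unit, under linear combinations
    and under left multiplication by trees, and these exhaust the dual.\<close>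
  have "H \<phi> = ext \<phi>" if "\<phi> \<in> graded_dual_space n" for \<phi>
    using that
  proof (induction rule: graded_dual_generated[of \<phi> n _ q1 q2, consumes 1, case_names one comb mult])
    case one
    show ?case using H by (simp add: algebra_hom_def ring_hom_def ext_one)
  next
    case (comb a b \<phi> \<psi>)
    then show ?case by (simp add: H_add H_scale graded_dual_scale ext_comb)
  next
    case (mult t \<phi>)
    then show ?case
      using H by (simp add: H_mult D_in_graded_dual ext_tree_product Dt_in_tree_span)
  qed
  then show "H = restrict ext (graded_dual_space n)"
    using H by (intro extensionalityI[of _ "graded_dual_space n"]) auto
qed

end

theorem corollary5p1:
  fixes n :: nat and q1 q2 :: "nat \<Rightarrow> 'k::field_char_0"
  shows "universal_enveloping_algebra TYPE('b) (ring_of_type_algebra :: 'k ring)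
           (tree_lie n q1 q2) (tree_bracket n q1 q2) (graded_dual n q1 q2) (\<lambda>\<phi>. \<phi>) \<and>
         (\<forall>s\<in>ctrees n. \<forall>t\<in>ctrees n.
            tree_bracket n q1 q2 (Dt n s) (Dt n t) =
              (\<lambda>x. bullet n q1 q2 t s x - bullet n q1 q2 s t x)) \<and>
         (\<forall>\<phi>\<in>tree_span n. primitive_functional n (\<phi> :: 'k functional))"
proof (intro conjI ballI)
  \<comment> \<open>The inclusion respects brackets because the bracket on the span of the trees is
    the commutator of the dual product.\<close>
  have "(\<lambda>\<phi>. \<phi>) \<in> lie_to_assoc_hom (ring_of_type_algebra :: 'k ring)
      (tree_lie n q1 q2) (tree_bracket n q1 q2) (graded_dual n q1 q2)"
    using tree_span_subset[of n]
    by (auto simp: lie_to_assoc_hom_def tree_bracket_commutator graded_dual_minus dual_product_closed subset_eq)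
  moreover have "\<exists>!F. F \<in> algebra_hom ring_of_type_algebra (graded_dual n q1 q2) A \<and>
      F \<in> extensional (carrier (graded_dual n q1 q2)) \<and>
      (\<forall>\<phi>\<in>carrier (tree_lie n q1 q2). F \<phi> = f \<phi>)"
    if "assoc_algebra (ring_of_type_algebra :: 'k ring) A"
      "f \<in> lie_to_assoc_hom ring_of_type_algebra (tree_lie n q1 q2) (tree_bracket n q1 q2) A"
    for A :: "('k, 'b) module" and f
  proof -
    interpret tree_lie_hom A n q1 q2 f
      using that by (intro tree_lie_hom.intro tree_lie_hom_axioms.intro)
    show ?thesis by (rule ex1_extension)
  qed
  ultimately show "universal_enveloping_algebra TYPE('b) (ring_of_type_algebra :: 'k ring)
      (tree_lie n q1 q2) (tree_bracket n q1 q2) (graded_dual n q1 q2) (\<lambda>\<phi>. \<phi>)"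
    unfolding universal_enveloping_algebra_def
    using tree_lie_algebra graded_dual_assoc_algebra by blast
qed (simp_all add: tree_bracket_Dt tree_span_primitive)

end
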